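(* A shift space $X$ is a minimal dendric shift over $\mathcal{A}_3=\{1,2,3\}$ if and only if there exist a permutation $\pi_0\in\Sigma_3$, a sequence $(\sigma_n)_{n\ge1}$ of morphisms in $\Sigma_3\mathcal{S}_3\Sigma_3$ and a sequence $(v_n)_{n\ge 1}$ of vertices of the graph $\mathcal{G}$ described below such that, for every $n\ge1$, $\sigma_n$ labels an edge of $\mathcal{G}$ from $v_n$ to $v_{n+1}$, and the directive sequence $(\pi_0,\sigma_1,\sigma_2,\dots)$ is primitive and is an $\mathcal{S}$-adic representation of $X$ (i.e. $X$ is the shift generated by it).
   Context: A shift space over a finite alphabet $\mathcal{A}$ is a closed subset $X\subseteq\mathcal{A}^{\mathbb{Z}}$ invariant under the shift map $S((x_n)_n)=(x_{n+1})_n$, in which every letter of $\mathcal{A}$ occurs; $\mathcal{L}(X)$ is the set of finite words (including the empty word $\varepsilon$) occurring in elements of $X$. $X$ is minimal if the only closed shift-invariant subsets are $\emptyset$ and $X$. For $w\in\mathcal{L}(X)$, the extension graph $\mathcal{E}_X(w)$ is the bipartite graph whose left vertices are the letters $a$ with $aw\in\mathcal{L}(X)$, whose right vertices are the letters $b$ with $wb\in\mathcal{L}(X)$ (left and right copies are disjoint), and with an edge between $a$ and $b$ whenever $awb\in\mathcal{L}(X)$. $X$ is dendric if $\mathcal{E}_X(w)$ is a tree for every $w\in\mathcal{L}(X)$. Morphisms are non-erasing monoid morphisms between free monoids. A directive sequence is a sequence $\boldsymbol\sigma=(\sigma_n:\mathcal{A}_{n+1}^*\to\mathcal{A}_n^*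 )_{n\ge1}$ of morphisms; $\sigma_{[n,N)}=\sigma_n\circ\cdots\circ\sigma_{N-1}$. It is primitive if for every $n$ there is $N>n$ such that every letter of $\mathcal{A}_n$ occurs in $\sigma_{[n,N)}(b)$ for every $b\in\mathcal{A}_N$. For primitive $\boldsymbol\sigma$, $\mathcal{L}^{(n)}(\boldsymbol\sigma)$ is the set of words occurring in some $\sigma_{[n,N)}(a)$, $N>n$, $a\in\mathcal{A}_N$, and the shift generated by $\boldsymbol\sigma$ is $X_{\boldsymbol\sigma}=\{x\in\mathcal{A}_1^{\mathbb{Z}}: \text{every factor of } x \text{ lies in } \mathcal{L}^{(1)}(\boldsymbol\sigma)\}$; $\boldsymbol\sigma$ is then an ($\mathcal{S}$-adic) representation of $X_{\boldsymbol\sigma}$. For $\{a,b,c\}=\{1,2,3\}$, $\pi_{abc}$ is the morphism $1\mapsto a,2\mapsto b,3\mapsto c$; $\Sigma_3$ is the set of these six permutations. Juxtaposition denotes composition. $\mathcal{S}_3=\{\alpha,\beta,\gamma,\eta\}\cup\{\delta^{(k)},\zeta^{(k)}:k\ge1\}$ where $\alpha:1\mapsto1,2\mapsto12,3\mapsto13$; $\beta:1\mapsto1,2\mapsto12,3\mapsto132$; $\gamma:1\mapsto1,2\mapsto12,3\mapsto123$; $\delta^{(k)}:1\mapsto1,2\mapsto123^k,3\mapsto123^{k+1}$; $\zeta^{(k)}:1\mapsto13^k,2\mapsto12,3\mapsto13^{k+1}$; $\eta:1\mapsto13,2\mapsto12,3\mapsto123$. $\Sigma_3\mathcal{S}_3\Sigma_3=\{\pi\sigma\pi':\pi,\pi'\in\Sigma_3,\sigma\in\mathcal{S}_3\}$.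 The graph $\mathcal{G}$ has two vertices $[3,2]$ and $[3,3]$ (and, for each vertex, an entering edge labeled by each permutation, which corresponds to $\pi_0$). Its edges (with $k$ ranging over all integers $\ge1$) are: loops at $[3,2]$ labeled $\alpha$, $\pi_{213}\alpha\pi_{213}$, $\pi_{321}\alpha\pi_{321}$, $\pi_{321}\beta$, $\pi_{312}\beta\pi_{132}$, $\pi_{213}\gamma$, $\pi_{231}\gamma\pi_{132}$, $\pi_{213}\delta^{(k)}$, $\pi_{213}\delta^{(k)}\pi_{132}$, $\pi_{132}\eta$, $\pi_{132}\eta\pi_{231}$, $\pi_{132}\eta\pi_{321}$; loops at $[3,3]$ labeled $\alpha$, $\pi_{213}\alpha\pi_{213}$, $\pi_{321}\alpha\pi_{321}$, $\zeta^{(k)}\pi_{213}$, $\pi_{213}\zeta^{(k)}\pi_{213}$, $\zeta^{(k)}\pi_{231}$, $\pi_{213}\zeta^{(k)}\pi_{231}$; edges from $[3,2]$ to $[3,3]$ labeled $\pi_{312}\beta\pi_{213}$, $\pi_{321}\beta\pi_{312}$, $\pi_{213}\gamma$, $\pi_{231}\gamma\pi_{132}$, $\pi_{213}\delta^{(k)}$, $\pi_{213}\delta^{(k)}\pi_{132}$, $\pi_{132}\eta$; edges from $[3,3]$ to $[3,2]$ labeled $\pi_{312}\beta\pi_{213}$, $\pi_{321}\beta\pi_{213}$, $\pi_{312}\beta\pi_{312}$, $\pi_{321}\beta\pi_{312}$, $\pi_{312}\gamma\pi_{231}$, $\pi_{321}\gamma\pi_{231}$, $\pi_{312}\gamma\pi_{321}$,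 $\pi_{321}\gamma\pi_{321}$, $\zeta^{(k)}\pi_{213}$, $\pi_{213}\zeta^{(k)}\pi_{213}$, $\zeta^{(k)}\pi_{231}$, $\pi_{213}\zeta^{(k)}\pi_{231}$. *)

theory Defs
  imports "HOL-Analysis.Function_Topology" "HOL-Library.Sublist"
begin

section \<open>Shift spaces over a finite alphabet (type 'a, discrete topology)\<close>

(* Points of A^Z are functions int => 'a; A^Z carries the product topology
   (instance from Function_Topology), the alphabet the discrete topology. *)

definition shift :: "(int \<Rightarrow> 'a) \<Rightarrow> (int \<Rightarrow> 'a)" where
  "shift x = (\<lambda>n. x (n + 1))"

definition factor :: "(int \<Rightarrow> 'a) \<Rightarrow> int \<Rightarrow> nat \<Rightarrow> 'a list" where
  "factor x i n = map (\<lambda>k. x (i + int k)) [0..<n]"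

definition shift_space :: "(int \<Rightarrow> 'a::discrete_topology) set \<Rightarrow> bool" where
  "shift_space X \<longleftrightarrow> closed X \<and> shift ` X = X \<and> (\<forall>a. \<exists>x\<in>X. \<exists>i. x i = a)"

definition lang :: "(int \<Rightarrow> 'a) set \<Rightarrow> 'a list set" where
  "lang X = {w. \<exists>x\<in>X. \<exists>i. w = factor x i (length w)}"

definition minimal_shift :: "(int \<Rightarrow> 'a::discrete_topology) set \<Rightarrow> bool" where
  "minimal_shift X \<longleftrightarrow>
     (\<forall>Y. Y \<subseteq> X \<and> closed Y \<and> shift ` Y = Y \<longrightarrow> Y = {} \<or> Y = X)"

section \<open>Simple graphs and trees\<close>

(* a graph is given by a vertex set V and a symmetric adjacency relation adj *)
definition graph_connected :: "'v set \<Rightarrow> ('v \<Rightarrow> 'v \<Rightarrow> bool) \<Rightarrow> bool" where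
  "graph_connected V adj \<longleftrightarrow>
     (\<forall>u\<in>V. \<forall>v\<in>V. (u, v) \<in> {(p, q). p \<in> V \<and> q \<in> V \<and> adj p q}\<^sup>*)"

(* a cycle: at least 3 distinct vertices c0..ck, consecutive ones adjacent, ck adjacent to c0 *)
definition graph_acyclic :: "'v set \<Rightarrow> ('v \<Rightarrow> 'v \<Rightarrow> bool) \<Rightarrow> bool" where
  "graph_acyclic V adj \<longleftrightarrow>
     \<not> (\<exists>cs. length cs \<ge> 3 \<and> distinct cs \<and> set cs \<subseteq> V \<and>
            (\<forall>i. Suc i < length cs \<longrightarrow> adj (cs ! i) (cs ! Suc i)) \<and> adj (last cs) (hd cs))"

definition graph_tree :: "'v set \<Rightarrow> ('v \<Rightarrow> 'v \<Rightarrow> bool) \<Rightarrow> bool" where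
  "graph_tree V adj \<longleftrightarrow> graph_connected V adj \<and> graph_acyclic V adj"

section \<open>Extension graphs and dendric shifts\<close>

(* left copies Inl a, right copies Inr b *)
definition ext_vertices :: "(int \<Rightarrow> 'a) set \<Rightarrow> 'a list \<Rightarrow> ('a + 'a) set" where
  "ext_vertices X w = Inl ` {a. a # w \<in> lang X} \<union> Inr ` {b. w @ [b] \<in> lang X}"

fun ext_adj :: "(int \<Rightarrow> 'a) set \<Rightarrow> 'a list \<Rightarrow> ('a + 'a) \<Rightarrow> ('a + 'a) \<Rightarrow> bool" where
  "ext_adj X w (Inl a) (Inr b) = (a # w @ [b] \<in> lang X)"
| "ext_adj X w (Inr b) (Inl a) = (a # w @ [b] \<in> lang X)"
| "ext_adj X w _ _ = False"

definition dendric :: "(int \<Rightarrow> 'a) set \<Rightarrow> bool" where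
  "dendric X \<longleftrightarrow> (\<forall>w\<in>lang X. graph_tree (ext_vertices X w) (ext_adj X w))"

section \<open>Morphisms and directive sequences (all alphabets equal to UNIV :: 'a set)\<close>

definition wmap :: "('a \<Rightarrow> 'b list) \<Rightarrow> 'a list \<Rightarrow> 'b list" where
  "wmap f w = concat (map f w)"

(* composition of morphisms: (f \<odot> g) a = f(g(a)) ; juxtaposition in the paper *)
definition mcomp :: "('b \<Rightarrow> 'c list) \<Rightarrow> ('a \<Rightarrow> 'b list) \<Rightarrow> ('a \<Rightarrow> 'c list)" (infixl "\<odot>" 55) where
  "f \<odot> g = (\<lambda>a. wmap f (g a))"

definition non_erasing :: "('a \<Rightarrow> 'b list) \<Rightarrow> bool" where
  "non_erasing f \<longleftrightarrow> (\<forall>a. f a \<noteq> [])"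

(* dcomp d n k = sigma_n o ... o sigma_(n+k-1), i.e. sigma_[n, n+k) *)
fun dcomp :: "(nat \<Rightarrow> ('a \<Rightarrow> 'a list)) \<Rightarrow> nat \<Rightarrow> nat \<Rightarrow> ('a \<Rightarrow> 'a list)" where
  "dcomp d n 0 = (\<lambda>a. [a])"
| "dcomp d n (Suc k) = dcomp d n k \<odot> d (n + k)"

definition dseg :: "(nat \<Rightarrow> ('a \<Rightarrow> 'a list)) \<Rightarrow> nat \<Rightarrow> nat \<Rightarrow> ('a \<Rightarrow> 'a list)" where
  "dseg d n N = dcomp d n (N - n)"

(* directive sequence indexed by n >= 1 (d 0 is irrelevant) *)
definition primitive_dir :: "(nat \<Rightarrow> ('a \<Rightarrow> 'a list)) \<Rightarrow> bool" where
  "primitive_dir d \<longleftrightarrow> (\<forall>n\<ge>1. non_erasing (d n)) \<and>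
     (\<forall>n\<ge>1. \<exists>N>n. \<forall>b a. a \<in> set (dseg d n N b))"

definition dlang :: "(nat \<Rightarrow> ('a \<Rightarrow> 'a list)) \<Rightarrow> nat \<Rightarrow> 'a list set" where
  "dlang d n = {w. \<exists>N>n. \<exists>a. sublist w (dseg d n N a)}"

definition gen_shift :: "(nat \<Rightarrow> ('a \<Rightarrow> 'a list)) \<Rightarrow> (int \<Rightarrow> 'a) set" where
  "gen_shift d = {x. \<forall>i n. factor x i n \<in> dlang d 1}"

section \<open>The alphabet A_3 and the morphisms of S_3\<close>

datatype letter = L1 | L2 | L3

instantiation letter :: discrete_topology
begin
definition open_letter :: "letter set \<Rightarrow> bool" where "open_letter (S :: letter set) = True"
instance by standard (simp_all add: open_letter_def)
end

definition mk3 :: "letter list \<Rightarrow> letter list \<Rightarrow> letter list \<Rightarrow> letter \<Rightarrow> letter list" where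
  "mk3 u v w = (\<lambda>c. case c of L1 \<Rightarrow> u | L2 \<Rightarrow> v | L3 \<Rightarrow> w)"

(* pi_abc : 1 -> a, 2 -> b, 3 -> c *)
definition perm3 :: "letter \<Rightarrow> letter \<Rightarrow> letter \<Rightarrow> letter \<Rightarrow> letter list" where
  "perm3 a b c = mk3 [a] [b] [c]"

abbreviation "p123 \<equiv> perm3 L1 L2 L3"
abbreviation "p132 \<equiv> perm3 L1 L3 L2"
abbreviation "p213 \<equiv> perm3 L2 L1 L3"
abbreviation "p231 \<equiv> perm3 L2 L3 L1"
abbreviation "p312 \<equiv> perm3 L3 L1 L2"
abbreviation "p321 \<equiv> perm3 L3 L2 L1"

definition Sigma3 :: "(letter \<Rightarrow> letter list) set" where
  "Sigma3 = {p123, p132, p213, p231, p312, p321}"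

definition mor_alpha :: "letter \<Rightarrow> letter list" where
  "mor_alpha = mk3 [L1] [L1, L2] [L1, L3]"
definition mor_beta :: "letter \<Rightarrow> letter list" where
  "mor_beta = mk3 [L1] [L1, L2] [L1, L3, L2]"
definition mor_gamma :: "letter \<Rightarrow> letter list" where
  "mor_gamma = mk3 [L1] [L1, L2] [L1, L2, L3]"
definition mor_delta :: "nat \<Rightarrow> letter \<Rightarrow> letter list" where
  "mor_delta k = mk3 [L1] ([L1, L2] @ replicate k L3) ([L1, L2] @ replicate (k + 1) L3)"
definition mor_zeta :: "nat \<Rightarrow> letter \<Rightarrow> letter list" where
  "mor_zeta k = mk3 (L1 # replicate k L3) [L1, L2] (L1 # replicate (k + 1) L3)"
definition mor_eta :: "letter \<Rightarrow> letter list" where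
  "mor_eta = mk3 [L1, L3] [L1, L2] [L1, L2, L3]"

definition S3 :: "(letter \<Rightarrow> letter list) set" where
  "S3 = {mor_alpha, mor_beta, mor_gamma, mor_eta} \<union>
        {s. \<exists>k\<ge>1. s = mor_delta k \<or> s = mor_zeta k}"

definition SigmaS3Sigma :: "(letter \<Rightarrow> letter list) set" where
  "SigmaS3Sigma = {p \<odot> s \<odot> p' | p s p'. p \<in> Sigma3 \<and> s \<in> S3 \<and> p' \<in> Sigma3}"

section \<open>The graph G\<close>

datatype vtx = V32 | V33   (* [3,2] and [3,3] *)

definition Gedge :: "vtx \<Rightarrow> (letter \<Rightarrow> letter list) \<Rightarrow> vtx \<Rightarrow> bool" where
  "Gedge v s v' \<longleftrightarrow>
    (v = V32 \<and> v' = V32 \<and>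
      (s \<in> {mor_alpha, p213 \<odot> mor_alpha \<odot> p213, p321 \<odot> mor_alpha \<odot> p321,
             p321 \<odot> mor_beta, p312 \<odot> mor_beta \<odot> p132,
             p213 \<odot> mor_gamma, p231 \<odot> mor_gamma \<odot> p132,
             p132 \<odot> mor_eta, p132 \<odot> mor_eta \<odot> p231, p132 \<odot> mor_eta \<odot> p321}
       \<or> (\<exists>k\<ge>1. s \<in> {p213 \<odot> mor_delta k, p213 \<odot> mor_delta k \<odot> p132})))
  \<or> (v = V33 \<and> v' = V33 \<and>
      (s \<in> {mor_alpha, p213 \<odot> mor_alpha \<odot> p213, p321 \<odot> mor_alpha \<odot> p321}
       \<or> (\<exists>k\<ge>1. s \<in> {mor_zeta k \<odot> p213, p213 \<odot> mor_zeta k \<odot> p213,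
                       mor_zeta k \<odot> p231, p213 \<odot> mor_zeta k \<odot> p231})))
  \<or> (v = V32 \<and> v' = V33 \<and>
      (s \<in> {p312 \<odot> mor_beta \<odot> p213, p321 \<odot> mor_beta \<odot> p312,
             p213 \<odot> mor_gamma, p231 \<odot> mor_gamma \<odot> p132, p132 \<odot> mor_eta}
       \<or> (\<exists>k\<ge>1. s \<in> {p213 \<odot> mor_delta k, p213 \<odot> mor_delta k \<odot> p132})))
  \<or> (v = V33 \<and> v' = V32 \<and>
      (s \<in> {p312 \<odot> mor_beta \<odot> p213, p321 \<odot> mor_beta \<odot> p213,
             p312 \<odot> mor_beta \<odot> p312, p321 \<odot> mor_beta \<odot> p312,
             p312 \<odot> mor_gamma \<odot> p231, p321 \<odot> mor_gamma \<odot> p231,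
             p312 \<odot> mor_gamma \<odot> p321, p321 \<odot> mor_gamma \<odot> p321}
       \<or> (\<exists>k\<ge>1. s \<in> {mor_zeta k \<odot> p213, p213 \<odot> mor_zeta k \<odot> p213,
                       mor_zeta k \<odot> p231, p213 \<odot> mor_zeta k \<odot> p231})))"

(* the directive sequence (pi_0, sigma_1, sigma_2, ...), indexed from 1 *)
definition prepend_dir :: "('a \<Rightarrow> 'a list) \<Rightarrow> (nat \<Rightarrow> ('a \<Rightarrow> 'a list)) \<Rightarrow> nat \<Rightarrow> ('a \<Rightarrow> 'a list)" where
  "prepend_dir p0 s n = (if n \<le> 1 then p0 else s (n - 1))"

end

(* Long left special words of a ternary dendric language are extended to the left by all three
   letters, or they form two families whose left extensions are two pairs with one common letter;
   symmetrically on the right. The vertices of the graph record these common letters. The extension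
   graphs of the image of a language under a morphism of S_3 are the images of its extension graphs
   under partial maps of letters, and trees go to trees exactly when glued letters have a common
   neighbour, which is what the common letters prescribed by the vertices guarantee. Along a path of
   the graph the extension graph of a word is thus controlled by that of a shorter word one level up,
   and induction on the length, for all levels at once, shows that all extension graphs are trees.
   Conversely, the extension graph of the empty word of a minimal dendric shift determines a return
   morphism; the desubstituted language is again dendric, and its common letters give the next vertex.
   Primitivity is automatic: otherwise some level would contain all powers of a letter. *)
theory Submission
  imports Defs
begin

section \<open>Bipartite graphs on two copies of the alphabet\<close>

text \<open>Two left vertices of a tree can be glued without destroying it exactly when their
  distance is two: a vertex and an edge then disappear together, whereas a larger distance closes a
  cycle. A map that glues two letters always comes with a second map, defined on these two letters
  only, whose image is connected exactly when they have a common neighbour, if both occur; so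
  treeness below recovers the condition above. The obstacle is that this condition must hold in all
  extension graphs of a level at once and cannot be read off one of them. One letter per side is
  enough information because a pair with a common neighbour in every extension graph contains a
  letter that has one with every other letter. Words avoiding the first letter of all images see no
  word of the level above; their graphs come from the images of single letters and are the base of
  the induction. Everything is done on languages of finite words, so that intermediate levels need
  no shift spaces; topology enters only for the shift \<open>X\<close> itself.\<close>

lemma letter_all: "(\<forall>x. P x) \<longleftrightarrow> P L1 \<and> P L2 \<and> P L3"
  by (metis letter.exhaust)

lemma letter_ex: "(\<exists>x. P x) \<longleftrightarrow> P L1 \<or> P L2 \<or> P L3"
  by (metis letter.exhaust)

text \<open>A relation \<open>M\<close> on letters encodes the bipartite graph with an edge from the left copy of \<open>a\<close>
  to the right copy of \<open>b\<close> for \<open>M a b\<close>. Isolated vertices are dropped: in a language whose words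
  all extend to both sides, extension graphs have none.\<close>

definition share :: "(letter \<Rightarrow> letter \<Rightarrow> bool) \<Rightarrow> letter \<Rightarrow> letter \<Rightarrow> bool" where
  "share M a b \<longleftrightarrow> (\<exists>x. M a x \<and> M b x)"

definition row :: "(letter \<Rightarrow> letter \<Rightarrow> bool) \<Rightarrow> letter \<Rightarrow> bool" where
  "row M a \<longleftrightarrow> (\<exists>x. M a x)"

text \<open>With three letters on each side, a bipartite graph can only have cycles of length 4 and
  6; the two clauses exclude these.\<close>

definition acyclic3 :: "(letter \<Rightarrow> letter \<Rightarrow> bool) \<Rightarrow> bool" where
  "acyclic3 M \<longleftrightarrow>
     (\<forall>a b x y. M a x \<and> M b x \<and> M a y \<and> M b y \<longrightarrow> a = b \<or> x = y) \<and>
     (\<forall>a b c x y z. M a x \<and> M b x \<and> M b y \<and> M c y \<and> M c z \<and> M a z \<longrightarrow>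
        a = b \<or> b = c \<or> a = c \<or> x = y \<or> y = z \<or> x = z)"

text \<open>With three letters, a chain of left letters with common neighbours needs at most one
  intermediate letter. Right vertices are covered because each is adjacent to a left one.\<close>

definition connected3 :: "(letter \<Rightarrow> letter \<Rightarrow> bool) \<Rightarrow> bool" where
  "connected3 M \<longleftrightarrow>
     (\<forall>a b. row M a \<and> row M b \<longrightarrow> share M a b \<or> (\<exists>c. share M a c \<and> share M c b))"

definition tree3 :: "(letter \<Rightarrow> letter \<Rightarrow> bool) \<Rightarrow> bool" where
  "tree3 M \<longleftrightarrow> acyclic3 M \<and> connected3 M"

text \<open>If all words \<open>w\<close> satisfy \<open>pers (ext L w) a b\<close>, then every word that \<open>a\<close> and \<open>b\<close> extend to the
  left is a prefix of longer and longer words with this property. The left extensions of the long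
  left special words of a ternary dendric language are either one full alphabet or two pairs; the
  condition on \<open>l\<close> in \<open>good l r M\<close>, imposed on all extension graphs, says that \<open>l\<close> is the letter
  common to the two pairs whenever the second case occurs. A vertex [3,2] of the graph stands for
  \<open>l = 3\<close>, \<open>r = 2\<close>, and [3,3] for \<open>l = r = 3\<close>.\<close>

definition pers :: "(letter \<Rightarrow> letter \<Rightarrow> bool) \<Rightarrow> letter \<Rightarrow> letter \<Rightarrow> bool" where
  "pers M a b \<longleftrightarrow> (row M a \<and> row M b \<longrightarrow> share M a b)"

definition good :: "letter \<Rightarrow> letter \<Rightarrow> (letter \<Rightarrow> letter \<Rightarrow> bool) \<Rightarrow> bool" where
  "good l r M \<longleftrightarrow> tree3 M \<and> (\<forall>b. pers M l b) \<and> (\<forall>b. pers M\<inverse>\<inverse> r b)"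


section \<open>Explicit forms in terms of the nine possible edges\<close>

lemma two_letters:
  assumes "a \<noteq> (b::letter)"
  obtains "a = L1" "b = L2" | "a = L1" "b = L3" | "a = L2" "b = L1" | "a = L2" "b = L3"
    | "a = L3" "b = L1" | "a = L3" "b = L2"
  using assms by (cases a; cases b) auto

lemma three_letters:
  assumes "a \<noteq> b" "b \<noteq> c" "a \<noteq> (c::letter)"
  obtains "a = L1" "b = L2" "c = L3" | "a = L1" "b = L3" "c = L2" | "a = L2" "b = L1" "c = L3"
    | "a = L2" "b = L3" "c = L1" | "a = L3" "b = L1" "c = L2" | "a = L3" "b = L2" "c = L1"
  using assms by (cases a; cases b; cases c) auto

text \<open>The complete bipartite graph on 3 + 3 vertices has nine 4-cycles and six 6-cycles.
  Spelled out, treeness is a propositional formula in the nine atoms \<open>M a b\<close>, so the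
  finite claims about graphs become decidable.\<close>

lemma acyclic3_explicit: "acyclic3 M \<longleftrightarrow>
  \<not> (M L1 L1 \<and> M L1 L2 \<and> M L2 L1 \<and> M L2 L2) \<and>
  \<not> (M L1 L1 \<and> M L1 L3 \<and> M L2 L1 \<and> M L2 L3) \<and>
  \<not> (M L1 L2 \<and> M L1 L3 \<and> M L2 L2 \<and> M L2 L3) \<and>
  \<not> (M L1 L1 \<and> M L1 L2 \<and> M L3 L1 \<and> M L3 L2) \<and>
  \<not> (M L1 L1 \<and> M L1 L3 \<and> M L3 L1 \<and> M L3 L3) \<and>
  \<not> (M L1 L2 \<and> M L1 L3 \<and> M L3 L2 \<and> M L3 L3) \<and>
  \<not> (M L2 L1 \<and> M L2 L2 \<and> M L3 L1 \<and> M L3 L2) \<and>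
  \<not> (M L2 L1 \<and> M L2 L3 \<and> M L3 L1 \<and> M L3 L3) \<and>
  \<not> (M L2 L2 \<and> M L2 L3 \<and> M L3 L2 \<and> M L3 L3) \<and>
  \<not> (M L1 L2 \<and> M L1 L3 \<and> M L2 L1 \<and> M L2 L3 \<and> M L3 L1 \<and> M L3 L2) \<and>
  \<not> (M L1 L2 \<and> M L1 L3 \<and> M L2 L1 \<and> M L2 L2 \<and> M L3 L1 \<and> M L3 L3) \<and>
  \<not> (M L1 L1 \<and> M L1 L3 \<and> M L2 L2 \<and> M L2 L3 \<and> M L3 L1 \<and> M L3 L2) \<and>
  \<not> (M L1 L1 \<and> M L1 L3 \<and> M L2 L1 \<and> M L2 L2 \<and> M L3 L2 \<and> M L3 L3) \<and>
  \<not> (M L1 L1 \<and> M L1 L2 \<and> M L2 L2 \<and> M L2 L3 \<and> M L3 L1 \<and> M L3 L3) \<and>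
  \<not> (M L1 L1 \<and> M L1 L2 \<and> M L2 L1 \<and> M L2 L3 \<and> M L3 L2 \<and> M L3 L3)"
  (is "_ \<longleftrightarrow> ?E")
proof
  assume ?E
  have 4: False if "a \<noteq> b" "x \<noteq> y" "M a x" "M b x" "M a y" "M b y" for a b x y
    using that(1)
  proof (cases rule: two_letters)
  qed (use that(2) in \<open>cases rule: two_letters; use that(3-) \<open>?E\<close> in simp\<close>)+
  have 6: False if "a \<noteq> b" "b \<noteq> c" "a \<noteq> c" "x \<noteq> y" "y \<noteq> z" "x \<noteq> z" "M a x" "M b x" "M b y" "M c y" "M c z" "M a z" for a b c x y z
    using that(1-3)
  proof (cases rule: three_letters)
  qed (use that(4-6) in \<open>cases rule: three_letters; use that(7-) \<open>?E\<close> in simp\<close>)+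
  show "acyclic3 M" unfolding acyclic3_def using 4 6 by meson
next
  assume "acyclic3 M"
  then have 4: "\<And>a b x y. a \<noteq> b \<Longrightarrow> x \<noteq> y \<Longrightarrow> \<lbrakk>M a x; M b x; M a y; M b y\<rbrakk> \<Longrightarrow> False"
   and 6: "\<And>a b c x y z. a \<noteq> b \<Longrightarrow> b \<noteq> c \<Longrightarrow> a \<noteq> c \<Longrightarrow> x \<noteq> y \<Longrightarrow> y \<noteq> z \<Longrightarrow> x \<noteq> z \<Longrightarrow> \<lbrakk>M a x; M b x; M b y; M c y; M c z; M a z\<rbrakk> \<Longrightarrow> False"
     unfolding acyclic3_def by meson+
  show ?E
    apply (intro conjI notI; elim conjE)
    using 4 6[of L1 L2 L3] by (simp_all, (metis letter.distinct)+)
qed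

lemma connected3_explicit: "connected3 M \<longleftrightarrow>
   (row M L1 \<and> row M L2 \<longrightarrow> share M L1 L2 \<or> share M L1 L3 \<and> share M L2 L3) \<and>
   (row M L1 \<and> row M L3 \<longrightarrow> share M L1 L3 \<or> share M L1 L2 \<and> share M L2 L3) \<and>
   (row M L2 \<and> row M L3 \<longrightarrow> share M L2 L3 \<or> share M L1 L2 \<and> share M L1 L3)"
proof -
  have "share M a b \<longleftrightarrow> share M b a" "share M a a \<longleftrightarrow> row M a"  for a b by (auto simp: share_def row_def)
  then show ?thesis
  unfolding connected3_def letter_all letter_ex
  by (smt (verit, best))
qed

lemma pers_explicit: "(\<forall>b. pers M L1 b) \<longleftrightarrow> pers M L1 L2 \<and> pers M L1 L3"
  "(\<forall>b. pers M L2 b) \<longleftrightarrow> pers M L2 L1 \<and> pers M L2 L3"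
  "(\<forall>b. pers M L3 b) \<longleftrightarrow> pers M L3 L1 \<and> pers M L3 L2"
  by (auto simp: letter_all pers_def share_def row_def)

lemmas bool_simps = tree3_def acyclic3_explicit connected3_explicit good_def pers_explicit pers_def share_def row_def
   letter_ex conversep_iff

lemma tree3_conv: "tree3 M \<Longrightarrow> tree3 M\<inverse>\<inverse>"
  unfolding bool_simps by (smt (verit))

section \<open>Effect of the morphisms on extension graphs\<close>

definition pmap :: "letter option \<Rightarrow> letter option \<Rightarrow> letter option \<Rightarrow> letter \<Rightarrow> letter \<Rightarrow> bool" where
  "pmap x y z c a \<longleftrightarrow> (case c of L1 \<Rightarrow> x | L2 \<Rightarrow> y | L3 \<Rightarrow> z) = Some a"

definition left_image :: "(letter \<Rightarrow> letter \<Rightarrow> bool) \<Rightarrow> (letter \<Rightarrow> letter \<Rightarrow> bool) \<Rightarrow> letter \<Rightarrow> letter \<Rightarrow> bool" where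
  "left_image f M a x \<longleftrightarrow> (\<exists>c. M c x \<and> f c a)"

definition img :: "(letter \<Rightarrow> letter \<Rightarrow> bool) \<Rightarrow> (letter \<Rightarrow> letter \<Rightarrow> bool) \<Rightarrow> (letter \<Rightarrow> letter \<Rightarrow> bool) \<Rightarrow> letter \<Rightarrow> letter \<Rightarrow> bool" where
  "img f g M a b \<longleftrightarrow> (\<exists>c d. M c d \<and> f c a \<and> g d b)"

lemma img_left_image: "img f g M = left_image f (left_image g M\<inverse>\<inverse>)\<inverse>\<inverse>"
  by (intro ext) (auto simp: img_def left_image_def)

text \<open>On left vertices, the morphisms act either injectively (\<open>b = c\<close>) or by two maps, one gluing \<open>b\<close> and
  \<open>c\<close> and one defined on \<open>b\<close> and \<open>c\<close> only. The clauses say that treeness and the common letters can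
  be transported along these maps in both directions.\<close>

definition merging :: "(letter \<Rightarrow> letter \<Rightarrow> bool) set \<Rightarrow> letter \<Rightarrow> letter \<Rightarrow> letter \<Rightarrow> bool" where
  "merging F b c l \<longleftrightarrow>
     (\<forall>M. tree3 M \<and> pers M b c \<longleftrightarrow> (\<forall>f\<in>F. tree3 (left_image f M))) \<and>
     (\<forall>M r d. tree3 M \<and> pers M b c \<longrightarrow>
        (pers M\<inverse>\<inverse> r d \<longleftrightarrow> (\<forall>f\<in>F. pers (left_image f M)\<inverse>\<inverse> r d))) \<and>
     (\<forall>M l'. tree3 M \<and> l' \<in> {b, c} \<and> (\<forall>d. pers M l' d) \<longrightarrow> (\<forall>f\<in>F. \<forall>d. pers (left_image f M) l d)) \<and>
     (\<forall>M. b = c \<and> (\<forall>f\<in>F. \<forall>d. pers (left_image f M) l d) \<longrightarrow> (\<forall>d. pers M b d))"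

lemma pers_sym: "pers M a b \<longleftrightarrow> pers M b a"
  by (auto simp: pers_def share_def)

lemma pers_refl: "pers M a a"
  by (auto simp: pers_def share_def row_def)

text \<open>Reduces \<open>merging\<close> to finitely many propositional statements: symmetry and
  reflexivity of \<open>pers\<close> leave three pairs of columns, and the last clause of
  \<open>merging\<close> is vacuous for \<open>b \<noteq> c\<close>.\<close>

lemma mergingI:
  assumes "\<And>M. tree3 M \<Longrightarrow> pers M b c \<Longrightarrow> tree3 (left_image f M) \<and> tree3 (left_image g M)"
    and "\<And>M. tree3 (left_image f M) \<Longrightarrow> tree3 (left_image g M) \<Longrightarrow> tree3 M \<and> pers M b c"
    and col: "\<And>M. tree3 M \<Longrightarrow> pers M b c \<Longrightarrow>
        pers M\<inverse>\<inverse> L1 L2 \<longleftrightarrow> pers (left_image f M)\<inverse>\<inverse> L1 L2 \<and> pers (left_image g M)\<inverse>\<inverse> L1 L2"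
      "\<And>M. tree3 M \<Longrightarrow> pers M b c \<Longrightarrow>
        pers M\<inverse>\<inverse> L1 L3 \<longleftrightarrow> pers (left_image f M)\<inverse>\<inverse> L1 L3 \<and> pers (left_image g M)\<inverse>\<inverse> L1 L3"
      "\<And>M. tree3 M \<Longrightarrow> pers M b c \<Longrightarrow>
        pers M\<inverse>\<inverse> L2 L3 \<longleftrightarrow> pers (left_image f M)\<inverse>\<inverse> L2 L3 \<and> pers (left_image g M)\<inverse>\<inverse> L2 L3"
    and row: "\<And>M a. a = b \<or> a = c \<Longrightarrow> tree3 M \<Longrightarrow> pers M a L1 \<Longrightarrow> pers M a L2 \<Longrightarrow> pers M a L3 \<Longrightarrow>
        pers (left_image f M) l L1 \<and> pers (left_image f M) l L2 \<and> pers (left_image f M) l L3 \<and>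
        pers (left_image g M) l L1 \<and> pers (left_image g M) l L2 \<and> pers (left_image g M) l L3"
    and "b \<noteq> c"
  shows "merging {f, g} b c l"
proof -
  have "tree3 M \<and> pers M b c \<longleftrightarrow> (\<forall>h\<in>{f, g}. tree3 (left_image h M))" for M
    using assms(1,2)[of M] by auto
  moreover have "tree3 M \<and> pers M b c \<longrightarrow>
        (pers M\<inverse>\<inverse> r d \<longleftrightarrow> (\<forall>h\<in>{f, g}. pers (left_image h M)\<inverse>\<inverse> r d))" for M r d
    using col[of M] pers_sym pers_refl by (cases r; cases d; simp; metis)
  moreover have "tree3 M \<and> l' \<in> {b, c} \<and> (\<forall>d. pers M l' d) \<longrightarrow> (\<forall>h\<in>{f, g}. \<forall>d. pers (left_image h M) l d)" for M l'
    using row[of l' M] by (auto simp: letter_all)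
  ultimately show ?thesis unfolding merging_def using \<open>b \<noteq> c\<close> by blast
qed

lemma left_image_id: "left_image (pmap (Some L1) (Some L2) (Some L3)) M = M"
proof (intro ext)
  show "left_image (pmap (Some L1) (Some L2) (Some L3)) M a b = M a b" for a b
    by (cases a; simp add: left_image_def pmap_def letter_ex)
qed

lemma merging_id: "merging {pmap (Some L1) (Some L2) (Some L3)} l l l"
  unfolding merging_def by (auto simp: left_image_id pers_def share_def row_def)

text \<open>Here and in the next four lemmas the first map glues \<open>b\<close> and
  \<open>c\<close>, the second is defined on these two only, and \<open>l\<close> is the one letter
  in both ranges. This is why \<open>l\<close> becomes the common letter.\<close>

lemma merging_122: "merging {pmap (Some L1) (Some L2) (Some L2), pmap None (Some L1) (Some L3)} L2 L3 L1"
  by (rule mergingI; (elim disjE)?; simp add: bool_simps left_image_def pmap_def; smt (verit))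

lemma merging_133: "merging {pmap (Some L1) (Some L3) (Some L3), pmap None (Some L2) (Some L3)} L2 L3 L3"
  by (rule mergingI; (elim disjE)?; simp add: bool_simps left_image_def pmap_def; smt (verit))

lemma merging_323: "merging {pmap (Some L3) (Some L2) (Some L3), pmap (Some L1) None (Some L3)} L1 L3 L3"
  by (rule mergingI; (elim disjE)?; simp add: bool_simps left_image_def pmap_def; smt (verit))

lemma merging_323_12: "merging {pmap (Some L3) (Some L2) (Some L3), pmap (Some L1) None (Some L2)} L1 L3 L2"
  by (rule mergingI; (elim disjE)?; simp add: bool_simps left_image_def pmap_def; smt (verit))

lemma merging_322: "merging {pmap (Some L3) (Some L2) (Some L2), pmap None (Some L1) (Some L3)} L2 L3 L3"
  by (rule mergingI; (elim disjE)?; simp add: bool_simps left_image_def pmap_def; smt (verit))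

section \<open>Letter maps and common letters of the six families\<close>

datatype kind = Alpha | Beta | Gamma | Delta nat | Zeta nat | Eta

text \<open>Each map sends a letter to the letter preceding a fixed suffix in its image, for the
  suffixes where this is not constant. For \<open>Beta\<close>, with images 1, 12, 132, these are
  the last letter and the letter before a final 2.\<close>

fun lmaps :: "kind \<Rightarrow> (letter \<Rightarrow> letter \<Rightarrow> bool) set" where
  "lmaps Alpha = {pmap (Some L1) (Some L2) (Some L3)}"
| "lmaps Beta = {pmap (Some L1) (Some L2) (Some L2), pmap None (Some L1) (Some L3)}"
| "lmaps Gamma = {pmap (Some L1) (Some L2) (Some L3)}"
| "lmaps (Delta k) = {pmap (Some L1) (Some L3) (Some L3), pmap None (Some L2) (Some L3)}"
| "lmaps (Zeta k) = {pmap (Some L3) (Some L2) (Some L3), pmap (Some L1) None (Some L3)}"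
| "lmaps Eta = {pmap (Some L3) (Some L2) (Some L3), pmap (Some L1) None (Some L2)}"

text \<open>The analogue on the right. The next image always starts with 1, so a letter whose image
  ends right after the fixed prefix is sent to \<open>L1\<close>.\<close>

fun rmaps :: "kind \<Rightarrow> (letter \<Rightarrow> letter \<Rightarrow> bool) set" where
  "rmaps Alpha = {pmap (Some L1) (Some L2) (Some L3)}"
| "rmaps Beta = {pmap (Some L1) (Some L2) (Some L3)}"
| "rmaps Gamma = {pmap (Some L1) (Some L2) (Some L2), pmap None (Some L1) (Some L3)}"
| "rmaps (Delta k) = {pmap (Some L1) (Some L2) (Some L2), pmap None (Some L1) (Some L3)}"
| "rmaps (Zeta k) = {pmap (Some L3) (Some L2) (Some L3), pmap (Some L1) None (Some L3)}"
| "rmaps Eta = {pmap (Some L3) (Some L2) (Some L2), pmap None (Some L1) (Some L3)}"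

text \<open>For a label \<open>p k q\<close> of an edge from \<open>[l, r]\<close> to \<open>[l', r']\<close>, the relation holds between the
  preimages of \<open>l\<close>, \<open>r\<close> under \<open>p\<close> and the images of \<open>l'\<close>, \<open>r'\<close> under \<open>q\<close>.\<close>

fun centers :: "kind \<Rightarrow> letter \<Rightarrow> letter \<Rightarrow> letter \<Rightarrow> letter \<Rightarrow> bool" where
  "centers Alpha l r l' r' \<longleftrightarrow> l' = l \<and> r' = r"
| "centers Beta l r l' r' \<longleftrightarrow> l = L1 \<and> r' = r \<and> l' \<in> {L2, L3}"
| "centers Gamma l r l' r' \<longleftrightarrow> r = L1 \<and> l' = l \<and> r' \<in> {L2, L3}"
| "centers (Delta k) l r l' r' \<longleftrightarrow> l = L3 \<and> r = L1 \<and> l' \<in> {L2, L3} \<and> r' \<in> {L2, L3}"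
| "centers (Zeta k) l r l' r' \<longleftrightarrow> l = L3 \<and> r = L3 \<and> l' \<in> {L1, L3} \<and> r' \<in> {L1, L3}"
| "centers Eta l r l' r' \<longleftrightarrow> l = L2 \<and> r = L3 \<and> l' \<in> {L1, L3} \<and> r' \<in> {L2, L3}"


text \<open>For kinds acting injectively on the left, \<open>b = c = l\<close> and the common letter
  is inherited; otherwise \<open>b\<close> and \<open>c\<close> are the glued letters, and either
  may be the common letter above. The last conclusion keeps both candidates open for the converse
  direction.\<close>

lemma merging_lmaps:
  assumes "centers k l r l' r'"
  obtains b c where "l' \<in> {b, c}" "merging (lmaps k) b c l"
    "\<And>x. x \<in> {b, c} \<Longrightarrow> centers k l r x r'"
proof (cases k)
  case Alpha
  with assms merging_id[of l] show ?thesis by (intro that[of l l]) auto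
next
  case Beta
  with assms merging_122 show ?thesis by (intro that[of L2 L3]) auto
next
  case Gamma
  with assms merging_id[of l] show ?thesis by (intro that[of l l]) auto
next
  case (Delta n)
  with assms merging_133 show ?thesis by (intro that[of L2 L3]) auto
next
  case (Zeta n)
  with assms merging_323 show ?thesis by (intro that[of L1 L3]) auto
next
  case Eta
  with assms merging_323_12 show ?thesis by (intro that[of L1 L3]) auto
qed

lemma merging_rmaps:
  assumes "centers k l r l' r'"
  obtains b c where "r' \<in> {b, c}" "merging (rmaps k) b c r"
    "\<And>x. x \<in> {b, c} \<Longrightarrow> centers k l r l' x"
proof (cases k)
  case Alpha
  with assms merging_id[of r] show ?thesis by (intro that[of r r]) auto
next
  case Beta
  with assms merging_id[of r] show ?thesis by (intro that[of r r]) auto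
next
  case Gamma
  with assms merging_122 show ?thesis by (intro that[of L2 L3]) auto
next
  case (Delta n)
  with assms merging_122 show ?thesis by (intro that[of L2 L3]) auto
next
  case (Zeta n)
  with assms merging_323 show ?thesis by (intro that[of L1 L3]) auto
next
  case Eta
  with assms merging_322 show ?thesis by (intro that[of L2 L3]) auto
qed

text \<open>One side is treated at a time: \<open>g\<close> acts on the transpose of
  \<open>M\<close>, giving a tree \<open>N\<close> that still satisfies the conditions on the other
  side, and then \<open>f\<close> acts on the transpose of \<open>N\<close>.\<close>

lemma good_img:
  assumes "centers k l r l' r'" and M: "good l' r' M" and f: "f \<in> lmaps k" and g: "g \<in> rmaps k"
  shows "good l r (img f g M)"
proof -
  obtain b c where bc: "l' \<in> {b, c}" "merging (lmaps k) b c l"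
    using merging_lmaps[OF assms(1)] by metis
  obtain b' c' where bc': "r' \<in> {b', c'}" "merging (rmaps k) b' c' r"
    using merging_rmaps[OF assms(1)] by metis
  define N where "N = left_image g M\<inverse>\<inverse>"
  have "pers M\<inverse>\<inverse> b' c'" "pers M b c"
    using M bc(1) bc'(1) pers_sym unfolding good_def by blast+
  moreover have M': "tree3 M" "tree3 M\<inverse>\<inverse>" using M tree3_conv unfolding good_def by auto
  ultimately have N: "tree3 N" "\<And>d. pers N r d" "\<And>p q. pers M p q \<Longrightarrow> pers N\<inverse>\<inverse> p q"
    using bc' g M unfolding merging_def N_def good_def by (metis conversep_conversep)+
  then have "tree3 N\<inverse>\<inverse>" "\<And>d. pers N\<inverse>\<inverse> l' d" "pers N\<inverse>\<inverse> b c"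
    using tree3_conv M \<open>pers M b c\<close> unfolding good_def by auto
  then have "tree3 (left_image f N\<inverse>\<inverse>)" "\<And>d. pers (left_image f N\<inverse>\<inverse>) l d"
    "\<And>d. pers (left_image f N\<inverse>\<inverse>)\<inverse>\<inverse> r d"
    using bc f N(2) unfolding merging_def by (metis conversep_conversep)+
  then show ?thesis unfolding good_def img_left_image N_def by blast
qed

lemma merging_tree:
  assumes "merging F b c l" "\<And>f. f \<in> F \<Longrightarrow> tree3 (left_image f M)"
  shows "tree3 M" "pers M b c"
  using assms(1)[unfolded merging_def, THEN conjunct1, THEN spec, of M] assms(2) by auto

lemma merging_pers:
  assumes "merging F b c l" "tree3 M" "pers M b c" "\<And>f. f \<in> F \<Longrightarrow> pers (left_image f M)\<inverse>\<inverse> r d"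
  shows "pers M\<inverse>\<inverse> r d"
  using assms(1)[unfolded merging_def, THEN conjunct2, THEN conjunct1, THEN spec, of M] assms(2-) by auto

lemma merging_center:
  assumes "merging F b c l" "b = c" "\<And>f d. f \<in> F \<Longrightarrow> pers (left_image f M) l d"
  shows "pers M b d"
  using assms(1)[unfolded merging_def, THEN conjunct2, THEN conjunct2, THEN conjunct2, THEN spec, of M] assms(2-)
  by auto

text \<open>For fixed \<open>g\<close>, the images under all \<open>f\<close> show that
  \<open>N g\<close> is a tree; all \<open>N g\<close> together then give back \<open>M\<close>. A
  side that acts injectively (\<open>b = c\<close>) returns its common letter; otherwise only the
  glued pair is known to share a neighbour.\<close>

lemma good_imgs:
  assumes F: "merging F b c l" and G: "merging G b' c' r"
    and imgs: "\<And>f g. f \<in> F \<Longrightarrow> g \<in> G \<Longrightarrow> good l r (img f g M)"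
  shows "tree3 M" "pers M b c" "pers M\<inverse>\<inverse> b' c'"
    "b = c \<Longrightarrow> pers M b d" "b' = c' \<Longrightarrow> pers M\<inverse>\<inverse> b' d"
proof -
  define N where "N g = left_image g M\<inverse>\<inverse>" for g
  have im: "tree3 (left_image f (N g)\<inverse>\<inverse>)" "pers (left_image f (N g)\<inverse>\<inverse>) l d"
    "pers (left_image f (N g)\<inverse>\<inverse>)\<inverse>\<inverse> r d" if "f \<in> F" "g \<in> G" for f g d
    using imgs[OF that] by (simp_all add: img_left_image N_def good_def)
  have N: "tree3 (N g)\<inverse>\<inverse>" "pers (N g)\<inverse>\<inverse> b c" if "g \<in> G" for g
    using merging_tree[OF F] im(1) that by blast+
  have Nr: "pers (N g) r d" if "g \<in> G" for g d
    using merging_pers[OF F N[OF that]] im(3) that by (metis conversep_conversep)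
  have Nb: "b = c \<Longrightarrow> pers (N g)\<inverse>\<inverse> b d" if "g \<in> G" for g d
    using merging_center[OF F] im(2) that by blast
  have "tree3 (N g)" if "g \<in> G" for g
    using tree3_conv[OF N(1)[OF that]] by simp
  then have M: "tree3 M\<inverse>\<inverse>" "pers M\<inverse>\<inverse> b' c'"
    using merging_tree[OF G, of "M\<inverse>\<inverse>"] unfolding N_def by blast+
  then show "tree3 M" "pers M\<inverse>\<inverse> b' c'" using tree3_conv[of "M\<inverse>\<inverse>"] by simp_all
  note transfer = merging_pers[OF G M, folded N_def, unfolded conversep_conversep]
  show "pers M b c" using transfer N(2) by blast
  show "b = c \<Longrightarrow> pers M b d" using transfer Nb by blast
  show "b' = c' \<Longrightarrow> pers M\<inverse>\<inverse> b' d" using merging_center[OF G] Nr unfolding N_def by blast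
qed

section \<open>Uniformly recurrent languages\<close>

text \<open>The word-level properties of the language of a minimal shift in which every letter
  occurs. Stated for sets of words, they apply directly to each level of a directive
  sequence.\<close>

definition urlang :: "'a list set \<Rightarrow> bool" where
  "urlang L \<longleftrightarrow> (\<forall>u v. v \<in> L \<and> sublist u v \<longrightarrow> u \<in> L) \<and> (\<forall>a. [a] \<in> L) \<and>
     (\<forall>w\<in>L. \<exists>a b. a # w @ [b] \<in> L) \<and>
     (\<forall>w\<in>L. \<exists>N. \<forall>u\<in>L. N \<le> length u \<longrightarrow> sublist w u)"

lemma urlang_sublist: "\<lbrakk>urlang L; v \<in> L; sublist u v\<rbrakk> \<Longrightarrow> u \<in> L"
  unfolding urlang_def by blast

lemma urlang_letter: "urlang L \<Longrightarrow> [a] \<in> L"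
  unfolding urlang_def by blast

lemma urlang_appendD: "\<lbrakk>urlang L; u @ v @ w \<in> L\<rbrakk> \<Longrightarrow> v \<in> L"
  by (erule urlang_sublist) auto

lemma urlang_appendD1: "\<lbrakk>urlang L; u @ v \<in> L\<rbrakk> \<Longrightarrow> u \<in> L"
  by (erule urlang_sublist) auto

lemma urlang_appendD2: "\<lbrakk>urlang L; u @ v \<in> L\<rbrakk> \<Longrightarrow> v \<in> L"
  by (erule urlang_sublist) auto

lemma urlang_ConsD: "\<lbrakk>urlang L; a # v \<in> L\<rbrakk> \<Longrightarrow> v \<in> L"
  using urlang_appendD2[of L "[a]" v] by simp

lemma urlang_extend: "\<lbrakk>urlang L; w \<in> L\<rbrakk> \<Longrightarrow> \<exists>a b. a # w @ [b] \<in> L"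
  unfolding urlang_def by blast

lemma urlang_right: "\<lbrakk>urlang L; w \<in> L\<rbrakk> \<Longrightarrow> \<exists>b. w @ [b] \<in> L"
  by (meson urlang_ConsD urlang_extend)

lemma urlang_left:
  assumes "urlang L" "w \<in> L"
  shows "\<exists>a. a # w \<in> L"
proof -
  obtain a b where "a # w @ [b] \<in> L" using urlang_extend assms by meson
  then show ?thesis using urlang_appendD1[OF assms(1), of "a # w" "[b]"] by auto
qed

lemma urlang_recurrent:
  assumes "urlang L" "w \<in> L"
  obtains N where "\<And>u. \<lbrakk>u \<in> L; N \<le> length u\<rbrakk> \<Longrightarrow> sublist w u"
  using assms unfolding urlang_def by blast

lemma urlang_extend_right:
  assumes "urlang L" "w \<in> L"
  shows "\<exists>y. length y = n \<and> w @ y \<in> L"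
proof (induction n)
  case (Suc n)
  then obtain y where "length y = n" "w @ y \<in> L" by blast
  moreover from this obtain b where "(w @ y) @ [b] \<in> L" using urlang_right[OF assms(1)] by blast
  ultimately show ?case by (intro exI[of _ "y @ [b]"]) auto
qed (use assms in auto)

lemma urlang_extend_left:
  assumes "urlang L" "w \<in> L"
  shows "\<exists>y. length y = n \<and> y @ w \<in> L"
proof (induction n)
  case (Suc n)
  then obtain y where "length y = n" "y @ w \<in> L" by blast
  moreover from this obtain b where "b # y @ w \<in> L" using urlang_left[OF assms(1)] by blast
  ultimately show ?case by (intro exI[of _ "b # y"]) auto
qed (use assms in auto)

lemma sublist_singleton: "sublist [c] u \<longleftrightarrow> c \<in> set u"
  by (metis append_Cons append_Nil in_set_conv_decomp sublist_def)

lemma urlang_next: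
  assumes L: "urlang L" and w: "w \<in> L"
  obtains y where "c \<notin> set y" "w @ y @ [c] \<in> L"
proof -
  obtain N where N: "\<And>u. \<lbrakk>u \<in> L; N \<le> length u\<rbrakk> \<Longrightarrow> sublist [c] u"
    using urlang_recurrent[OF L urlang_letter[OF L]] by blast
  obtain y where y: "length y = N" "w @ y \<in> L" using urlang_extend_right[OF L w] by blast
  then have "c \<in> set y" using N urlang_appendD2[OF L] by (metis order_refl sublist_singleton)
  then obtain p q where "y = p @ c # q" "c \<notin> set p" by (meson split_list_first)
  then show ?thesis using that[of p] y(2) urlang_appendD1[OF L, of "w @ p @ [c]" q] by simp
qed

lemma urlang_prev:
  assumes L: "urlang L" and w: "w \<in> L"
  obtains y where "c \<notin> set y" "c # y @ w \<in> L"
proof -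
  obtain N where N: "\<And>u. \<lbrakk>u \<in> L; N \<le> length u\<rbrakk> \<Longrightarrow> sublist [c] u"
    using urlang_recurrent[OF L urlang_letter[OF L]] by blast
  obtain y where y: "length y = N" "y @ w \<in> L" using urlang_extend_left[OF L w] by blast
  then have "c \<in> set y" using N urlang_appendD1[OF L] by (metis order_refl sublist_singleton)
  then obtain p q where "y = p @ c # q" "c \<notin> set q" by (meson split_list_last)
  then show ?thesis using that[of q] y(2) urlang_appendD2[OF L, of p "c # q @ w"] by simp
qed

lemma in_rev_image: "u \<in> rev ` L \<longleftrightarrow> rev u \<in> L"
  by (metis image_iff rev_rev_ident)

lemma urlang_rev:
  assumes L: "urlang L"
  shows "urlang (rev ` L)"
  unfolding urlang_def
proof (intro conjI allI impI ballI)
  show "u \<in> rev ` L" if "v \<in> rev ` L \<and> sublist u v" for u v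
    using that urlang_sublist[OF L] by (simp add: in_rev_image) (metis rev_rev_ident sublist_rev)
  show "[a] \<in> rev ` L" for a using urlang_letter[OF L] by (simp add: in_rev_image)
  show "\<exists>a b. a # w @ [b] \<in> rev ` L" if w: "w \<in> rev ` L" for w
  proof -
    obtain a b where "a # rev w @ [b] \<in> L" using urlang_extend[OF L] w by (metis in_rev_image)
    then have "b # w @ [a] \<in> rev ` L" by (simp add: in_rev_image)
    then show ?thesis by blast
  qed
  show "\<exists>N. \<forall>u\<in>rev ` L. N \<le> length u \<longrightarrow> sublist w u" if w: "w \<in> rev ` L" for w
  proof -
    obtain N where N: "\<And>u. \<lbrakk>u \<in> L; N \<le> length u\<rbrakk> \<Longrightarrow> sublist (rev w) u"
      using urlang_recurrent[OF L] w by (metis in_rev_image)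
    then show ?thesis by (metis length_rev in_rev_image rev_rev_ident sublist_rev)
  qed
qed

section \<open>Extension relations and left special words\<close>

definition ext :: "'a list set \<Rightarrow> 'a list \<Rightarrow> 'a \<Rightarrow> 'a \<Rightarrow> bool" where
  "ext L w a b \<longleftrightarrow> a # w @ [b] \<in> L"

lemma ext_rev: "ext (rev ` L) (rev w) = (ext L w)\<inverse>\<inverse>"
proof (intro ext)
  show "ext (rev ` L) (rev w) a b = (ext L w)\<inverse>\<inverse> a b" for a b
    by (simp add: ext_def in_rev_image)
qed

lemma row_ext: "urlang L \<Longrightarrow> row (ext L w) a \<longleftrightarrow> a # w \<in> L"
  unfolding row_def ext_def
  by (metis append_Cons urlang_appendD1 urlang_right)

lemma row_ext_conv: "urlang L \<Longrightarrow> row (ext L w)\<inverse>\<inverse> b \<longleftrightarrow> w @ [b] \<in> L"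
  unfolding row_def ext_def conversep_iff
  by (meson urlang_ConsD urlang_left)

text \<open>If \<open>u\<close> and \<open>v\<close> differed, their longest common prefix would
  carry a 4-cycle through \<open>a\<close>, \<open>b\<close> and the two letters at which they
  part.\<close>

lemma same_left_special:
  assumes L: "urlang L" and tree: "\<And>w. tree3 (ext L w)" and "a \<noteq> b"
  shows "\<lbrakk>length u = length v; a # u \<in> L; b # u \<in> L; a # v \<in> L; b # v \<in> L\<rbrakk> \<Longrightarrow> u = v"
proof (induction u arbitrary: v rule: rev_induct)
  case (snoc x u)
  then obtain v' y where v: "v = v' @ [y]" by (metis length_append_singleton rev_exhaust length_0_conv nat.distinct(1))
  have "u = v'"
    using snoc.IH[of v'] snoc.prems urlang_appendD1[OF L, of "_ # _"] v by auto
  then have "ext L u a x" "ext L u b x" "ext L u a y" "ext L u b y"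
    using snoc.prems v by (auto simp: ext_def)
  then have "x = y" using tree[of u] \<open>a \<noteq> b\<close> unfolding tree3_def acyclic3_def by meson
  then show ?case using v \<open>u = v'\<close> by simp
qed auto

text \<open>Once two of the shortened words agree, their common value is extended by all three
  letters, so \<open>same_left_special\<close> makes all three agree. The last letters then form a
  6-cycle unless two of them coincide.\<close>

lemma left_special_triangle:
  assumes L: "urlang L" and tree: "\<And>w. tree3 (ext L w)"
    and neq: "a \<noteq> b" "b \<noteq> c" "a \<noteq> c"
  shows "\<lbrakk>length u = length v; length v = length w; a # u \<in> L; b # u \<in> L; b # v \<in> L; c # v \<in> L; a # w \<in> L; c # w \<in> L\<rbrakk>
    \<Longrightarrow> u = v \<or> v = w \<or> u = w"
proof (induction u arbitrary: v w rule: rev_induct)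
  case (snoc x u)
  obtain v' y where v: "v = v' @ [y]" using snoc.prems by (metis length_append_singleton rev_exhaust length_0_conv nat.distinct(1))
  obtain w' z where w: "w = w' @ [z]" using snoc.prems by (metis length_append_singleton rev_exhaust length_0_conv nat.distinct(1))
  have mem: "a # u \<in> L" "b # u \<in> L" "b # v' \<in> L" "c # v' \<in> L" "a # w' \<in> L" "c # w' \<in> L"
    and len: "length u = length v'" "length v' = length w'"
    using snoc.prems urlang_appendD1[OF L, of "_ # _"] v w by auto
  note same = same_left_special[OF L tree]
  have "u = v' \<or> v' = w' \<or> u = w'" using snoc.IH mem len by blast
  then have "u = v' \<and> v' = w'"
    using same[OF neq(1)] same[OF neq(2)] same[OF neq(3)] mem len by metis
  then have "ext L u a x" "ext L u b x" "ext L u b y" "ext L u c y" "ext L u a z" "ext L u c z"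
    using snoc.prems v w by (auto simp: ext_def)
  then have "x = y \<or> y = z \<or> x = z" using tree[of u] neq unfolding tree3_def acyclic3_def by meson
  then show ?case using v w \<open>u = v' \<and> v' = w'\<close> by auto
qed auto

text \<open>Connectedness links \<open>a\<close> and \<open>b\<close> through \<open>c\<close>; the
  word \<open>w\<close> followed by a common neighbour of \<open>a\<close> and \<open>c\<close> is
  the required \<open>u\<close>.\<close>

lemma not_pers_exact:
  assumes L: "urlang L" and tree: "\<And>w. tree3 (ext L w)" and "\<not> pers (ext L w) a b"
    and c: "\<And>d. d = a \<or> d = b \<or> d = c"
  shows "\<exists>u. a # u \<in> L \<and> c # u \<in> L \<and> b # u \<notin> L"
proof -
  let ?M = "ext L w"
  have ab: "row ?M a" "row ?M b" "\<not> share ?M a b" using assms(3) unfolding pers_def by blast+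
  then obtain d where d: "share ?M a d" "share ?M d b"
    using tree[of w] unfolding tree3_def connected3_def by blast
  then have "d \<noteq> a" "d \<noteq> b" using ab(3) by blast+
  then have "d = c" using c by blast
  then obtain x where "?M a x" "?M c x" using d(1) unfolding share_def by blast
  moreover from this have "\<not> ?M b x" using ab(3) unfolding share_def by blast
  ultimately show ?thesis unfolding ext_def by blast
qed

text \<open>With only two left vertices present, connectedness gives them a common neighbour, which
  prolongs the word; \<open>c\<close> cannot reappear because the language is closed under
  prefixes.\<close>

lemma exact_extend:
  assumes L: "urlang L" and tree: "\<And>w. tree3 (ext L w)" and c: "\<And>d. d = a \<or> d = b \<or> d = c"
    and w: "a # w \<in> L" "b # w \<in> L" "c # w \<notin> L" and "length w \<le> n"
  shows "\<exists>u. length u = n \<and> a # u \<in> L \<and> b # u \<in> L \<and> c # u \<notin> L"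
  using \<open>length w \<le> n\<close>
proof (induction rule: dec_induct)
  case (step n)
  then obtain u where u: "length u = n" "a # u \<in> L" "b # u \<in> L" "c # u \<notin> L" by blast
  let ?M = "ext L u"
  have rows: "row ?M a" "row ?M b" "\<not> row ?M c" using u row_ext[OF L] by blast+
  have "share ?M a b \<or> (\<exists>d. share ?M a d \<and> share ?M d b)"
    using rows tree[of u] unfolding tree3_def connected3_def by blast
  then have "share ?M a b" using c rows(3) unfolding share_def row_def by metis
  then obtain x where "a # u @ [x] \<in> L" "b # u @ [x] \<in> L" unfolding share_def ext_def by blast
  moreover have "c # u @ [x] \<notin> L" using u(4) urlang_appendD1[OF L, of "c # u"] by auto
  ultimately show ?case using u(1) by (intro exI[of _ "u @ [x]"]) auto
qed (use w in auto)

text \<open>If the conclusion fails, then for some length there are words extended to the left by \<open>a\<close> and \<open>b\<close>,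
  by \<open>b\<close> and \<open>c\<close> only, and by \<open>a\<close> and \<open>c\<close> only, and these form a hexagon.\<close>

lemma left_center:
  assumes L: "urlang L" and tree: "\<And>w. tree3 (ext L w)" and "a \<noteq> b"
    and pers: "\<And>w. pers (ext L w) a b"
  shows "\<exists>l\<in>{a, b}. \<forall>w d. pers (ext L w) l d"
proof (rule ccontr)
  assume neg: "\<not> ?thesis"
  obtain c where c: "a \<noteq> c" "b \<noteq> c" "\<And>d. d = a \<or> d = b \<or> d = c"
    using \<open>a \<noteq> b\<close> by (cases a; cases b) (metis letter.distinct letter.exhaust)+
  obtain w1 d1 where "\<not> pers (ext L w1) a d1" using neg by blast
  then have "\<not> pers (ext L w1) c a" using c(3)[of d1] pers pers_refl pers_sym by metis
  then obtain v where v: "c # v \<in> L" "b # v \<in> L" "a # v \<notin> L"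
    using not_pers_exact[OF L tree, of w1 c a b] c(3) by blast
  obtain w2 d2 where "\<not> pers (ext L w2) b d2" using neg by blast
  then have "\<not> pers (ext L w2) c b" using c(3)[of d2] pers pers_refl pers_sym by metis
  then obtain w where w: "c # w \<in> L" "a # w \<in> L" "b # w \<notin> L"
    using not_pers_exact[OF L tree, of w2 c b a] c(3) by blast
  define n where "n = max (length v) (length w)"
  obtain v' where v': "length v' = n" "c # v' \<in> L" "b # v' \<in> L" "a # v' \<notin> L"
    using exact_extend[OF L tree _ v, of n] c(3) n_def by auto
  obtain w' where w': "length w' = n" "c # w' \<in> L" "a # w' \<in> L" "b # w' \<notin> L"
    using exact_extend[OF L tree _ w, of n] c(3) n_def by auto
  \<comment> \<open>Persistence of the pair prolongs words with both left extensions to any length,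
    in particular to that of \<open>v'\<close> and \<open>w'\<close>.\<close>
  have "\<exists>u. length u = n \<and> a # u \<in> L \<and> b # u \<in> L"
  proof (induction n)
    case (Suc n)
    then obtain u where "length u = n" "a # u \<in> L" "b # u \<in> L" by blast
    moreover from this obtain x where "a # u @ [x] \<in> L" "b # u @ [x] \<in> L"
      using pers[of u] row_ext[OF L] unfolding pers_def share_def ext_def by blast
    ultimately show ?case by (intro exI[of _ "u @ [x]"]) auto
  qed (use urlang_letter[OF L] in auto)
  then obtain u where u: "length u = n" "a # u \<in> L" "b # u \<in> L" by blast
  have "u = v' \<or> v' = w' \<or> u = w'"
    using left_special_triangle[OF L tree \<open>a \<noteq> b\<close> c(2) c(1), of u v' w'] u v' w' by auto
  then show False using u v' w' by auto
qed

text \<open>If some pair never fails, \<open>left_center\<close> applies. If every pair fails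
  somewhere, any two letters are the exact left extensions of some word, and prolonging these words
  to one length contradicts \<open>left_special_triangle\<close>.\<close>

lemma exists_left_center:
  assumes L: "urlang L" and tree: "\<And>w. tree3 (ext L w)"
  shows "\<exists>l. \<forall>w d. pers (ext L w) l d"
proof (rule ccontr)
  assume neg: "\<not> ?thesis"
  have bad: "\<exists>w. \<not> pers (ext L w) a b" if "a \<noteq> b" for a b
    using left_center[OF L tree that] neg by blast
  have lt: "d = L1 \<or> d = L2 \<or> d = L3" for d by (cases d) auto
  obtain u where u: "L1 # u \<in> L" "L2 # u \<in> L" "L3 # u \<notin> L"
    using bad[of L1 L3] not_pers_exact[OF L tree, of _ L1 L3 L2] lt by blast
  obtain v where v: "L2 # v \<in> L" "L3 # v \<in> L" "L1 # v \<notin> L"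
    using bad[of L2 L1] not_pers_exact[OF L tree, of _ L2 L1 L3] lt by blast
  obtain w where w: "L1 # w \<in> L" "L3 # w \<in> L" "L2 # w \<notin> L"
    using bad[of L1 L2] not_pers_exact[OF L tree, of _ L1 L2 L3] lt by blast
  define n where "n = max (length u) (max (length v) (length w))"
  have "\<exists>x. length x = n \<and> L1 # x \<in> L \<and> L2 # x \<in> L \<and> L3 # x \<notin> L"
    by (rule exact_extend[OF L tree _ u]) (use lt n_def in \<open>blast, simp\<close>)
  then obtain u' where u': "length u' = n" "L1 # u' \<in> L" "L2 # u' \<in> L" "L3 # u' \<notin> L" by blast
  have "\<exists>x. length x = n \<and> L2 # x \<in> L \<and> L3 # x \<in> L \<and> L1 # x \<notin> L"
    by (rule exact_extend[OF L tree _ v]) (use lt n_def in \<open>blast, simp\<close>)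
  then obtain v' where v': "length v' = n" "L2 # v' \<in> L" "L3 # v' \<in> L" "L1 # v' \<notin> L" by blast
  have "\<exists>x. length x = n \<and> L1 # x \<in> L \<and> L3 # x \<in> L \<and> L2 # x \<notin> L"
    by (rule exact_extend[OF L tree _ w]) (use lt n_def in \<open>blast, simp\<close>)
  then obtain w' where w': "length w' = n" "L1 # w' \<in> L" "L3 # w' \<in> L" "L2 # w' \<notin> L" by blast
  have "u' = v' \<or> v' = w' \<or> u' = w'"
    by (rule left_special_triangle[OF L tree, of L1 L2 L3]) (use u' v' w' in auto)
  then show False using u' v' w' by auto
qed

lemma ext_rev': "ext (rev ` L) w = (ext L (rev w))\<inverse>\<inverse>"
  using ext_rev[of L "rev w"] by simp

lemma tree3_ext_rev:
  assumes "\<And>w. tree3 (ext L w)"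
  shows "tree3 (ext (rev ` L) w)"
  unfolding ext_rev' using assms by (rule tree3_conv)

text \<open>Reversing all words transposes the extension relations, which turns this into
  \<open>left_center\<close>.\<close>

lemma right_center:
  assumes L: "urlang L" and tree: "\<And>w. tree3 (ext L w)" and "a \<noteq> b"
    and pers: "\<And>w. pers (ext L w)\<inverse>\<inverse> a b"
  shows "\<exists>r\<in>{a, b}. \<forall>w d. pers (ext L w)\<inverse>\<inverse> r d"
proof -
  have "\<exists>r\<in>{a, b}. \<forall>w d. pers (ext (rev ` L) w) r d"
    by (rule left_center[OF urlang_rev[OF L] tree3_ext_rev[OF tree] \<open>a \<noteq> b\<close>]) (simp add: ext_rev' pers)
  then show ?thesis unfolding ext_rev' by (metis rev_rev_ident)
qed

lemma exists_right_center:
  assumes L: "urlang L" and tree: "\<And>w. tree3 (ext L w)"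
  shows "\<exists>r. \<forall>w d. pers (ext L w)\<inverse>\<inverse> r d"
  using exists_left_center[OF urlang_rev[OF L] tree3_ext_rev[OF tree]]
  unfolding ext_rev' by (metis rev_rev_ident)

section \<open>Images under return morphisms\<close>

lemma wmap_simps [simp]: "wmap f [] = []" "wmap f (a # u) = f a @ wmap f u"
  "wmap f (u @ v) = wmap f u @ wmap f v"
  by (simp_all add: wmap_def)

lemma sublist_wmap: "sublist u v \<Longrightarrow> sublist (wmap f u) (wmap f v)"
  unfolding sublist_def by (metis wmap_simps(3))

definition image_lang :: "('a \<Rightarrow> 'b list) \<Rightarrow> 'a list set \<Rightarrow> 'b list set" where
  "image_lang f K = {w. \<exists>v\<in>K. sublist w (wmap f v)}"

lemma marker_split:
  assumes "z \<notin> set p" "z \<notin> set q" "p @ z # x = q @ z # y"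
  shows "p = q" "x = y"
proof -
  have "takeWhile (\<lambda>c. c \<noteq> z) (r @ z # u) = r" if "z \<notin> set r" for r u
    using that by (subst takeWhile_append2) auto
  then show "p = q" using assms by metis
  then show "x = y" using assms(3) by simp
qed

lemma prefix_upto_marker:
  assumes "z \<notin> set p" "p @ b # y = q @ z # x"
  shows "prefix (p @ [b]) (q @ [z])"
proof -
  have "prefix (p @ [b]) (q @ z # x)" using assms(2) by (metis append_Cons append_Nil append_assoc prefixI)
  moreover have "prefix (q @ [z]) (q @ z # x)" by simp
  ultimately consider "prefix (p @ [b]) (q @ [z])" | "prefix (q @ [z]) (p @ [b])"
    by (metis prefix_same_cases)
  then show ?thesis
  proof cases
    case 2
    then have "prefix (q @ [z]) p \<or> q @ [z] = p @ [b]" by (auto simp: prefix_snoc)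
    then show ?thesis using assms(1) set_mono_prefix by fastforce
  qed
qed

lemma suffix_from_marker:
  assumes "z \<notin> set s" "x @ a # s = y @ z # t"
  shows "suffix (a # s) (z # t)"
proof -
  have "prefix (rev s @ [a]) (rev t @ [z])"
    by (rule prefix_upto_marker[of z _ _ "rev x" _ "rev y"])
      (use assms in simp, metis append.assoc append_Cons append_Nil assms(2) rev.simps(2) rev_append)
  then show ?thesis by (simp add: suffix_to_prefix)
qed

text \<open>\<open>lmap z t s\<close> sends a letter \<open>c\<close> to the letter preceding \<open>s\<close> in the image \<open>z # t c\<close>, and \<open>rmap z t p\<close>
  sends \<open>d\<close> to the letter following \<open>p\<close> in \<open>t d @ [z]\<close>, where \<open>z\<close> starts the image of the next letter.\<close>

definition lmap :: "'b \<Rightarrow> ('a \<Rightarrow> 'b list) \<Rightarrow> 'b list \<Rightarrow> 'a \<Rightarrow> 'b \<Rightarrow> bool" where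
  "lmap z t s c a \<longleftrightarrow> suffix (a # s) (z # t c)"

definition rmap :: "'b \<Rightarrow> ('a \<Rightarrow> 'b list) \<Rightarrow> 'b list \<Rightarrow> 'a \<Rightarrow> 'b \<Rightarrow> bool" where
  "rmap z t p d b \<longleftrightarrow> prefix (p @ [b]) (t d @ [z])"

locale return_morphism =
  fixes z :: 'b and t :: "'a \<Rightarrow> 'b list"
  assumes z_notin: "z \<notin> set (t a)" and inj: "inj t"
begin

abbreviation f :: "'a \<Rightarrow> 'b list" where "f a \<equiv> z # t a"

lemma length_wmap: "length u \<le> length (wmap f u)"
  by (induction u) auto

lemma wmap_cut:
  "x @ z # y = wmap f v \<Longrightarrow> \<exists>v1 d v2. v = v1 @ d # v2 \<and> x = wmap f v1 \<and> y = t d @ wmap f v2"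
proof (induction v arbitrary: x)
  case (Cons a v)
  show ?case
  proof (cases x)
    case Nil
    then show ?thesis using Cons.prems by (intro exI[of _ "[]"] exI[of _ a] exI[of _ v]) auto
  next
    case (Cons b x')
    then have "x' @ z # y = t a @ wmap f v" and b: "b = z" using Cons.prems by auto
    then obtain us where "x' = t a @ us \<and> us @ z # y = wmap f v \<or> x' @ us = t a \<and> z # y = us @ wmap f v"
      by (auto simp: append_eq_append_conv2)
    moreover have "us = []" if "x' @ us = t a" "z # y = us @ wmap f v"
      using that z_notin[of a] by (metis Un_iff append_eq_Cons_conv list.set_intros(1) set_append)
    ultimately obtain us where us: "x' = t a @ us" "us @ z # y = wmap f v" by fastforce
    from Cons.IH[OF us(2)] obtain v1 d v2 where "v = v1 @ d # v2" "us = wmap f v1" "y = t d @ wmap f v2" by blast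
    then show ?thesis using us Cons b by (intro exI[of _ "a # v1"] exI[of _ d] exI[of _ v2]) auto
  qed
qed simp

lemma wmap_inj: "wmap f u = wmap f v \<Longrightarrow> u = v"
proof (induction u arbitrary: v)
  case Nil
  then show ?case by (cases v) auto
next
  case (Cons a u)
  then obtain b v' where v: "v = b # v'" by (cases v) auto
  then have "t a @ wmap f u @ [z] = t b @ wmap f v' @ [z]" using Cons.prems by simp
  moreover have "\<exists>x. wmap f w @ [z] = z # x" for w by (cases w) auto
  ultimately have "t a = t b \<and> wmap f u @ [z] = wmap f v' @ [z]"
    using marker_split z_notin by metis
  then show ?case using Cons.IH v inj by (auto dest: injD)
qed

lemma wmap_prefix:
  assumes "wmap f u @ z # y = wmap f v"
  obtains d v2 where "v = u @ d # v2" "y = t d @ wmap f v2"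
  using wmap_cut[OF assms] wmap_inj that by metis

text \<open>The markers fix all cuts: \<open>s\<close> ends the image of a letter \<open>c\<close>,
  the middle decodes to \<open>u\<close> only, and \<open>z # p\<close> starts the image of a letter
  \<open>d\<close>. Hence the extensions of this word are images of those of
  \<open>u\<close>.\<close>

lemma marked_word_in_image:
  assumes K: "urlang K" and s: "z \<notin> set s" and p: "z \<notin> set p"
  shows "a # (s @ wmap f u @ z # p) @ [b] \<in> image_lang f K \<longleftrightarrow>
    (\<exists>c d. c # u @ [d] \<in> K \<and> lmap z t s c a \<and> rmap z t p d b)"
proof
  assume "a # (s @ wmap f u @ z # p) @ [b] \<in> image_lang f K"
  then obtain v x y where v: "v \<in> K" and eq: "wmap f v = x @ a # s @ wmap f u @ z # p @ b # y"
    by (auto simp: image_lang_def sublist_def)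
  \<comment> \<open>The additional letter ensures that the image of \<open>d\<close> is followed by
    a marker, as \<open>rmap\<close> presupposes.\<close>
  obtain e where e: "v @ [e] \<in> K" using urlang_right[OF K v] by blast
  have "\<exists>Y. wmap f u @ z # p @ b # y @ f e = z # Y" by (cases u) auto
  then obtain Y where Y: "z # Y = wmap f u @ z # (p @ b # y @ f e)" by metis
  have "(x @ a # s) @ z # Y = wmap f (v @ [e])" by (simp add: Y eq)
  then obtain v1 d0 v2 where v1: "v @ [e] = v1 @ d0 # v2" "x @ a # s = wmap f v1" "Y = t d0 @ wmap f v2"
    using wmap_cut by blast
  from v1(2) obtain v0 c where c: "v1 = v0 @ [c]" by (cases v1 rule: rev_cases) auto
  have l: "lmap z t s c a"
    unfolding lmap_def by (rule suffix_from_marker[OF s, of x a "wmap f v0"]) (simp add: v1(2) c)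
  have "wmap f u @ z # (p @ b # y @ f e) = wmap f (d0 # v2)" using Y v1(3) by simp
  then obtain d v3 where d: "d0 # v2 = u @ d # v3" "p @ b # y @ f e = t d @ wmap f v3"
    by (rule wmap_prefix)
  have "v3 \<noteq> []"
  proof
    assume "v3 = []"
    then have "z \<in> set (t d)" using arg_cong[OF d(2), of set] by auto
    then show False using z_notin by blast
  qed
  then obtain Z where "p @ b # (y @ f e) = t d @ z # Z" using d(2) by (cases v3) auto
  then have "rmap z t p d b" unfolding rmap_def by (rule prefix_upto_marker[OF p])
  moreover have "v0 @ (c # u @ [d]) @ v3 \<in> K" using e v1(1) c d(1) by simp
  then have "c # u @ [d] \<in> K" by (rule urlang_appendD[OF K])
  ultimately show "\<exists>c d. c # u @ [d] \<in> K \<and> lmap z t s c a \<and> rmap z t p d b" using l by blast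
next
  assume "\<exists>c d. c # u @ [d] \<in> K \<and> lmap z t s c a \<and> rmap z t p d b"
  then obtain c d where cd: "c # u @ [d] \<in> K" and l: "suffix (a # s) (f c)"
    and r: "prefix (p @ [b]) (t d @ [z])" by (auto simp: lmap_def rmap_def)
  obtain e where "(c # u @ [d]) @ [e] \<in> K" using urlang_right[OF K cd] by blast
  moreover obtain x where "f c = x @ a # s" using l by (auto simp: suffix_def)
  moreover obtain y where "t d @ [z] = p @ b # y" using r by (auto simp: prefix_def)
  then have "t d @ z # t e = p @ b # y @ t e" by (metis append_Cons append_Nil append_assoc)
  ultimately have "wmap f ((c # u @ [d]) @ [e]) = x @ (a # (s @ wmap f u @ z # p) @ [b]) @ y @ t e" by simp
  then have "sublist (a # (s @ wmap f u @ z # p) @ [b]) (wmap f ((c # u @ [d]) @ [e]))"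
    unfolding sublist_def by metis
  then show "a # (s @ wmap f u @ z # p) @ [b] \<in> image_lang f K"
    unfolding image_lang_def using \<open>(c # u @ [d]) @ [e] \<in> K\<close> by blast
qed

text \<open>Without a marker in \<open>w\<close>, the whole of \<open>a # w @ [b]\<close> lies in
  one image followed by the next marker. The condition is independent of \<open>K\<close>, since
  every letter occurs there and is followed by another.\<close>

lemma unmarked_word_in_image:
  assumes K: "urlang K" and w: "z \<notin> set w"
  shows "a # w @ [b] \<in> image_lang f K \<longleftrightarrow> (\<exists>c. sublist (a # w @ [b]) (f c @ [z]))"
proof
  assume "a # w @ [b] \<in> image_lang f K"
  then obtain v x y where v: "v \<in> K" and eq: "wmap f v = (x @ [a]) @ w @ b # y"
    by (auto simp: image_lang_def sublist_def)
  obtain e where e: "v @ [e] \<in> K" using urlang_right[OF K v] by blast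
  have "z \<in> set (x @ [a])"
    using eq by (cases v; cases x) auto
  then obtain x1 x2 where x: "x @ [a] = x1 @ z # x2" "z \<notin> set x2" by (meson split_list_last)
  have "x1 @ z # (x2 @ w @ b # y @ f e) = wmap f (v @ [e])" using eq x(1) by simp
  then obtain d v2 where d: "x2 @ w @ b # y @ f e = t d @ wmap f v2" using wmap_cut by blast
  have "v2 \<noteq> []"
  proof
    assume "v2 = []"
    then have "z \<in> set (t d)" using arg_cong[OF d, of set] by auto
    then show False using z_notin by blast
  qed
  then obtain Z where "(x2 @ w) @ b # (y @ f e) = t d @ z # Z" using d by (cases v2) auto
  then have "prefix ((x2 @ w) @ [b]) (t d @ [z])" by (rule prefix_upto_marker[rotated]) (use x w in auto)
  then have "prefix ((z # x2) @ w @ [b]) (f d @ [z])" by simp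
  moreover obtain x3 where "z # x2 = x3 @ [a]" using x(1) by (metis append_butlast_last_id last_ConsR last_appendR last_snoc list.distinct(1))
  ultimately have "prefix (x3 @ (a # w @ [b])) (f d @ [z])" by simp
  then have "sublist (a # w @ [b]) (f d @ [z])" by (auto simp: prefix_def sublist_def)
  then show "\<exists>c. sublist (a # w @ [b]) (f c @ [z])" by blast
next
  assume "\<exists>c. sublist (a # w @ [b]) (f c @ [z])"
  then obtain c where c: "sublist (a # w @ [b]) (f c @ [z])" by blast
  obtain e where "[c] @ [e] \<in> K" using urlang_right[OF K urlang_letter[OF K]] by blast
  moreover have "sublist (f c @ [z]) (wmap f ([c] @ [e]))" by (auto simp: sublist_def)
  ultimately show "a # w @ [b] \<in> image_lang f K"
    using c sublist_order.order_trans unfolding image_lang_def by blast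
qed

lemma marked_word_form:
  assumes "w \<in> image_lang f K" "z \<in> set w"
  obtains s u p where "w = s @ wmap f u @ z # p" "z \<notin> set s" "z \<notin> set p"
proof -
  obtain v x y where eq: "wmap f v = x @ w @ y" using assms by (auto simp: image_lang_def sublist_def)
  obtain s w' where w: "w = s @ z # w'" "z \<notin> set s" using assms(2) by (meson split_list_first)
  have "z \<in> set (z # w')" by simp
  then obtain q p where q: "z # w' = q @ z # p" "z \<notin> set p" by (meson split_list_last)
  have "(x @ s @ q) @ z # (p @ y) = wmap f v" using eq w q by simp
  then obtain v1 where v1: "x @ s @ q = wmap f v1" using wmap_cut by metis
  have "\<exists>u. q = wmap f u"
  proof (cases q)
    case Nil
    then show ?thesis by (metis wmap_simps(1))
  next
    case (Cons b q')
    then have "(x @ s) @ z # q' = wmap f v1" using q(1) v1 by simp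
    then obtain d v2 where "q' = t d @ wmap f v2" using wmap_cut by blast
    then have "q = wmap f (d # v2)" using Cons q(1) by simp
    then show ?thesis by blast
  qed
  then show ?thesis using that w q by auto
qed

lemma sublist_wmap_marked:
  assumes "sublist (wmap f u @ [z]) (wmap f v @ [z])"
  shows "sublist u v"
proof -
  obtain x y where xy: "wmap f v @ [z] = x @ wmap f u @ z # y" using assms by (auto simp: sublist_def)
  \<comment> \<open>An arbitrary letter: appending \<open>t e\<close> completes the final
    \<open>z\<close> to a full image.\<close>
  define e where "e = (undefined :: 'a)"
  have "\<exists>Y. wmap f u @ z # y @ t e = z # Y" by (cases u) auto
  then obtain Y where Y: "wmap f u @ z # y @ t e = z # Y" by blast
  have "x @ z # Y = wmap f (v @ [e])"
    using arg_cong[OF xy, of "\<lambda>w. w @ t e"] Y by simp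
  then obtain v1 d v2 where v1: "v @ [e] = v1 @ d # v2" "Y = t d @ wmap f v2"
    using wmap_cut by blast
  then have "wmap f u @ z # (y @ t e) = wmap f (d # v2)" using Y by simp
  then obtain d' v3 where "d # v2 = u @ d' # v3" by (rule wmap_prefix)
  then have "v @ [e] = v1 @ u @ d' # v3" using v1 by simp
  then have "butlast (v @ [e]) = v1 @ u @ butlast (d' # v3)" by (simp only: butlast_append) simp
  then have "v = v1 @ u @ butlast (d' # v3)" by simp
  then show ?thesis unfolding sublist_def by blast
qed

end

section \<open>The extension graphs of an image language\<close>

fun tail :: "kind \<Rightarrow> letter \<Rightarrow> letter list" where
  "tail Alpha = mk3 [] [L2] [L3]"
| "tail Beta = mk3 [] [L2] [L3, L2]"
| "tail Gamma = mk3 [] [L2] [L2, L3]"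
| "tail (Delta n) = mk3 [] (L2 # replicate n L3) (L2 # replicate (Suc n) L3)"
| "tail (Zeta n) = mk3 (replicate n L3) [L2] (replicate (Suc n) L3)"
| "tail Eta = mk3 [L3] [L2] [L2, L3]"

fun valid :: "kind \<Rightarrow> bool" where
  "valid (Delta n) \<longleftrightarrow> n \<ge> 1"
| "valid (Zeta n) \<longleftrightarrow> n \<ge> 1"
| "valid _ \<longleftrightarrow> True"

lemma mk3_simps [simp]: "mk3 u v w L1 = u" "mk3 u v w L2 = v" "mk3 u v w L3 = w"
  by (simp_all add: mk3_def)

text \<open>The three tails of a kind are told apart by their lengths and by the presence of
  \<open>L2\<close>.\<close>

lemma return_morphism_tail: "return_morphism L1 (tail k)"
proof
  show "L1 \<notin> set (tail k a)" for a by (cases k; cases a) auto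
  show "inj (tail k)"
  proof (rule injI)
    fix x y
    assume eq: "tail k x = tail k y"
    then have "length (tail k x) = length (tail k y)" "L2 \<in> set (tail k x) \<longleftrightarrow> L2 \<in> set (tail k y)"
      by simp_all
    then show "x = y" using eq by (cases k; cases x; cases y) auto
  qed
qed

lemma suffix_Cons_replicate:
  "suffix (a # s) (replicate n c) \<longleftrightarrow> a = c \<and> (\<exists>i<n. s = replicate i c)"
  by (induction n) (auto simp: suffix_Cons less_Suc_eq)

lemma prefix_snoc_Cons: "prefix (p @ [b]) (y # ys) \<longleftrightarrow> p = [] \<and> b = y \<or> (\<exists>p'. p = y # p' \<and> prefix (p' @ [b]) ys)"
  by (cases p) auto

lemma prefix_snoc_replicate:
  "prefix (p @ [b]) (replicate n c @ [d]) \<longleftrightarrow> (\<exists>j. p = replicate j c \<and> (j < n \<and> b = c \<or> j = n \<and> b = d))"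
proof (induction n arbitrary: p)
  case (Suc n)
  have "(\<exists>j. p = replicate j c \<and> (j < Suc n \<and> b = c \<or> j = Suc n \<and> b = d)) \<longleftrightarrow>
     p = [] \<and> b = c \<or> (\<exists>j. p = replicate (Suc j) c \<and> (j < n \<and> b = c \<or> j = n \<and> b = d))"
    by (metis Suc_less_eq bot_nat_0.not_eq_extremum nat.distinct(1) not0_implies_Suc replicate_0 zero_less_Suc old.nat.inject)
  then show ?case using Suc by (auto simp: prefix_snoc_Cons)
qed (auto simp: prefix_snoc_Cons)

lemma sublist_Cons_snoc:
  "sublist (a # w @ [b]) (y # ys) \<longleftrightarrow> a = y \<and> prefix (w @ [b]) ys \<or> sublist (a # w @ [b]) ys"
  by (simp add: sublist_Cons_right)

lemma sublist_replicate_snoc: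
  "sublist (a # w @ [b]) (replicate n c @ [d]) \<longleftrightarrow> a = c \<and> (\<exists>i<n. prefix (w @ [b]) (replicate i c @ [d]))"
  by (induction n) (auto simp: sublist_Cons_snoc less_Suc_eq sublist_Cons_right)

lemma lmap_simps:
  "lmap L1 (tail Alpha) s c a \<longleftrightarrow> s = [] \<and> c = a \<or> c \<noteq> L1 \<and> s = [c] \<and> a = L1"
  "lmap L1 (tail Beta) s c a \<longleftrightarrow> (c = L1 \<and> s = [] \<and> a = L1) \<or>
     (c = L2 \<and> (s = [] \<and> a = L2 \<or> s = [L2] \<and> a = L1)) \<or>
     (c = L3 \<and> (s = [] \<and> a = L2 \<or> s = [L2] \<and> a = L3 \<or> s = [L3, L2] \<and> a = L1))"
  "lmap L1 (tail Gamma) s c a \<longleftrightarrow> (c = L1 \<and> s = [] \<and> a = L1) \<or>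
     (c = L2 \<and> (s = [] \<and> a = L2 \<or> s = [L2] \<and> a = L1)) \<or>
     (c = L3 \<and> (s = [] \<and> a = L3 \<or> s = [L3] \<and> a = L2 \<or> s = [L2, L3] \<and> a = L1))"
  "lmap L1 (tail Eta) s c a \<longleftrightarrow> (c = L1 \<and> (s = [] \<and> a = L3 \<or> s = [L3] \<and> a = L1)) \<or>
     (c = L2 \<and> (s = [] \<and> a = L2 \<or> s = [L2] \<and> a = L1)) \<or>
     (c = L3 \<and> (s = [] \<and> a = L3 \<or> s = [L3] \<and> a = L2 \<or> s = [L2, L3] \<and> a = L1))"
  "lmap L1 (tail (Delta n)) s c a \<longleftrightarrow> (c = L1 \<and> s = [] \<and> a = L1) \<or>
     (c = L2 \<and> (a = L1 \<and> s = L2 # replicate n L3 \<or> a = L2 \<and> s = replicate n L3 \<or> a = L3 \<and> (\<exists>i<n. s = replicate i L3))) \<or>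
     (c = L3 \<and> (a = L1 \<and> s = L2 # replicate (Suc n) L3 \<or> a = L2 \<and> s = replicate (Suc n) L3 \<or> a = L3 \<and> (\<exists>i<Suc n. s = replicate i L3)))"
  "lmap L1 (tail (Zeta n)) s c a \<longleftrightarrow>
     (c = L1 \<and> (a = L1 \<and> s = replicate n L3 \<or> a = L3 \<and> (\<exists>i<n. s = replicate i L3))) \<or>
     (c = L2 \<and> (s = [] \<and> a = L2 \<or> s = [L2] \<and> a = L1)) \<or>
     (c = L3 \<and> (a = L1 \<and> s = replicate (Suc n) L3 \<or> a = L3 \<and> (\<exists>i<Suc n. s = replicate i L3)))"
  by (cases c; simp add: lmap_def suffix_Cons suffix_Cons_replicate del: replicate.simps; blast?)+

lemma rmap_simps:
  "rmap L1 (tail Alpha) p d b \<longleftrightarrow> p = [] \<and> d = b \<or> d \<noteq> L1 \<and> p = [d] \<and> b = L1"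
  "rmap L1 (tail Beta) p d b \<longleftrightarrow> (d = L1 \<and> p = [] \<and> b = L1) \<or>
     (d = L2 \<and> (p = [] \<and> b = L2 \<or> p = [L2] \<and> b = L1)) \<or>
     (d = L3 \<and> (p = [] \<and> b = L3 \<or> p = [L3] \<and> b = L2 \<or> p = [L3, L2] \<and> b = L1))"
  "rmap L1 (tail Gamma) p d b \<longleftrightarrow> (d = L1 \<and> p = [] \<and> b = L1) \<or>
     (d = L2 \<and> (p = [] \<and> b = L2 \<or> p = [L2] \<and> b = L1)) \<or>
     (d = L3 \<and> (p = [] \<and> b = L2 \<or> p = [L2] \<and> b = L3 \<or> p = [L2, L3] \<and> b = L1))"
  "rmap L1 (tail Eta) p d b \<longleftrightarrow> (d = L1 \<and> (p = [] \<and> b = L3 \<or> p = [L3] \<and> b = L1)) \<or>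
     (d = L2 \<and> (p = [] \<and> b = L2 \<or> p = [L2] \<and> b = L1)) \<or>
     (d = L3 \<and> (p = [] \<and> b = L2 \<or> p = [L2] \<and> b = L3 \<or> p = [L2, L3] \<and> b = L1))"
  "rmap L1 (tail (Delta n)) p d b \<longleftrightarrow> (d = L1 \<and> p = [] \<and> b = L1) \<or>
     (d \<noteq> L1 \<and> (p = [] \<and> b = L2 \<or> (\<exists>j. p = L2 # replicate j L3 \<and>
        (let m = (if d = L2 then n else Suc n) in j < m \<and> b = L3 \<or> j = m \<and> b = L1))))"
  "rmap L1 (tail (Zeta n)) p d b \<longleftrightarrow>
     (d = L2 \<and> (p = [] \<and> b = L2 \<or> p = [L2] \<and> b = L1)) \<or>
     (d \<noteq> L2 \<and> (\<exists>j. p = replicate j L3 \<and>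
        (let m = (if d = L1 then n else Suc n) in j < m \<and> b = L3 \<or> j = m \<and> b = L1)))"
  by (cases d; simp add: rmap_def Let_def prefix_snoc_Cons prefix_snoc_replicate del: replicate.simps prefix_snoc; blast?)+

lemma pmap_eqI:
  assumes "\<And>a. R L1 a \<longleftrightarrow> x = Some a" "\<And>a. R L2 a \<longleftrightarrow> y = Some a" "\<And>a. R L3 a \<longleftrightarrow> z = Some a"
  shows "R = pmap x y z"
proof (intro ext)
  show "R c a = pmap x y z c a" for c a
    using assms[of a] by (cases c) (simp_all add: pmap_def)
qed

text \<open>Read \<open>M\<close> as a partial map on letters: it takes at most one value. An image
  graph formed with it has at most one vertex on that side, so it is a star or empty.\<close>

definition one_row :: "('a \<Rightarrow> 'b \<Rightarrow> bool) \<Rightarrow> bool" where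
  "one_row M \<longleftrightarrow> (\<forall>c c' a a'. M c a \<and> M c' a' \<longrightarrow> a = a')"

lemma replicate_neq_Cons [simp]: "a \<noteq> b \<Longrightarrow> replicate n a \<noteq> b # x" "a \<noteq> b \<Longrightarrow> b # x \<noteq> replicate n a"
  by (cases n; simp)+

text \<open>The suffixes preceded by different letters in the images; only for these can the image
  graph have several left vertices.\<close>

fun lspecial :: "kind \<Rightarrow> letter list set" where
  "lspecial Alpha = {[]}"
| "lspecial Beta = {[], [L2]}"
| "lspecial Gamma = {[]}"
| "lspecial (Delta n) = {[], replicate n L3}"
| "lspecial (Zeta n) = {[], replicate n L3}"
| "lspecial Eta = {[], [L3]}"

text \<open>For \<open>Delta\<close> and \<open>Zeta\<close> a positive exponent separates the empty
  suffix from \<open>replicate n L3\<close>, at which the two maps are read.\<close>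

lemma lmap_special:
  assumes "valid k"
  shows "lmap L1 (tail k) ` lspecial k = lmaps k"
proof (cases k)
  case Alpha
  have "lmap L1 (tail k) ([]) = pmap (Some L1) (Some L2) (Some L3)"
    unfolding Alpha by (rule pmap_eqI; simp only: lmap_simps; auto simp: Let_def)
  then show ?thesis using Alpha by simp
next
  case Beta
  have "lmap L1 (tail k) ([]) = pmap (Some L1) (Some L2) (Some L2)"
    unfolding Beta by (rule pmap_eqI; simp only: lmap_simps; auto simp: Let_def)
  moreover
  have "lmap L1 (tail k) ([L2]) = pmap None (Some L1) (Some L3)"
    unfolding Beta by (rule pmap_eqI; simp only: lmap_simps; auto simp: Let_def)
  ultimately show ?thesis using Beta by simp
next
  case Gamma
  have "lmap L1 (tail k) ([]) = pmap (Some L1) (Some L2) (Some L3)"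
    unfolding Gamma by (rule pmap_eqI; simp only: lmap_simps; auto simp: Let_def)
  then show ?thesis using Gamma by simp
next
  case (Delta n)
  then have "n \<ge> 1" using assms by simp
  have "lmap L1 (tail k) ([]) = pmap (Some L1) (Some L3) (Some L3)"
    unfolding Delta by (rule pmap_eqI; insert \<open>n \<ge> 1\<close>; simp only: lmap_simps; auto simp del: replicate.simps simp: Let_def)
  moreover
  have "lmap L1 (tail k) (replicate n L3) = pmap None (Some L2) (Some L3)"
    unfolding Delta by (rule pmap_eqI; insert \<open>n \<ge> 1\<close>; simp only: lmap_simps; auto simp del: replicate.simps simp: Let_def)
  ultimately show ?thesis using Delta by simp
next
  case (Zeta n)
  then have "n \<ge> 1" using assms by simp
  have "lmap L1 (tail k) ([]) = pmap (Some L3) (Some L2) (Some L3)"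
    unfolding Zeta by (rule pmap_eqI; insert \<open>n \<ge> 1\<close>; simp only: lmap_simps; auto simp del: replicate.simps simp: Let_def)
  moreover
  have "lmap L1 (tail k) (replicate n L3) = pmap (Some L1) None (Some L3)"
    unfolding Zeta by (rule pmap_eqI; insert \<open>n \<ge> 1\<close>; simp only: lmap_simps; auto simp del: replicate.simps simp: Let_def)
  ultimately show ?thesis using Zeta by simp
next
  case Eta
  have "lmap L1 (tail k) ([]) = pmap (Some L3) (Some L2) (Some L3)"
    unfolding Eta by (rule pmap_eqI; simp only: lmap_simps; auto simp: Let_def)
  moreover
  have "lmap L1 (tail k) ([L3]) = pmap (Some L1) None (Some L2)"
    unfolding Eta by (rule pmap_eqI; simp only: lmap_simps; auto simp: Let_def)
  ultimately show ?thesis using Eta by simp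
qed

lemma lmap_nonspecial:
  assumes "s \<notin> lspecial k"
  shows "one_row (lmap L1 (tail k) s)"
  using assms unfolding one_row_def
  by (cases k; simp only: lmap_simps lspecial.simps; auto simp: less_Suc_eq Let_def simp del: replicate.simps split: if_splits)

fun rspecial :: "kind \<Rightarrow> letter list set" where
  "rspecial Alpha = {[]}"
| "rspecial Beta = {[]}"
| "rspecial Gamma = {[], [L2]}"
| "rspecial (Delta n) = {[], L2 # replicate n L3}"
| "rspecial (Zeta n) = {[], replicate n L3}"
| "rspecial Eta = {[], [L2]}"

lemma rmap_special:
  assumes "valid k"
  shows "rmap L1 (tail k) ` rspecial k = rmaps k"
proof (cases k)
  case Alpha
  have "rmap L1 (tail k) ([]) = pmap (Some L1) (Some L2) (Some L3)"
    unfolding Alpha by (rule pmap_eqI; simp only: rmap_simps; auto simp: Let_def)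
  then show ?thesis using Alpha by simp
next
  case Beta
  have "rmap L1 (tail k) ([]) = pmap (Some L1) (Some L2) (Some L3)"
    unfolding Beta by (rule pmap_eqI; simp only: rmap_simps; auto simp: Let_def)
  then show ?thesis using Beta by simp
next
  case Gamma
  have "rmap L1 (tail k) ([]) = pmap (Some L1) (Some L2) (Some L2)"
    unfolding Gamma by (rule pmap_eqI; simp only: rmap_simps; auto simp: Let_def)
  moreover
  have "rmap L1 (tail k) ([L2]) = pmap None (Some L1) (Some L3)"
    unfolding Gamma by (rule pmap_eqI; simp only: rmap_simps; auto simp: Let_def)
  ultimately show ?thesis using Gamma by simp
next
  case (Delta n)
  then have "n \<ge> 1" using assms by simp
  have "rmap L1 (tail k) ([]) = pmap (Some L1) (Some L2) (Some L2)"
    unfolding Delta by (rule pmap_eqI; insert \<open>n \<ge> 1\<close>; simp only: rmap_simps; auto simp del: replicate.simps simp: Let_def)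
  moreover
  have "rmap L1 (tail k) (L2 # replicate n L3) = pmap None (Some L1) (Some L3)"
    unfolding Delta by (rule pmap_eqI; insert \<open>n \<ge> 1\<close>; simp only: rmap_simps; auto simp del: replicate.simps simp: Let_def)
  ultimately show ?thesis using Delta by simp
next
  case (Zeta n)
  then have "n \<ge> 1" using assms by simp
  have "rmap L1 (tail k) ([]) = pmap (Some L3) (Some L2) (Some L3)"
    unfolding Zeta by (rule pmap_eqI; insert \<open>n \<ge> 1\<close>; simp only: rmap_simps; auto simp del: replicate.simps simp: Let_def)
  moreover
  have "rmap L1 (tail k) (replicate n L3) = pmap (Some L1) None (Some L3)"
    unfolding Zeta by (rule pmap_eqI; insert \<open>n \<ge> 1\<close>; simp only: rmap_simps; auto simp del: replicate.simps simp: Let_def)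
  ultimately show ?thesis using Zeta by simp
next
  case Eta
  have "rmap L1 (tail k) ([]) = pmap (Some L3) (Some L2) (Some L2)"
    unfolding Eta by (rule pmap_eqI; simp only: rmap_simps; auto simp: Let_def)
  moreover
  have "rmap L1 (tail k) ([L2]) = pmap None (Some L1) (Some L3)"
    unfolding Eta by (rule pmap_eqI; simp only: rmap_simps; auto simp: Let_def)
  ultimately show ?thesis using Eta by simp
qed

lemma rmap_nonspecial:
  assumes "s \<notin> rspecial k"
  shows "one_row (rmap L1 (tail k) s)"
  using assms unfolding one_row_def
  by (cases k; simp only: rmap_simps rspecial.simps; auto simp: less_Suc_eq Let_def simp del: replicate.simps split: if_splits)

definition mor :: "kind \<Rightarrow> letter \<Rightarrow> letter list" where
  "mor k a = L1 # tail k a"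

lemma lspecial_L1: "s \<in> lspecial k \<Longrightarrow> L1 \<notin> set s"
  by (cases k) auto

lemma rspecial_L1: "s \<in> rspecial k \<Longrightarrow> L1 \<notin> set s"
  by (cases k) auto

lemma good_one_row:
  assumes "\<And>a a' x x'. M a x \<Longrightarrow> M a' x' \<Longrightarrow> a = a'"
  shows "good l r M"
proof -
  have "acyclic3 M" unfolding acyclic3_def using assms by blast
  moreover have "connected3 M" "pers M l b" "pers M\<inverse>\<inverse> r b" for b
    unfolding connected3_def pers_def row_def share_def conversep_iff using assms by metis+
  ultimately show ?thesis unfolding good_def tree3_def by blast
qed

lemma good_one_col:
  assumes "\<And>a a' x x'. M a x \<Longrightarrow> M a' x' \<Longrightarrow> x = x'"
  shows "good l r M"
proof -
  have "good r l M\<inverse>\<inverse>" by (rule good_one_row) (use assms in auto)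
  then show ?thesis unfolding good_def using tree3_conv by (metis conversep_conversep)
qed

lemma replicate_inj: "replicate i a = replicate j a \<longleftrightarrow> i = j"
  by (simp add: replicate_eq_replicate)

section \<open>Extension graphs of words without the marker\<close>

definition unmarked_ext :: "kind \<Rightarrow> letter list \<Rightarrow> letter \<Rightarrow> letter \<Rightarrow> bool" where
  "unmarked_ext k w a b \<longleftrightarrow> (\<exists>c. sublist (a # w @ [b]) (mor k c @ [L1]))"

lemma sublist_letter: "\<not> sublist (a # w @ [b]) [c]"
  by (auto simp: sublist_Cons_right)

lemmas unmarked_simps = unmarked_ext_def mor_def letter_ex sublist_Cons_snoc prefix_snoc_Cons
  prefix_snoc_replicate sublist_replicate_snoc sublist_letter

lemma unmarked_ext_simps:
  "unmarked_ext Alpha w a b \<longleftrightarrow> (w = [] \<and> (a = L1 \<or> b = L1)) \<or> (w \<in> {[L2], [L3]} \<and> a = L1 \<and> b = L1)"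
  "unmarked_ext Beta w a b \<longleftrightarrow> (w = [] \<and> (a, b) \<in> {(L1, L1), (L1, L2), (L1, L3), (L2, L1), (L3, L2)}) \<or>
    (w = [L2] \<and> (a, b) \<in> {(L1, L1), (L3, L1)}) \<or> (w = [L3] \<and> (a, b) = (L1, L2)) \<or> (w = [L3, L2] \<and> (a, b) = (L1, L1))"
  "unmarked_ext Gamma w a b \<longleftrightarrow> (w = [] \<and> (a, b) \<in> {(L1, L1), (L1, L2), (L2, L1), (L2, L3), (L3, L1)}) \<or>
    (w = [L2] \<and> (a, b) \<in> {(L1, L1), (L1, L3)}) \<or> (w = [L3] \<and> (a, b) = (L2, L1)) \<or> (w = [L2, L3] \<and> (a, b) = (L1, L1))"
  "unmarked_ext Eta w a b \<longleftrightarrow> (w = [] \<and> (a, b) \<in> {(L1, L2), (L1, L3), (L2, L1), (L2, L3), (L3, L1)}) \<or>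
    (w = [L2] \<and> (a, b) \<in> {(L1, L1), (L1, L3)}) \<or> (w = [L3] \<and> (a, b) \<in> {(L1, L1), (L2, L1)}) \<or> (w = [L2, L3] \<and> (a, b) = (L1, L1))"
     apply (simp add: unmarked_simps del: prefix_snoc; cases a; cases b; auto)
    apply (simp add: unmarked_simps del: prefix_snoc; cases a; cases b; auto)
   apply (simp add: unmarked_simps del: prefix_snoc; cases a; cases b; auto)
  apply (simp add: unmarked_simps del: prefix_snoc; cases a; cases b; auto)
  done

lemma unmarked_ext_Delta:
  "unmarked_ext (Delta n) w a b \<longleftrightarrow> a = L1 \<and> w = [] \<and> b = L1 \<or>
    (\<exists>m\<in>{n, Suc n}. a = L1 \<and> prefix (w @ [b]) (L2 # replicate m L3 @ [L1]) \<or>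
       a = L2 \<and> prefix (w @ [b]) (replicate m L3 @ [L1]) \<or>
       a = L3 \<and> (\<exists>i<m. prefix (w @ [b]) (replicate i L3 @ [L1])))"
  by (simp add: unmarked_ext_def mor_def letter_ex sublist_Cons_snoc sublist_replicate_snoc sublist_letter
      prefix_snoc_Cons[of _ _ L1] del: prefix_snoc replicate.simps; blast?)

lemma unmarked_ext_Zeta:
  "unmarked_ext (Zeta n) w a b \<longleftrightarrow> w = [] \<and> (a, b) \<in> {(L1, L2), (L2, L1)} \<or> w = [L2] \<and> a = L1 \<and> b = L1 \<or>
    (\<exists>m\<in>{n, Suc n}. a = L1 \<and> prefix (w @ [b]) (replicate m L3 @ [L1]) \<or>
       a = L3 \<and> (\<exists>i<m. prefix (w @ [b]) (replicate i L3 @ [L1])))"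
  by (simp add: unmarked_ext_def mor_def letter_ex sublist_Cons_snoc sublist_replicate_snoc sublist_letter
      prefix_snoc_Cons del: prefix_snoc replicate.simps; blast?)

lemma unmarked_ext_replicate:
  assumes "n \<ge> 1"
  shows "unmarked_ext (Delta n) (replicate j L3) a b \<longleftrightarrow>
    (j = 0 \<and> (a, b) \<in> {(L1, L1), (L1, L2)}) \<or> (a = L2 \<and> (j \<le> n \<and> b = L3 \<or> j \<in> {n, Suc n} \<and> b = L1)) \<or>
    (a = L3 \<and> (j < n \<and> b = L3 \<or> j \<le> n \<and> b = L1))"
  "unmarked_ext (Zeta n) (replicate j L3) a b \<longleftrightarrow>
    (j = 0 \<and> (a, b) \<in> {(L1, L2), (L2, L1)}) \<or> (a = L1 \<and> (j \<le> n \<and> b = L3 \<or> j \<in> {n, Suc n} \<and> b = L1)) \<or>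
    (a = L3 \<and> (j < n \<and> b = L3 \<or> j \<le> n \<and> b = L1))"
proof -
  have pre: "prefix (replicate j L3 @ [b]) (replicate i L3 @ [L1]) \<longleftrightarrow> j < i \<and> b = L3 \<or> j = i \<and> b = L1" for i
    by (auto simp: prefix_snoc_replicate replicate_inj simp del: prefix_snoc)
  have pre': "prefix (replicate j L3 @ [b]) (L2 # replicate i L3 @ [L1]) \<longleftrightarrow> j = 0 \<and> b = L2" for i
    by (auto simp: prefix_snoc_Cons simp del: prefix_snoc)
  have ex: "(\<exists>i<m. j < i \<and> b = L3 \<or> j = i \<and> b = L1) \<longleftrightarrow> Suc j < m \<and> b = L3 \<or> j < m \<and> b = L1" for m
    by auto
  have neq: "replicate j L3 \<noteq> [L2]" by simp
  show "unmarked_ext (Delta n) (replicate j L3) a b \<longleftrightarrow>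
    (j = 0 \<and> (a, b) \<in> {(L1, L1), (L1, L2)}) \<or> (a = L2 \<and> (j \<le> n \<and> b = L3 \<or> j \<in> {n, Suc n} \<and> b = L1)) \<or>
    (a = L3 \<and> (j < n \<and> b = L3 \<or> j \<le> n \<and> b = L1))"
    unfolding unmarked_ext_Delta pre pre' ex by (cases a; cases b; simp; arith?)
  show "unmarked_ext (Zeta n) (replicate j L3) a b \<longleftrightarrow>
    (j = 0 \<and> (a, b) \<in> {(L1, L2), (L2, L1)}) \<or> (a = L1 \<and> (j \<le> n \<and> b = L3 \<or> j \<in> {n, Suc n} \<and> b = L1)) \<or>
    (a = L3 \<and> (j < n \<and> b = L3 \<or> j \<le> n \<and> b = L1))"
    unfolding unmarked_ext_Zeta pre ex using neq by (cases a; cases b; simp; arith?)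
qed

lemma unmarked_ext_no_replicate:
  assumes "\<And>j. w \<noteq> replicate j L3" "unmarked_ext k w a b" "k = Delta n \<or> k = Zeta n"
  shows "a = L1"
proof -
  have np: "\<not> prefix (w @ [b]) (replicate i L3 @ [L1])" for i
    using assms(1) by (auto simp: prefix_snoc_replicate simp del: prefix_snoc)
  have "w \<noteq> []" using assms(1)[of 0] by simp
  with np assms(2,3) show ?thesis
    by (auto simp: unmarked_ext_Delta unmarked_ext_Zeta simp del: prefix_snoc replicate.simps)
qed

text \<open>Several vertices on both sides arise only for the empty word and, in the case of
  \<open>Delta\<close> and \<open>Zeta\<close>, for powers of \<open>L3\<close>; all other graphs
  are stars or empty.\<close>

lemma good_unmarked_ext:
  assumes "valid k" "centers k l r l' r'"
  shows "good l r (unmarked_ext k w)"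
proof (cases k)
  case Alpha
  show ?thesis
  proof (cases "w = []")
    case True
    then show ?thesis unfolding Alpha unmarked_ext_simps
      by (cases l; cases r; simp add: bool_simps)
  next
    case False
    show ?thesis by (rule good_one_row) (use False in \<open>auto simp: Alpha unmarked_ext_simps\<close>)
  qed
next
  case Beta
  then have "l = L1" using assms by simp
  show ?thesis
  proof (cases "w = []")
    case True
    then show ?thesis unfolding Beta unmarked_ext_simps \<open>l = L1\<close>
      by (cases r; simp add: bool_simps)
  next
    case False
    show ?thesis by (rule good_one_col) (use False in \<open>auto simp: Beta unmarked_ext_simps\<close>)
  qed
next
  case Gamma
  then have "r = L1" using assms by simp
  show ?thesis
  proof (cases "w = []")
    case True
    then show ?thesis unfolding Gamma unmarked_ext_simps \<open>r = L1\<close>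
      by (cases l; simp add: bool_simps)
  next
    case False
    show ?thesis by (rule good_one_row) (use False in \<open>auto simp: Gamma unmarked_ext_simps\<close>)
  qed
next
  case Eta
  then have lr: "l = L2" "r = L3" using assms by simp_all
  consider "w = []" | "w = [L3]" | "w \<noteq> []" "w \<noteq> [L3]" by blast
  then show ?thesis
  proof cases
    case 1
    then show ?thesis unfolding Eta unmarked_ext_simps lr
      by (simp add: bool_simps)
  next
    case 2
    show ?thesis by (rule good_one_col) (use 2 in \<open>auto simp: Eta unmarked_ext_simps\<close>)
  next
    case 3
    show ?thesis by (rule good_one_row) (use 3 in \<open>auto simp: Eta unmarked_ext_simps\<close>)
  qed
next
  case (Delta n)
  then have lr: "l = L3" "r = L1" and n: "n \<ge> 1" using assms by simp_all
  show ?thesis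
  proof (cases "\<exists>j. w = replicate j L3")
    case True
    then obtain j where w: "w = replicate j L3" by blast
    \<comment> \<open>For \<open>0 < j < n\<close> the graph is a path through the edge from
      \<open>L3\<close> to \<open>L3\<close>; at \<open>j = n\<close> this edge is lost and the
      outer letters become adjacent; at \<open>Suc n\<close> one edge remains, and beyond it
      none.\<close>
    consider "j = 0" | "1 \<le> j" "j < n" | "1 \<le> j" "j = n" | "j = Suc n" | "j > Suc n" by linarith
    then show ?thesis
      by cases (use n in \<open>simp_all add: bool_simps w lr unmarked_ext_replicate(1)[OF n] Delta del: replicate.simps\<close>)
  next
    case False
    show ?thesis by (rule good_one_row) (use False Delta unmarked_ext_no_replicate in metis)
  qed
next
  case (Zeta n)
  then have lr: "l = L3" "r = L3" and n: "n \<ge> 1" using assms by simp_all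
  show ?thesis
  proof (cases "\<exists>j. w = replicate j L3")
    case True
    then obtain j where w: "w = replicate j L3" by blast
    consider "j = 0" | "1 \<le> j" "j < n" | "1 \<le> j" "j = n" | "j = Suc n" | "j > Suc n" by linarith
    then show ?thesis
      by cases (use n in \<open>simp_all add: bool_simps w lr unmarked_ext_replicate(2)[OF n] Zeta del: replicate.simps\<close>)
  next
    case False
    show ?thesis by (rule good_one_row) (use False Zeta unmarked_ext_no_replicate in metis)
  qed
qed

lemma (in return_morphism) ext_image_marked:
  assumes "urlang K" "z \<notin> set s" "z \<notin> set p"
  shows "ext (image_lang f K) (s @ wmap f u @ z # p) = (\<lambda>a b. \<exists>c d. ext K u c d \<and> lmap z t s c a \<and> rmap z t p d b)"
  unfolding ext_def using marked_word_in_image[OF assms] by (intro HOL.ext) simp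

lemma ext_image_mor:
  assumes "urlang K" "L1 \<notin> set s" "L1 \<notin> set p"
  shows "ext (image_lang (mor k) K) (s @ wmap (mor k) u @ L1 # p) =
    img (lmap L1 (tail k) s) (rmap L1 (tail k) p) (ext K u)"
proof -
  interpret return_morphism L1 "tail k" by (rule return_morphism_tail)
  have "mor k = f" by (simp add: mor_def fun_eq_iff)
  moreover have "img g h M = (\<lambda>a b. \<exists>c d. M c d \<and> g c a \<and> h d b)" for g h M
    by (intro HOL.ext) (simp add: img_def)
  ultimately show ?thesis using ext_image_marked[OF assms, of u] by metis
qed

text \<open>Words without marker are settled by the morphism alone. For the others the graph is the
  image of that of \<open>u\<close>, and it is a star or empty unless both \<open>s\<close> and
  \<open>p\<close> are special.\<close>

lemma good_image:
  assumes k: "valid k" "centers k l r l' r'" and K: "urlang K"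
    and good: "\<And>u. length u < length w \<Longrightarrow> good l' r' (ext K u)"
  shows "good l r (ext (image_lang (mor k) K) w)"
proof -
  interpret return_morphism L1 "tail k" by (rule return_morphism_tail)
  have mor: "mor k = f" by (simp add: mor_def fun_eq_iff)
  let ?L = "image_lang (mor k) K"
  show ?thesis
  proof (cases "L1 \<in> set w")
    case False
    then have "ext ?L w = unmarked_ext k w"
      unfolding ext_def unmarked_ext_def mor using unmarked_word_in_image[OF K] by (intro HOL.ext) simp
    then show ?thesis using good_unmarked_ext[OF k] by simp
  next
    case True
    show ?thesis
    proof (cases "w \<in> ?L")
      case False
      have "\<not> ext ?L w a b" for a b
      proof
        assume "ext ?L w a b"
        then obtain v where "v \<in> K" "sublist (a # w @ [b]) (wmap (mor k) v)" by (auto simp: ext_def image_lang_def)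
        moreover have "sublist w (a # w @ [b])" by (auto simp: sublist_def intro: exI[of _ "[a]"])
        ultimately show False using False sublist_order.order_trans unfolding image_lang_def by blast
      qed
      then show ?thesis by (intro good_one_row) blast
    next
      case inL: True
      then obtain s u p where w: "w = s @ wmap f u @ L1 # p" "L1 \<notin> set s" "L1 \<notin> set p"
        using marked_word_form[of w K] True mor by metis
      \<comment> \<open>The marker in front of \<open>p\<close> is not part of the decoded factor,
        whence the strict inequality.\<close>
      have "length u < length w" using w(1) length_wmap[of u] by simp
      then have M: "good l' r' (ext K u)" by (rule good)
      have eq: "ext ?L w = img (lmap L1 (tail k) s) (rmap L1 (tail k) p) (ext K u)"
        using ext_image_mor[OF K w(2,3), of k u] w(1) mor by simp
      consider "s \<in> lspecial k" "p \<in> rspecial k" | "s \<notin> lspecial k" | "p \<notin> rspecial k" by blast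
      then show ?thesis
      proof cases
        case 1
        then have "lmap L1 (tail k) s \<in> lmaps k" "rmap L1 (tail k) p \<in> rmaps k"
          using lmap_special[OF k(1)] rmap_special[OF k(1)] by blast+
        then show ?thesis unfolding eq by (rule good_img[OF k(2) M])
      next
        case 2
        show ?thesis unfolding eq
          by (rule good_one_row) (use lmap_nonspecial[OF 2] in \<open>unfold img_def one_row_def, blast\<close>)
      next
        case 3
        show ?thesis unfolding eq
          by (rule good_one_col) (use rmap_nonspecial[OF 3] in \<open>unfold img_def one_row_def, blast\<close>)
      qed
    qed
  qed
qed

text \<open>Every pair of maps is realised by words of the image language, so
  \<open>good_imgs\<close> applies. A side acting injectively determines its common letter; a glued
  pair shares a neighbour in all graphs, and \<open>left_center\<close> or
  \<open>right_center\<close> picks one of its letters.\<close>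

lemma good_preimage:
  assumes k: "valid k" "centers k l r l0 r0" and K: "urlang K"
    and good: "\<And>w. good l r (ext (image_lang (mor k) K) w)"
  shows "\<exists>l' r'. centers k l r l' r' \<and> (\<forall>u. good l' r' (ext K u))"
proof -
  have imgs: "good l r (img f g (ext K u))" if fg: "f \<in> lmaps k" "g \<in> rmaps k" for f g u
  proof -
    obtain s p where "s \<in> lspecial k" "f = lmap L1 (tail k) s" "p \<in> rspecial k" "g = rmap L1 (tail k) p"
      using lmap_special[OF k(1)] rmap_special[OF k(1)] fg by (metis imageE)
    then show ?thesis
      using ext_image_mor[OF K lspecial_L1 rspecial_L1, of s k p k k u] good by metis
  qed
  obtain b c where bc: "merging (lmaps k) b c l" "\<And>x. x \<in> {b, c} \<Longrightarrow> centers k l r x r0"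
    using merging_lmaps[OF k(2)] by metis
  obtain b0 c0 where bc0: "merging (rmaps k) b0 c0 r"
    using merging_rmaps[OF k(2)] by metis
  note L = good_imgs[OF bc(1) bc0 imgs]
  have tree: "tree3 (ext K u)" for u using L(1) by blast
  obtain l' where l': "l' \<in> {b, c}" "\<And>u d. pers (ext K u) l' d"
  proof (cases "b = c")
    case True
    then show ?thesis using that[of b] L(4) by blast
  next
    case False
    have "\<exists>l\<in>{b, c}. \<forall>w d. pers (ext K w) l d"
      by (rule left_center[OF K tree False]) (rule L(2))
    then show ?thesis using that by blast
  qed
  \<comment> \<open>The candidates on the right are taken anew with the chosen \<open>l'\<close>, so
    that \<open>centers\<close> will hold for \<open>l'\<close> and \<open>r'\<close>
    together.\<close>
  obtain b' c' where bc': "merging (rmaps k) b' c' r" "\<And>x. x \<in> {b', c'} \<Longrightarrow> centers k l r l' x"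
    using merging_rmaps[OF bc(2)[OF l'(1)]] by metis
  note R = good_imgs[OF bc(1) bc'(1) imgs]
  obtain r' where r': "r' \<in> {b', c'}" "\<And>u d. pers (ext K u)\<inverse>\<inverse> r' d"
  proof (cases "b' = c'")
    case True
    then show ?thesis using that[of b'] R(5) by blast
  next
    case False
    have "\<exists>r\<in>{b', c'}. \<forall>w d. pers (ext K w)\<inverse>\<inverse> r d"
      by (rule right_center[OF K tree False]) (rule R(3))
    then show ?thesis using that by blast
  qed
  show ?thesis using bc'(2)[OF r'(1)] tree l'(2) r'(2) unfolding good_def by blast
qed

section \<open>Desubstitution\<close>

context return_morphism
begin

lemma desubstitute_word:
  assumes L: "urlang L"
    and blocks: "\<And>v. z \<notin> set v \<Longrightarrow> z # v @ [z] \<in> L \<Longrightarrow> v \<in> range t"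
  shows "z # w @ [z] \<in> L \<Longrightarrow> \<exists>u. z # w = wmap f u"
proof (induction w rule: length_induct)
  case (1 w)
  show ?case
  proof (cases "z \<in> set w")
    case False
    then obtain a where "w = t a" using blocks 1 by blast
    then show ?thesis by (intro exI[of _ "[a]"]) simp
  next
    case True
    then obtain p q where w: "w = p @ z # q" "z \<notin> set p" by (meson split_list_first)
    have "(z # p @ [z]) @ q @ [z] \<in> L" "(z # p) @ z # q @ [z] \<in> L" using 1(2) w by simp_all
    then have "z # p @ [z] \<in> L" "z # q @ [z] \<in> L"
      using urlang_appendD1[OF L] urlang_appendD2[OF L] by blast+
    moreover have "length q < length w" using w by simp
    ultimately obtain u a where "z # q = wmap f u" "p = t a" using 1(1) blocks w(2) by blast
    then show ?thesis using w(1) by (intro exI[of _ "a # u"]) simp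
  qed
qed

lemma wmap_marker: "\<exists>x. wmap f u @ [z] = z # x"
  by (cases u) auto

text \<open>The final \<open>z\<close> in \<open>K\<close> forces the last image to be complete:
  otherwise an image that is a proper prefix of a longer one could be read off inside the latter.
  Recurrence of \<open>z\<close> places every word of \<open>L\<close> between two markers.\<close>

lemma desubstitute:
  assumes L: "urlang L"
    and blocks: "\<And>v. z \<notin> set v \<Longrightarrow> z # v @ [z] \<in> L \<longleftrightarrow> v \<in> range t"
  defines "K \<equiv> {u. wmap f u @ [z] \<in> L}"
  shows "urlang K" "L = image_lang f K"
proof -
  show "L = image_lang f K"
  proof (intro equalityI subsetI)
    fix w assume "w \<in> L"
    then obtain y where "w @ y @ [z] \<in> L" using urlang_next[OF L] by metis
    then obtain y' where "z # y' @ (w @ y @ [z]) \<in> L" using urlang_prev[OF L] by metis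
    then have inL: "z # (y' @ w @ y) @ [z] \<in> L" by simp
    then obtain u where u: "z # (y' @ w @ y) = wmap f u" using desubstitute_word[OF L] blocks by blast
    then have "u \<in> K" using inL unfolding K_def by (metis append_Cons mem_Collect_eq)
    moreover have "sublist w (wmap f u)" unfolding u[symmetric] sublist_def by (metis append_Cons)
    ultimately show "w \<in> image_lang f K" unfolding image_lang_def by blast
  next
    fix w assume "w \<in> image_lang f K"
    then show "w \<in> L" unfolding image_lang_def K_def
      using urlang_sublist[OF L] urlang_appendD1[OF L] by blast
  qed
  have left: "\<exists>a. a # u \<in> K" if "u \<in> K" for u
  proof -
    have "wmap f u @ [z] \<in> L" using that K_def by simp
    then obtain y where y: "z \<notin> set y" "z # y @ wmap f u @ [z] \<in> L" using urlang_prev[OF L] by metis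
    moreover obtain x where "wmap f u @ [z] = z # x" using wmap_marker by blast
    ultimately have "(z # y @ [z]) @ x \<in> L" by simp
    then have "z # y @ [z] \<in> L" by (rule urlang_appendD1[OF L])
    then obtain a where "y = t a" using blocks y(1) by blast
    then have "a # u \<in> K" using y(2) K_def by simp
    then show ?thesis by blast
  qed
  have right: "\<exists>b. u @ [b] \<in> K" if "u \<in> K" for u
  proof -
    have "wmap f u @ [z] \<in> L" using that K_def by simp
    then obtain y where y: "z \<notin> set y" "(wmap f u @ [z]) @ y @ [z] \<in> L" using urlang_next[OF L] by metis
    then have "z # y @ [z] \<in> L" using urlang_appendD2[OF L, of "wmap f u"] by simp
    then obtain b where "y = t b" using blocks y(1) by blast
    then have "u @ [b] \<in> K" using y(2) K_def by simp
    then show ?thesis by blast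
  qed
  show "urlang K" unfolding urlang_def
  proof (intro conjI allI impI ballI)
    show "u \<in> K" if uv: "v \<in> K \<and> sublist u v" for u v
    proof -
      obtain p q where v: "v = p @ u @ q" using uv unfolding sublist_def by blast
      obtain x where "wmap f q @ [z] = z # x" using wmap_marker by blast
      then have "wmap f v @ [z] = wmap f p @ (wmap f u @ [z]) @ x" using v by simp
      then show ?thesis using uv urlang_appendD[OF L] unfolding K_def by (metis mem_Collect_eq)
    qed
    show "[a] \<in> K" for a using blocks[OF z_notin, of a] unfolding K_def by simp
    show "\<exists>a b. a # w @ [b] \<in> K" if "w \<in> K" for w
      using left[OF that] right by (metis append_Cons)
    show "\<exists>N. \<forall>u\<in>K. N \<le> length u \<longrightarrow> sublist w u" if "w \<in> K" for w
    proof -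
      have "wmap f w @ [z] \<in> L" using that K_def by simp
      then obtain N where N: "\<And>u. \<lbrakk>u \<in> L; N \<le> length u\<rbrakk> \<Longrightarrow> sublist (wmap f w @ [z]) u"
        using urlang_recurrent[OF L] by blast
      have "sublist w u" if u: "u \<in> K" "N \<le> length u" for u
      proof -
        have "N \<le> length (wmap f u @ [z])" using u(2) length_wmap[of u] by simp
        then show ?thesis using N sublist_wmap_marked u(1) unfolding K_def by blast
      qed
      then show ?thesis by blast
    qed
  qed
qed

end

section \<open>Return words to the first letter\<close>

lemma urlang_pair: "\<lbrakk>urlang L; x @ a # b # y \<in> L\<rbrakk> \<Longrightarrow> ext L [] a b"
  unfolding ext_def using urlang_appendD[of L x "[a, b]" y] by simp

lemma urlang_forced_next:
  assumes L: "urlang L" and "w @ [a] \<in> L" and "\<And>x. ext L [] a x \<Longrightarrow> x = b"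
  shows "w @ [a, b] \<in> L"
proof -
  obtain x where x: "w @ [a, x] \<in> L" using urlang_right[OF L assms(2)] by auto
  then have "ext L [] a x" using urlang_pair[OF L, of w a x "[]"] by simp
  then show ?thesis using x assms(3) by blast
qed

lemma urlang_forced_prev:
  assumes L: "urlang L" and "a # w \<in> L" and "\<And>x. ext L [] x a \<Longrightarrow> x = b"
  shows "b # a # w \<in> L"
proof -
  obtain x where x: "x # a # w \<in> L" using urlang_left[OF L assms(2)] by auto
  then have "ext L [] x a" using urlang_pair[OF L, of "[]" x a w] by simp
  then show ?thesis using x assms(3) by blast
qed

lemma run_of_letter:
  assumes L: "urlang L" and "\<And>x. ext L [] c x \<Longrightarrow> x = c \<or> x = z"
  shows "w @ c # v \<in> L \<Longrightarrow> z \<notin> set v \<Longrightarrow> \<exists>j. v = replicate j c"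
proof (induction v arbitrary: w)
  case Nil
  then show ?case by (intro exI[of _ 0]) simp
next
  case (Cons x v)
  then have "x = c" using urlang_pair[OF L] assms(2) by (metis list.set_intros(1))
  then have "\<exists>j. v = replicate j c" using Cons.IH[of "w @ [c]"] Cons.prems by simp
  then obtain j where "v = replicate j c" by blast
  then show ?case using \<open>x = c\<close> by (intro exI[of _ "Suc j"]) simp
qed

lemma replicate_snoc: "replicate n c @ [c] = c # replicate n c"
  by (metis replicate_Suc replicate_append_same)

text \<open>If \<open>m\<close> is the largest exponent of \<open>c\<close> in the language, the extension graph of \<open>c\<^sup>j\<close> for \<open>j < m - 1\<close>
  has the path \<open>x - c - c - y\<close>, which excludes the edge \<open>x - y\<close>, while for \<open>j = m - 1\<close> it lacks the
  edge \<open>c - c\<close> and needs \<open>x - y\<close> to be connected.\<close>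

lemma power_exponents:
  assumes L: "urlang L" and tree: "\<And>w. tree3 (ext L w)" and neq: "x \<noteq> c" "y \<noteq> c"
    and prev: "\<And>a. ext L [] a c \<Longrightarrow> a = c \<or> a = x"
    and succ: "\<And>b. ext L [] c b \<Longrightarrow> b = c \<or> b = y"
    and cc: "ext L [] c c"
  obtains n where "n \<ge> 1" "\<And>j. j \<ge> 1 \<Longrightarrow> x # replicate j c @ [y] \<in> L \<longleftrightarrow> j = n \<or> j = Suc n"
proof -
  \<comment> \<open>The exponents of \<open>c\<close> are bounded because every long word contains
    \<open>x\<close>.\<close>
  define J where "J = {j. replicate j c \<in> L}"
  obtain N where N: "\<And>u. \<lbrakk>u \<in> L; N \<le> length u\<rbrakk> \<Longrightarrow> sublist [x] u"
    using urlang_recurrent[OF L urlang_letter[OF L]] by blast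
  have "j < N" if "j \<in> J" for j
  proof (rule ccontr)
    assume "\<not> j < N"
    then have "x \<in> set (replicate j c)" using N[of "replicate j c"] that J_def sublist_singleton[of x] by auto
    then show False using neq(1) by auto
  qed
  then have fin: "finite J" by (meson bounded_nat_set_is_finite)
  have "2 \<in> J" using cc by (simp add: J_def ext_def numeral_2_eq_2)
  define m where "m = Max J"
  have m: "m \<in> J" "m \<ge> 2" using fin \<open>2 \<in> J\<close> Max_in Max_ge unfolding m_def by blast+
  have top: "replicate (Suc m) c \<notin> L" using Max_ge[OF fin, of "Suc m"] unfolding m_def J_def by auto
  have down: "replicate j c \<in> L" if "j \<le> m" for j
    using m(1) urlang_appendD1[OF L, of "replicate j c" "replicate (m - j) c"] that
    by (simp add: J_def replicate_add[symmetric])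
  obtain m' where m': "m = Suc m'" using m(2) by (cases m) auto
  obtain a where a: "a # replicate m c \<in> L" using urlang_left[OF L] m(1) J_def by blast
  then have "ext L [] a c" using urlang_pair[OF L, of "[]" a c "replicate m' c"] m' by simp
  then have "a = x" using prev a top by auto
  obtain b where b: "replicate m c @ [b] \<in> L" using urlang_right[OF L] m(1) J_def by blast
  then have "ext L [] c b" using urlang_pair[OF L, of "replicate m' c" c b "[]"] m'
    by (simp add: replicate_app_Cons_same)
  then have "b = y" using succ[of b] b top by (metis replicate_Suc replicate_snoc)
  have left: "x # replicate j c \<in> L" if "j \<le> m" for j
    using a \<open>a = x\<close> urlang_appendD1[OF L, of "x # replicate j c" "replicate (m - j) c"] that
    by (simp add: replicate_add[symmetric])
  have right: "replicate j c @ [y] \<in> L" if "j \<le> m" for j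
    using b \<open>b = y\<close> urlang_appendD2[OF L, of "replicate (m - j) c" "replicate j c @ [y]"] that
    by (simp add: append_assoc[symmetric] replicate_add[symmetric] del: append_assoc)
  have xc: "ext L (replicate j c) x c" if "j < m" for j
    using left[of "Suc j"] that by (simp add: ext_def replicate_snoc)
  have cy: "ext L (replicate j c) c y" if "j < m" for j
    using right[of "Suc j"] that by (simp add: ext_def)
  have "x # replicate j c @ [y] \<in> L \<longleftrightarrow> j = m' \<or> j = Suc m'" if j1: "j \<ge> 1" for j
  proof -
    \<comment> \<open>For \<open>j \<ge> 1\<close> the power begins and ends with \<open>c\<close>,
      so that \<open>prev\<close> and \<open>succ\<close> restrict its neighbours.\<close>
    obtain i where i: "j = Suc i" using j1 by (cases j) auto
    have rows: "a = c \<or> a = x" if "a # replicate j c \<in> L" for a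
      using prev urlang_pair[OF L, of "[]" a c "replicate i c"] that i by simp
    have cols: "b = c \<or> b = y" if "replicate j c @ [b] \<in> L" for b
      using succ urlang_pair[OF L, of "replicate i c" c b "[]"] that i by (simp add: replicate_app_Cons_same)
    consider "j < m'" | "j = m'" | "j = m" | "j > m" using m' by linarith
    then show ?thesis
    proof cases
      case 1
      have "ext L (replicate j c) c c" using down[of "Suc (Suc j)"] 1 m' by (simp add: ext_def replicate_snoc)
      then have "\<not> ext L (replicate j c) x y"
        using xc[of j] cy[of j] 1 m' tree[of "replicate j c"] neq unfolding tree3_def acyclic3_def by (metis less_SucI)
      then show ?thesis using 1 by (simp add: ext_def)
    next
      case 2
      let ?M = "ext L (replicate j c)"
      have "row ?M x" "row ?M c" using xc[of j] cy[of j] 2 m' unfolding row_def by auto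
      then have "share ?M x c \<or> (\<exists>a. share ?M x a \<and> share ?M a c)"
        using tree unfolding tree3_def connected3_def by blast
      moreover have "a = c \<or> a = x" if xa: "share ?M x a" for a
      proof -
        obtain b where "a # replicate j c @ [b] \<in> L" using xa unfolding share_def ext_def by blast
        then show ?thesis using rows urlang_appendD1[OF L, of "a # replicate j c" "[b]"] by simp
      qed
      ultimately have "share ?M x c" by blast
      then obtain b where b: "?M x b" "?M c b" unfolding share_def by blast
      then have "b = c \<or> b = y" using cols urlang_ConsD[OF L] unfolding ext_def by blast
      moreover have "\<not> ?M c c" using top 2 m' by (simp add: ext_def replicate_snoc)
      ultimately show ?thesis using b 2 by (auto simp: ext_def)
    next
      case 3
      obtain b where "x # replicate m c @ [b] \<in> L" using urlang_right[OF L left[of m]] by auto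
      moreover from this have "b = c \<or> b = y" using cols urlang_ConsD[OF L] 3 by blast
      moreover have "b \<noteq> c" using top urlang_ConsD[OF L] calculation(1) by (auto simp: replicate_snoc)
      ultimately show ?thesis using 3 m' by auto
    next
      case 4
      then have "replicate j c \<notin> L" using Max_ge[OF fin, of j] unfolding m_def J_def by auto
      then show ?thesis using 4 m' urlang_appendD[OF L, of "[x]" "replicate j c" "[y]"] by auto
    qed
  qed
  then show ?thesis using that[of m'] m(2) m' by simp
qed

text \<open>The extension graph of the empty word in an image of this kind, a tree with five edges
  on six vertices. It reveals the kind but not the exponent, hence
  \<open>same_family\<close>.\<close>

fun pattern :: "kind \<Rightarrow> (letter \<times> letter) set" where
  "pattern Alpha = {(L1, L1), (L1, L2), (L1, L3), (L2, L1), (L3, L1)}"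
| "pattern Beta = {(L1, L1), (L1, L2), (L1, L3), (L2, L1), (L3, L2)}"
| "pattern Gamma = {(L1, L1), (L1, L2), (L2, L1), (L2, L3), (L3, L1)}"
| "pattern (Delta n) = {(L1, L1), (L1, L2), (L2, L3), (L3, L1), (L3, L3)}"
| "pattern (Zeta n) = {(L1, L2), (L1, L3), (L2, L1), (L3, L1), (L3, L3)}"
| "pattern Eta = {(L1, L2), (L1, L3), (L2, L1), (L2, L3), (L3, L1)}"

fun same_family :: "kind \<Rightarrow> kind \<Rightarrow> bool" where
  "same_family (Delta n) k \<longleftrightarrow> (\<exists>m. k = Delta m)"
| "same_family (Zeta n) k \<longleftrightarrow> (\<exists>m. k = Zeta m)"
| "same_family k k' \<longleftrightarrow> k' = k"

lemma UNIV_letter: "UNIV = {L1, L2, L3}"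
  using letter.exhaust by blast

lemma range_letter: "range g = {g L1, g L2, g L3}"
  by (simp add: UNIV_letter)

text \<open>In the kinds without exponent, three consecutive letters other than \<open>L1\<close>
  are impossible, so few return words remain, and forced neighbours show that they all occur. For
  \<open>Delta\<close> and \<open>Zeta\<close> the edge from \<open>L3\<close> to itself allows
  runs, whose two exponents come from \<open>power_exponents\<close>.\<close>

lemma pattern_return_words:
  assumes L: "urlang L" and tree: "\<And>w. tree3 (ext L w)"
    and P: "\<And>a b. ext L [] a b \<longleftrightarrow> (a, b) \<in> pattern k"
  shows "\<exists>k'. valid k' \<and> same_family k k' \<and>
    (\<forall>v. L1 \<notin> set v \<longrightarrow> (L1 # v @ [L1] \<in> L \<longleftrightarrow> v \<in> range (tail k')))"
proof -
  have pair: "(a, b) \<in> pattern k" if "x @ a # b # y \<in> L" for x a b y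
    using urlang_pair[OF L that] P by simp
  have inL: "[a, b] \<in> L" if "(a, b) \<in> pattern k" for a b
    using that P by (simp add: ext_def flip: P)
  have succ: "w @ [a, b] \<in> L" if "w @ [a] \<in> L" "\<And>x. (a, x) \<in> pattern k \<Longrightarrow> x = b" for w a b
    using urlang_forced_next[OF L that(1)] that(2) P by blast
  have prev: "b # a # w \<in> L" if "a # w \<in> L" "\<And>x. (x, a) \<in> pattern k \<Longrightarrow> x = b" for w a b
    using urlang_forced_prev[OF L that(1)] that(2) P by blast
  have short: "v = [] \<or> (\<exists>x. v = [x]) \<or> (\<exists>x y. v = [x, y]) \<or> (\<exists>x y x' v'. v = x # y # x' # v')" for v :: "letter list"
    by (metis list.exhaust)
  have only_if: "v \<in> range (tail k)"
    if k: "k \<in> {Alpha, Beta, Gamma, Eta}" and v: "L1 \<notin> set v" "L1 # v @ [L1] \<in> L" for v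
    using short[of v]
  proof (elim disjE exE)
    assume "v = []"
    then have "(L1, L1) \<in> pattern k" using v(2) pair[of "[]" L1 L1 "[]"] by simp
    then show ?thesis using k \<open>v = []\<close> by (auto simp: range_letter)
  next
    fix x assume "v = [x]"
    then have "(L1, x) \<in> pattern k" "(x, L1) \<in> pattern k" "x \<noteq> L1"
      using v pair[of "[]" L1 x "[L1]"] pair[of "[L1]" x L1 "[]"] by auto
    then show ?thesis using k \<open>v = [x]\<close> by (cases x) (auto simp: range_letter)
  next
    fix x y assume "v = [x, y]"
    then have "(L1, x) \<in> pattern k" "(x, y) \<in> pattern k" "(y, L1) \<in> pattern k" "x \<noteq> L1" "y \<noteq> L1"
      using v pair[of "[]" L1 x "[y, L1]"] pair[of "[L1]" x y "[L1]"] pair[of "[L1, x]" y L1 "[]"] by auto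
    then show ?thesis using k \<open>v = [x, y]\<close> by (cases x; cases y) (auto simp: range_letter)
  next
    fix x y x' v' assume "v = x # y # x' # v'"
    then have "(x, y) \<in> pattern k" "(y, x') \<in> pattern k" "x \<noteq> L1" "y \<noteq> L1" "x' \<noteq> L1"
      using v pair[of "[L1]" x y "x' # v' @ [L1]"] pair[of "[L1, x]" y x' "v' @ [L1]"] by auto
    then show ?thesis using k by (cases x; cases y; cases x') auto
  qed
  have range_sub: "L1 # tail k a @ [L1] \<in> L" if k: "k \<in> {Alpha, Beta, Gamma, Eta}" for a
  proof -
    consider "k = Alpha" | "k = Beta" | "k = Gamma" | "k = Eta" using k by blast
    then show ?thesis
    proof cases
      case 1
      show ?thesis using 1 inL[of L1 L1] succ[of "[L1]" L2 L1] succ[of "[L1]" L3 L1] inL[of L1 L2] inL[of L1 L3]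
        by (cases a) auto
    next
      case 2
      then have "[L1, L2] @ [L1] \<in> L" "[L1, L3] @ [L2] \<in> L" "[L1, L1] \<in> L"
        using inL[of L1 L1] succ[of "[L1]" L2 L1] succ[of "[L1]" L3 L2] inL[of L1 L2] inL[of L1 L3] by auto
      moreover from this have "[L1, L3] @ [L2, L1] \<in> L" by (intro succ) (use 2 in auto)
      ultimately show ?thesis using 2 by (cases a) auto
    next
      case 3
      then have "[L1, L2, L1] \<in> L" "[L1, L2] @ [L3] \<in> L" "[L1, L1] \<in> L"
        using inL[of L1 L1] prev[of L2 "[L1]" L1] prev[of L2 "[L3]" L1] inL[of L2 L1] inL[of L2 L3] by auto
      moreover from this have "[L1, L2] @ [L3, L1] \<in> L" by (intro succ) (use 3 in auto)
      ultimately show ?thesis using 3 by (cases a) auto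
    next
      case 4
      then have "[L1, L2, L1] \<in> L" "[L1, L2] @ [L3] \<in> L" "[L1, L3, L1] \<in> L"
        using succ[of "[L1]" L3 L1] prev[of L2 "[L1]" L1] prev[of L2 "[L3]" L1] inL[of L2 L1] inL[of L1 L3] inL[of L2 L3] by auto
      moreover from this have "[L1, L2] @ [L3, L1] \<in> L" by (intro succ) (use 4 in auto)
      ultimately show ?thesis using 4 by (cases a) auto
    qed
  qed
  have fixed: ?thesis if "k \<in> {Alpha, Beta, Gamma, Eta}"
    using only_if[OF that] range_sub[OF that] that by (intro exI[of _ k]) auto
  have run: "\<exists>j. v = replicate j L3" if "w @ L3 # v @ [L1] \<in> L" "L1 \<notin> set v" "(L3, L2) \<notin> pattern k" for w v
  proof (rule run_of_letter[OF L _ _ that(2)])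
    show "x = L3 \<or> x = L1" if "ext L [] L3 x" for x
      using that \<open>(L3, L2) \<notin> pattern k\<close> P by (cases x) auto
    show "w @ L3 # v \<in> L" using urlang_appendD1[OF L, of "w @ L3 # v" "[L1]"] that(1) by simp
  qed
  show ?thesis
  proof (cases k)
    case (Delta m)
    obtain n where n: "n \<ge> 1" "\<And>j. j \<ge> 1 \<Longrightarrow> L2 # replicate j L3 @ [L1] \<in> L \<longleftrightarrow> j = n \<or> j = Suc n"
      by (rule power_exponents[OF L tree, of L2 L3 L1]) (auto simp: P Delta)
    have "L1 # v @ [L1] \<in> L \<longleftrightarrow> v \<in> range (tail (Delta n))" if v: "L1 \<notin> set v" for v
    proof
      assume a: "L1 # v @ [L1] \<in> L"
      show "v \<in> range (tail (Delta n))"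
      proof (cases v)
        case Nil
        then show ?thesis by (simp add: range_letter)
      next
        case (Cons x v1)
        then have x: "x = L2" using a v pair[of "[]" L1 x "v1 @ [L1]"] by (auto simp: Delta)
        then have "v1 \<noteq> []" using a Cons pair[of "[L1]" x L1 "[]"] by (auto simp: Delta)
        then obtain y v2 where v1: "v1 = y # v2" by (cases v1) auto
        then have y: "y = L3" using a x v Cons pair[of "[L1]" x y "v2 @ [L1]"] by (auto simp: Delta)
        then obtain j where "v2 = replicate j L3" using run[of "[L1, L2]" v2] a v Cons v1 x by (auto simp: Delta)
        then have v': "v = L2 # replicate (Suc j) L3" using Cons v1 x y by simp
        then have "L2 # replicate (Suc j) L3 @ [L1] \<in> L" using urlang_ConsD[OF L a] by simp
        then have "Suc j = n \<or> Suc j = Suc n" using n(2)[of "Suc j"] by simp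
        then show ?thesis using v' by (auto simp: range_letter)
      qed
    next
      assume "v \<in> range (tail (Delta n))"
      then consider "v = []" | j where "v = L2 # replicate j L3" "j = n \<or> j = Suc n"
        unfolding range_letter tail.simps mk3_simps by blast
      then show "L1 # v @ [L1] \<in> L"
      proof cases
        case 1
        then show ?thesis using inL[of L1 L1] by (simp add: Delta)
      next
        case 2
        then have "L2 # (replicate j L3 @ [L1]) \<in> L" using n by auto
        then have "L1 # L2 # (replicate j L3 @ [L1]) \<in> L" by (rule prev) (auto simp: Delta)
        then show ?thesis using 2 by simp
      qed
    qed
    then show ?thesis using n(1) Delta by (intro exI[of _ "Delta n"]) auto
  next
    case (Zeta m)
    obtain n where n: "n \<ge> 1" "\<And>j. j \<ge> 1 \<Longrightarrow> L1 # replicate j L3 @ [L1] \<in> L \<longleftrightarrow> j = n \<or> j = Suc n"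
      by (rule power_exponents[OF L tree, of L1 L3 L1]) (auto simp: P Zeta)
    have "L1 # v @ [L1] \<in> L \<longleftrightarrow> v \<in> range (tail (Zeta n))" if v: "L1 \<notin> set v" for v
    proof
      assume a: "L1 # v @ [L1] \<in> L"
      have "v \<noteq> []" using a pair[of "[]" L1 L1 "[]"] by (auto simp: Zeta)
      then obtain x v1 where Cons: "v = x # v1" by (cases v) auto
      show "v \<in> range (tail (Zeta n))"
      proof (cases "x = L2")
        case True
        have "v1 = []"
        proof (cases v1)
          case (Cons y v2)
          then show ?thesis using a v True \<open>v = x # v1\<close> pair[of "[L1]" x y "v2 @ [L1]"] by (auto simp: Zeta)
        qed
        then show ?thesis using True Cons by (simp add: range_letter)
      next
        case False
        then have x: "x = L3" using v Cons by (cases x) auto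
        then obtain j where "v1 = replicate j L3" using run[of "[L1]" v1] a v Cons by (auto simp: Zeta)
        then have v': "v = replicate (Suc j) L3" using Cons x by simp
        then have "Suc j = n \<or> Suc j = Suc n" using n(2)[of "Suc j"] a by simp
        then show ?thesis using v' by (auto simp: range_letter)
      qed
    next
      assume "v \<in> range (tail (Zeta n))"
      then consider "v = [L2]" | j where "v = replicate j L3" "j = n \<or> j = Suc n"
        unfolding range_letter tail.simps mk3_simps by blast
      then show "L1 # v @ [L1] \<in> L"
      proof cases
        case 1
        then show ?thesis using succ[of "[L1]" L2 L1] inL[of L1 L2] by (simp add: Zeta)
      next
        case 2
        then show ?thesis using n by auto
      qed
    qed
    then show ?thesis using n(1) Zeta by (intro exI[of _ "Zeta n"]) auto
  qed (use fixed in auto)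
qed

text \<open>Only the family of \<open>k\<close> matters; the exponent in \<open>k'\<close> is the
  one found in the return words.\<close>

lemma desubstitution:
  assumes L: "urlang L" and good: "\<And>w. good l r (ext L w)"
    and P: "\<And>a b. ext L [] a b \<longleftrightarrow> (a, b) \<in> pattern k"
    and centers: "\<exists>l' r'. centers k l r l' r'"
  shows "\<exists>k' K l' r'. valid k' \<and> same_family k k' \<and> L = image_lang (mor k') K \<and> urlang K \<and>
     centers k' l r l' r' \<and> (\<forall>w. good l' r' (ext K w))"
proof -
  have tree: "tree3 (ext L w)" for w using good unfolding good_def by blast
  obtain k' where k': "valid k'" "same_family k k'"
     "\<And>v. L1 \<notin> set v \<Longrightarrow> L1 # v @ [L1] \<in> L \<longleftrightarrow> v \<in> range (tail k')"
    using pattern_return_words[OF L tree P] by blast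
  interpret return_morphism L1 "tail k'" by (rule return_morphism_tail)
  have mor: "mor k' = f" by (simp add: mor_def fun_eq_iff)
  define K where "K = {u. wmap f u @ [L1] \<in> L}"
  have K: "urlang K" "L = image_lang (mor k') K"
    using desubstitute[OF L k'(3)] unfolding K_def mor by blast+
  have "\<exists>l' r'. centers k' l r l' r'" using centers k'(2) by (cases k) auto
  then obtain l0 r0 where "centers k' l r l0 r0" by blast
  then have "\<exists>l' r'. centers k' l r l' r' \<and> (\<forall>u. good l' r' (ext K u))"
    by (rule good_preimage[OF k'(1) _ K(1)]) (use good K(2) in simp)
  then show ?thesis using k' K by blast
qed

section \<open>The labels of the graph\<close>

fun relabelling :: "letter \<times> letter \<times> letter \<Rightarrow> letter \<Rightarrow> letter" where
  "relabelling (a, b, c) L1 = a"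
| "relabelling (a, b, c) L2 = b"
| "relabelling (a, b, c) L3 = c"

fun perm :: "letter \<times> letter \<times> letter \<Rightarrow> letter \<Rightarrow> letter list" where
  "perm (a, b, c) = perm3 a b c"

fun distinct3 :: "letter \<times> letter \<times> letter \<Rightarrow> bool" where
  "distinct3 (a, b, c) \<longleftrightarrow> a \<noteq> b \<and> b \<noteq> c \<and> a \<noteq> c"

fun lcenter :: "vtx \<Rightarrow> letter" where
  "lcenter V32 = L3" | "lcenter V33 = L3"

fun rcenter :: "vtx \<Rightarrow> letter" where
  "rcenter V32 = L2" | "rcenter V33 = L3"

text \<open>The edges as data, with permutations as triples, so that claims about all edges reduce
  to finite case distinctions.\<close>

fun labels :: "vtx \<Rightarrow> vtx \<Rightarrow> ((letter \<times> letter \<times> letter) \<times> kind \<times> (letter \<times> letter \<times> letter)) set" where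
  "labels V32 V32 =
    {((L1, L2, L3), Alpha, (L1, L2, L3)),
      ((L2, L1, L3), Alpha, (L2, L1, L3)),
      ((L3, L2, L1), Alpha, (L3, L2, L1)),
      ((L3, L2, L1), Beta, (L1, L2, L3)),
      ((L3, L1, L2), Beta, (L1, L3, L2)),
      ((L2, L1, L3), Gamma, (L1, L2, L3)),
      ((L2, L3, L1), Gamma, (L1, L3, L2)),
      ((L1, L3, L2), Eta, (L1, L2, L3)),
      ((L1, L3, L2), Eta, (L2, L3, L1)),
      ((L1, L3, L2), Eta, (L3, L2, L1))} \<union>
    (\<Union>n\<in>{1..}. {((L2, L1, L3), Delta n, (L1, L2, L3)),
      ((L2, L1, L3), Delta n, (L1, L3, L2))})"
| "labels V33 V33 =
    {((L1, L2, L3), Alpha, (L1, L2, L3)),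
      ((L2, L1, L3), Alpha, (L2, L1, L3)),
      ((L3, L2, L1), Alpha, (L3, L2, L1))} \<union>
    (\<Union>n\<in>{1..}. {((L1, L2, L3), Zeta n, (L2, L1, L3)),
      ((L2, L1, L3), Zeta n, (L2, L1, L3)),
      ((L1, L2, L3), Zeta n, (L2, L3, L1)),
      ((L2, L1, L3), Zeta n, (L2, L3, L1))})"
| "labels V32 V33 =
    {((L3, L1, L2), Beta, (L2, L1, L3)),
      ((L3, L2, L1), Beta, (L3, L1, L2)),
      ((L2, L1, L3), Gamma, (L1, L2, L3)),
      ((L2, L3, L1), Gamma, (L1, L3, L2)),
      ((L1, L3, L2), Eta, (L1, L2, L3))} \<union>
    (\<Union>n\<in>{1..}. {((L2, L1, L3), Delta n, (L1, L2, L3)),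
      ((L2, L1, L3), Delta n, (L1, L3, L2))})"
| "labels V33 V32 =
    {((L3, L1, L2), Beta, (L2, L1, L3)),
      ((L3, L2, L1), Beta, (L2, L1, L3)),
      ((L3, L1, L2), Beta, (L3, L1, L2)),
      ((L3, L2, L1), Beta, (L3, L1, L2)),
      ((L3, L1, L2), Gamma, (L2, L3, L1)),
      ((L3, L2, L1), Gamma, (L2, L3, L1)),
      ((L3, L1, L2), Gamma, (L3, L2, L1)),
      ((L3, L2, L1), Gamma, (L3, L2, L1))} \<union>
    (\<Union>n\<in>{1..}. {((L1, L2, L3), Zeta n, (L2, L1, L3)),
      ((L2, L1, L3), Zeta n, (L2, L1, L3)),
      ((L1, L2, L3), Zeta n, (L2, L3, L1)),
      ((L2, L1, L3), Zeta n, (L2, L3, L1))})"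

text \<open>The exponent 1 stands for all exponents, as in \<open>same_family\<close>.\<close>

fun start :: "vtx \<Rightarrow> ((letter \<times> letter \<times> letter) \<times> kind) set" where
  "start V32 = {((L1, L2, L3), Alpha), ((L2, L1, L3), Alpha), ((L3, L2, L1), Alpha), ((L3, L2, L1), Beta), ((L3, L1, L2), Beta), ((L2, L1, L3), Gamma), ((L2, L3, L1), Gamma), ((L2, L1, L3), Delta 1), ((L1, L3, L2), Eta)}"
| "start V33 = {((L1, L2, L3), Alpha), ((L2, L1, L3), Alpha), ((L3, L2, L1), Alpha), ((L1, L2, L3), Zeta 1), ((L2, L1, L3), Zeta 1), ((L3, L1, L2), Beta), ((L3, L2, L1), Beta), ((L3, L1, L2), Gamma), ((L3, L2, L1), Gamma)}"

lemma perm_apply: "perm p x = [relabelling p x]"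
  by (cases p; cases x) (simp_all add: perm3_def)

lemma bij_relabelling: "distinct3 p \<Longrightarrow> bij (relabelling p)"
proof -
  assume p: "distinct3 p"
  have "inj (relabelling p)"
  proof (rule injI)
    show "x = y" if "relabelling p x = relabelling p y" for x y
      using p that by (cases p; cases x; cases y) auto
  qed
  moreover have "finite (UNIV :: letter set)"
    by (simp add: UNIV_letter)
  ultimately show ?thesis by (simp add: finite_UNIV_inj_surj bij_def)
qed

lemma mor_eqs: "mor_alpha = mor Alpha" "mor_beta = mor Beta" "mor_gamma = mor Gamma"
  "mor_delta n = mor (Delta n)" "mor_zeta n = mor (Zeta n)" "mor_eta = mor Eta"
  by (intro HOL.ext; case_tac x; simp add: mor_def mor_alpha_def mor_beta_def mor_gamma_def
      mor_delta_def mor_zeta_def mor_eta_def)+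

lemma perm3_id: "p123 \<odot> g = g" "g \<odot> p123 = g"
proof -
  have "wmap p123 w = w" for w
    by (induction w) (simp_all add: perm3_def mk3_def split: letter.splits)
  then show "p123 \<odot> g = g" by (simp add: mcomp_def)
  show "g \<odot> p123 = g"
  proof
    show "(g \<odot> p123) x = g x" for x by (cases x) (simp_all add: mcomp_def perm3_def)
  qed
qed

lemma Gedge_labels:
  "Gedge v s v' \<longleftrightarrow> (\<exists>(p, k, q)\<in>labels v v'. s = perm p \<odot> mor k \<odot> perm q)"
  by (cases v; cases v'; simp add: Gedge_def mor_eqs perm3_id bex_Un; blast?)

lemma labels_sound:
  assumes "(p, k, q) \<in> labels v v'"
  shows "valid k \<and> distinct3 p \<and> distinct3 q \<and>
    (\<exists>l r. relabelling p l = lcenter v \<and> relabelling p r = rcenter v \<and>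
       centers k l r (relabelling q (lcenter v')) (relabelling q (rcenter v')))"
  using assms by (cases v; cases v'; simp; elim disjE conjE bexE; simp add: letter_ex)

lemma start_centers:
  assumes "(p, k) \<in> start v"
  shows "\<exists>l r l' r'. distinct3 p \<and> relabelling p l = lcenter v \<and> relabelling p r = rcenter v \<and> centers k l r l' r'"
  using assms by (cases v; simp; elim disjE conjE; simp add: letter_ex)

text \<open>The vertex \<open>v'\<close> is [3,3] if \<open>l'\<close> and \<open>r'\<close>
  coincide and [3,2] otherwise, and \<open>q\<close> carries its standard common letters to them.
  All twelve choices of permutation and vertex are tried.\<close>

lemma labels_complete:
  assumes "(p, k) \<in> start v" "same_family k k'" "valid k'"
    "relabelling p l = lcenter v" "relabelling p r = rcenter v" "centers k' l r l' r'"
  shows "\<exists>q v'. (p, k', q) \<in> labels v v' \<and> relabelling q (lcenter v') = l' \<and> relabelling q (rcenter v') = r'"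
  using assms
  apply (cases v; cases k'; cases l; cases r; simp del: split_paired_Ex; elim disjE conjE; simp del: split_paired_Ex; (elim disjE conjE)?; (elim disjE)?; hypsubst?)
  by ((intro exI[of _ "(L1, L2, L3)"] exI[of _ V32]; simp; fail) |
      (intro exI[of _ "(L1, L3, L2)"] exI[of _ V32]; simp; fail) |
      (intro exI[of _ "(L2, L1, L3)"] exI[of _ V32]; simp; fail) |
      (intro exI[of _ "(L2, L3, L1)"] exI[of _ V32]; simp; fail) |
      (intro exI[of _ "(L3, L1, L2)"] exI[of _ V32]; simp; fail) |
      (intro exI[of _ "(L3, L2, L1)"] exI[of _ V32]; simp; fail) |
      (intro exI[of _ "(L1, L2, L3)"] exI[of _ V33]; simp; fail) |
      (intro exI[of _ "(L1, L3, L2)"] exI[of _ V33]; simp; fail) |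
      (intro exI[of _ "(L2, L1, L3)"] exI[of _ V33]; simp; fail) |
      (intro exI[of _ "(L2, L3, L1)"] exI[of _ V33]; simp; fail) |
      (intro exI[of _ "(L3, L1, L2)"] exI[of _ V33]; simp; fail) |
      (intro exI[of _ "(L3, L2, L1)"] exI[of _ V33]; simp; fail))+

text \<open>The last hypothesis says that the graph of letter successors is strongly connected.
  Among the trees with the prescribed common letters this leaves only relabelled patterns, a finite
  check in nine propositions.\<close>

lemma start_exists:
  assumes "good (lcenter v) (rcenter v) M" and "\<And>a. row M a" "\<And>a. row M\<inverse>\<inverse> a"
    and "\<And>A. A \<noteq> {} \<Longrightarrow> A \<noteq> UNIV \<Longrightarrow> \<exists>a\<in>A. \<exists>b. b \<notin> A \<and> M a b"
  shows "\<exists>(p, k)\<in>start v. \<forall>a b. M (relabelling p a) (relabelling p b) \<longleftrightarrow> (a, b) \<in> pattern k"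
proof -
  have ex: "M L1 L2 \<or> M L1 L3" "M L2 L1 \<or> M L2 L3" "M L3 L1 \<or> M L3 L2"
     "M L1 L3 \<or> M L2 L3" "M L1 L2 \<or> M L3 L2" "M L2 L1 \<or> M L3 L1"
    using assms(4)[of "{L1}"] assms(4)[of "{L2}"] assms(4)[of "{L3}"]
       assms(4)[of "{L1, L2}"] assms(4)[of "{L1, L3}"] assms(4)[of "{L2, L3}"]
       UNIV_letter by (auto simp: letter_ex)
  have rows: "row M L1" "row M L2" "row M L3" "row M\<inverse>\<inverse> L1" "row M\<inverse>\<inverse> L2" "row M\<inverse>\<inverse> L3"
    using assms(2,3) by blast+
  show ?thesis
  proof (cases v)
    case V32
    then show ?thesis using assms(1) ex rows
      apply (simp add: bool_simps letter_all)
      by (smt (verit))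
  next
    case V33
    then show ?thesis using assms(1) ex rows
      apply (simp add: bool_simps letter_all)
      by (smt (verit))
  qed
qed

section \<open>One step along the graph\<close>

definition relabel :: "('a \<Rightarrow> 'b) \<Rightarrow> 'b list set \<Rightarrow> 'a list set" where
  "relabel h L = {w. map h w \<in> L}"

lemma sublist_map: "sublist u v \<Longrightarrow> sublist (map h u) (map h v)"
  unfolding sublist_def by (metis map_append)

lemma sublist_map_inj: "inj h \<Longrightarrow> sublist (map h u) (map h v) \<Longrightarrow> sublist u v"
  using sublist_map[of "map h u" "map h v" "inv h"] by (simp add: o_def)

lemma urlang_relabel:
  assumes h: "bij h" and L: "urlang L"
  shows "urlang (relabel h L)"
  unfolding urlang_def
proof (intro conjI allI impI ballI)
  show "u \<in> relabel h L" if "v \<in> relabel h L \<and> sublist u v" for u v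
    using that urlang_sublist[OF L] sublist_map unfolding relabel_def by blast
  show "[a] \<in> relabel h L" for a using urlang_letter[OF L] by (simp add: relabel_def)
  show "\<exists>a b. a # w @ [b] \<in> relabel h L" if w: "w \<in> relabel h L" for w
  proof -
    obtain a b where "a # map h w @ [b] \<in> L" using urlang_extend[OF L] w unfolding relabel_def by blast
    then have "inv h a # w @ [inv h b] \<in> relabel h L"
      using h by (simp add: relabel_def bij_is_surj surj_f_inv_f)
    then show ?thesis by blast
  qed
  show "\<exists>N. \<forall>u\<in>relabel h L. N \<le> length u \<longrightarrow> sublist w u" if w: "w \<in> relabel h L" for w
  proof -
    obtain N where "\<And>u. \<lbrakk>u \<in> L; N \<le> length u\<rbrakk> \<Longrightarrow> sublist (map h w) u"
      using urlang_recurrent[OF L] w unfolding relabel_def by blast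
    then have "\<forall>u\<in>relabel h L. N \<le> length u \<longrightarrow> sublist w u"
      using sublist_map_inj[of h] h unfolding relabel_def by (simp add: bij_is_inj)
    then show ?thesis by blast
  qed
qed

lemma wmap_letters: "wmap (\<lambda>x. [h x]) w = map h w"
  by (induction w) auto

lemma image_lang_letters:
  assumes h: "bij h" and L: "\<And>u v. v \<in> L \<Longrightarrow> sublist u v \<Longrightarrow> u \<in> L"
  shows "image_lang (\<lambda>x. [h x]) L = relabel (inv h) L"
proof -
  have "w \<in> image_lang (\<lambda>x. [h x]) L \<longleftrightarrow> map (inv h) w \<in> L" for w
  proof
    assume "w \<in> image_lang (\<lambda>x. [h x]) L"
    then obtain v where "v \<in> L" "sublist w (map h v)" by (auto simp: image_lang_def wmap_letters)
    then have "sublist (map (inv h) w) v"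
      using sublist_map[of w "map h v" "inv h"] h by (simp add: bij_is_inj)
    then show "map (inv h) w \<in> L" using \<open>v \<in> L\<close> L by blast
  next
    assume "map (inv h) w \<in> L"
    moreover have "map h (map (inv h) w) = w" using h by (simp add: o_def bij_is_surj surj_f_inv_f)
    ultimately show "w \<in> image_lang (\<lambda>x. [h x]) L"
      unfolding image_lang_def wmap_letters by (metis (mono_tags, lifting) mem_Collect_eq sublist_order.order_refl)
  qed
  then show ?thesis unfolding relabel_def by blast
qed

lemma wmap_mcomp: "wmap (f \<odot> g) w = wmap f (wmap g w)"
  by (induction w) (simp_all add: mcomp_def)

lemma image_lang_mcomp: "image_lang (f \<odot> g) K = image_lang f (image_lang g K)"
proof -
  have "w \<in> image_lang (f \<odot> g) K \<longleftrightarrow> w \<in> image_lang f (image_lang g K)" for w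
    unfolding image_lang_def wmap_mcomp
    using sublist_wmap sublist_order.order_trans by (blast intro: sublist_order.order_refl)
  then show ?thesis by blast
qed

lemma share_relabel: "surj h \<Longrightarrow> share (\<lambda>a b. M (h a) (h b)) a b \<longleftrightarrow> share M (h a) (h b)"
  unfolding share_def by (metis surj_f_inv_f)

lemma row_relabel: "surj h \<Longrightarrow> row (\<lambda>a b. M (h a) (h b)) a \<longleftrightarrow> row M (h a)"
  unfolding row_def by (metis surj_f_inv_f)

lemma good_relabel:
  assumes h: "bij h" and good: "good (h l) (h r) M"
  shows "good l r (\<lambda>a b. M (h a) (h b))"
proof -
  let ?M = "\<lambda>a b. M (h a) (h b)"
  have inj: "h a = h b \<longleftrightarrow> a = b" for a b using h by (metis bij_inv_eq_iff)
  have surj: "surj h" using h by (rule bij_is_surj)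
  note rel = share_relabel[OF surj] row_relabel[OF surj]
  have conv: "?M\<inverse>\<inverse> = (\<lambda>a b. M\<inverse>\<inverse> (h a) (h b))" by (intro HOL.ext) simp
  have "pers ?M l b" "pers ?M\<inverse>\<inverse> r b" for b
    using good unfolding conv unfolding good_def pers_def rel by blast+
  moreover have "acyclic3 ?M"
  proof -
    have ac: "acyclic3 M" using good unfolding good_def tree3_def by blast
    show ?thesis unfolding acyclic3_def
    proof (intro conjI allI impI)
      fix a b x y assume "?M a x \<and> ?M b x \<and> ?M a y \<and> ?M b y"
      then have "h a = h b \<or> h x = h y" using ac unfolding acyclic3_def by blast
      then show "a = b \<or> x = y" by (simp add: inj)
    next
      fix a b c x y z' assume "?M a x \<and> ?M b x \<and> ?M b y \<and> ?M c y \<and> ?M c z' \<and> ?M a z'"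
      then have "h a = h b \<or> h b = h c \<or> h a = h c \<or> h x = h y \<or> h y = h z' \<or> h x = h z'"
        using ac[unfolded acyclic3_def, THEN conjunct2, rule_format, of "h a" "h x" "h b" "h y" "h c" "h z'"] by blast
      then show "a = b \<or> b = c \<or> a = c \<or> x = y \<or> y = z' \<or> x = z'" by (simp add: inj)
    qed
  qed
  moreover have "connected3 ?M"
  proof -
    have "connected3 M" using good unfolding good_def tree3_def by blast
    then show ?thesis unfolding connected3_def rel by (metis surj surj_f_inv_f)
  qed
  ultimately show ?thesis unfolding good_def tree3_def by blast
qed

lemma ext_relabel: "ext (relabel h L) w = (\<lambda>a b. ext L (map h w) (h a) (h b))"
  by (intro HOL.ext) (simp add: ext_def relabel_def)

lemma good_ext_relabel:
  assumes "bij h" "good (h l) (h r) (ext L (map h w))"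
  shows "good l r (ext (relabel h L) w)"
  unfolding ext_relabel by (rule good_relabel) fact+

text \<open>Relabellings preserve lengths, so the bound on \<open>u\<close> passes unchanged through
  the permutations around \<open>mor k\<close>.\<close>

lemma good_image_label:
  assumes edge: "Gedge v s v'" and K: "urlang K"
    and good: "\<And>u. length u < length w \<Longrightarrow> good (lcenter v') (rcenter v') (ext K u)"
  shows "good (lcenter v) (rcenter v) (ext (image_lang s K) w)"
proof -
  obtain p k q where pkq: "(p, k, q) \<in> labels v v'" and s: "s = perm p \<odot> mor k \<odot> perm q"
    using edge unfolding Gedge_labels by blast
  obtain l r where lr: "relabelling p l = lcenter v" "relabelling p r = rcenter v"
    "centers k l r (relabelling q (lcenter v')) (relabelling q (rcenter v'))"
    and "valid k" and pq: "bij (relabelling p)" "bij (relabelling q)"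
    using labels_sound[OF pkq] bij_relabelling by blast
  have perm: "perm p = (\<lambda>x. [relabelling p x])" for p by (intro HOL.ext) (rule perm_apply)
  have inv_inv: "inv h (h x) = x" if "bij h" for h :: "letter \<Rightarrow> letter" and x
    using that by (simp add: bij_is_inj)
  define K0 where "K0 = relabel (inv (relabelling q)) K"
  have K0: "urlang K0" unfolding K0_def by (rule urlang_relabel[OF bij_imp_bij_inv[OF pq(2)] K])
  have qK: "image_lang (perm q) K = K0"
    unfolding K0_def perm by (rule image_lang_letters[OF pq(2) urlang_sublist[OF K]])
  have "good (relabelling q (lcenter v')) (relabelling q (rcenter v')) (ext K0 u)" if "length u < length w" for u
    unfolding K0_def by (rule good_ext_relabel) (use pq good that in \<open>simp_all add: bij_imp_bij_inv inv_inv\<close>)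
  then have g: "good l r (ext (image_lang (mor k) K0) u)" if "length u \<le> length w" for u
    by (intro good_image[OF \<open>valid k\<close> lr(3) K0]) (use that in simp)
  have L: "image_lang s K = image_lang (perm p) (image_lang (mor k) K0)"
    by (simp add: s image_lang_mcomp qK)
  have closed: "u \<in> image_lang (mor k) K0" if "v \<in> image_lang (mor k) K0" "sublist u v" for u v
    using that sublist_order.order_trans unfolding image_lang_def by blast
  have "image_lang s K = relabel (inv (relabelling p)) (image_lang (mor k) K0)"
    unfolding L perm by (rule image_lang_letters[OF pq(1) closed])
  then show ?thesis
    apply (simp only:)
    by (rule good_ext_relabel) (use pq g in \<open>simp_all add: bij_imp_bij_inv inv_inv flip: lr(1,2)\<close>)
qed

lemma urlang_crossing:
  assumes L: "urlang L" and "A \<noteq> {}" "A \<noteq> UNIV"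
  shows "\<exists>a\<in>A. \<exists>b. b \<notin> A \<and> ext L [] a b"
proof -
  have cross: "a \<in> A \<Longrightarrow> c \<notin> A \<Longrightarrow> a # y @ [c] \<in> L \<Longrightarrow> ?thesis" for a c y
  proof (induction y arbitrary: a)
    case Nil
    then show ?case by (auto simp: ext_def)
  next
    case (Cons b y)
    have "ext L [] a b" using urlang_pair[OF L, of "[]" a b "y @ [c]"] Cons.prems(3) by simp
    moreover have "b # y @ [c] \<in> L" using urlang_ConsD[OF L Cons.prems(3)] by simp
    ultimately show ?case using Cons.IH[of b] Cons.prems by blast
  qed
  obtain a c where ac: "a \<in> A" "c \<notin> A" using assms by blast
  obtain y where "[a] @ y @ [c] \<in> L" using urlang_next[OF L urlang_letter[OF L]] by metis
  then show ?thesis using cross[OF ac] by simp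
qed

lemma Sigma3_perm: "distinct3 p \<Longrightarrow> perm p \<in> Sigma3"
proof -
  assume "distinct3 p"
  moreover obtain a b c where p: "p = (a, b, c)" by (cases p)
  ultimately show ?thesis by (cases a; cases b; cases c) (auto simp: Sigma3_def)
qed

lemma S3_mor: "valid k \<Longrightarrow> mor k \<in> S3"
  by (cases k) (auto simp: S3_def mor_eqs)

text \<open>The permutation \<open>p\<close> brings the graph of the empty word into the form of a
  \<open>pattern\<close>; after desubstitution, \<open>q\<close> moves the new common letters to
  their standard position.\<close>

lemma desubstitution_label:
  assumes L: "urlang L" and good: "\<And>w. good (lcenter v) (rcenter v) (ext L w)"
  shows "\<exists>s v' K. Gedge v s v' \<and> s \<in> SigmaS3Sigma \<and> L = image_lang s K \<and> urlang K \<and>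
    (\<forall>w. good (lcenter v') (rcenter v') (ext K w))"
proof -
  have "\<exists>(p, k)\<in>start v. \<forall>a b. ext L [] (relabelling p a) (relabelling p b) \<longleftrightarrow> (a, b) \<in> pattern k"
    by (rule start_exists[OF good])
      (use urlang_crossing[OF L] urlang_letter[OF L] in \<open>auto simp: row_ext[OF L] row_ext_conv[OF L]\<close>)
  then obtain p k where start: "(p, k) \<in> start v"
    and pat: "\<And>a b. ext L [] (relabelling p a) (relabelling p b) \<longleftrightarrow> (a, b) \<in> pattern k" by blast
  obtain l r where p: "distinct3 p" and lr: "relabelling p l = lcenter v" "relabelling p r = rcenter v"
    "\<exists>l' r'. centers k l r l' r'" using start_centers[OF start] by blast
  have h: "bij (relabelling p)" by (rule bij_relabelling[OF p])
  have perm: "perm p = (\<lambda>x. [relabelling p x])" for p by (intro HOL.ext) (rule perm_apply)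
  define L0 where "L0 = relabel (relabelling p) L"
  have L0: "urlang L0" unfolding L0_def by (rule urlang_relabel[OF h L])
  have "good l r (ext L0 w)" for w
    unfolding L0_def by (rule good_ext_relabel[OF h]) (use good lr in simp)
  moreover have "ext L0 [] a b \<longleftrightarrow> (a, b) \<in> pattern k" for a b
    unfolding L0_def ext_relabel using pat by simp
  ultimately obtain k' K l' r' where k': "valid k'" "same_family k k'" "L0 = image_lang (mor k') K" "urlang K"
     "centers k' l r l' r'" "\<And>w. good l' r' (ext K w)"
    using desubstitution[OF L0 _ _ lr(3)] by blast
  obtain q v' where q: "(p, k', q) \<in> labels v v'" "relabelling q (lcenter v') = l'" "relabelling q (rcenter v') = r'"
    using labels_complete[OF start k'(2,1) lr(1,2) k'(5)] by blast
  have dq: "distinct3 q" using labels_sound[OF q(1)] by blast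
  then have hq: "bij (relabelling q)" by (rule bij_relabelling)
  define K' where "K' = relabel (relabelling q) K"
  have K': "urlang K'" unfolding K'_def by (rule urlang_relabel[OF hq k'(4)])
  have undo: "image_lang (perm p) (relabel (relabelling p) L) = L" if "distinct3 p" "urlang L" for p and L
  proof -
    have h: "bij (relabelling p)" by (rule bij_relabelling[OF that(1)])
    have "image_lang (perm p) (relabel (relabelling p) L) = relabel (inv (relabelling p)) (relabel (relabelling p) L)"
      unfolding perm by (rule image_lang_letters[OF h urlang_sublist[OF urlang_relabel[OF h that(2)]]])
    then show ?thesis
      by (simp add: relabel_def o_def bij_is_surj[OF h] surj_f_inv_f)
  qed
  have "L = image_lang (perm p \<odot> mor k' \<odot> perm q) K'"
    using undo[OF p L] undo[OF dq k'(4)] k'(3) by (simp add: image_lang_mcomp L0_def K'_def)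
  moreover have "good (lcenter v') (rcenter v') (ext K' w)" for w
    unfolding K'_def by (rule good_ext_relabel[OF hq]) (use q k' in simp)
  moreover have "Gedge v (perm p \<odot> mor k' \<odot> perm q) v'" unfolding Gedge_labels using q(1) by blast
  moreover have "perm p \<odot> mor k' \<odot> perm q \<in> SigmaS3Sigma"
    unfolding SigmaS3Sigma_def using Sigma3_perm[OF p] Sigma3_perm[OF dq] S3_mor[OF k'(1)] by blast
  ultimately show ?thesis using K' by blast
qed

lemma Gedge_first_letter:
  assumes "Gedge v s v'"
  obtains c where "\<And>a. \<exists>x. s a = c # x"
proof -
  obtain p k q where "s = perm p \<odot> mor k \<odot> perm q" using assms unfolding Gedge_labels by blast
  then have "s a = relabelling p L1 # wmap (perm p) (tail k (relabelling q a))" for a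
    by (simp add: mcomp_def perm_apply mor_def)
  then show ?thesis using that by blast
qed

section \<open>Shift spaces and their languages\<close>

lemma length_factor [simp]: "length (factor x i n) = n"
  by (simp add: factor_def)

lemma nth_factor [simp]: "k < n \<Longrightarrow> factor x i n ! k = x (i + int k)"
  by (simp add: factor_def)

lemma factor_eq_iff: "w = factor x i (length w) \<longleftrightarrow> (\<forall>k<length w. w ! k = x (i + int k))"
  by (auto simp: list_eq_iff_nth_eq)

lemma sublist_factor:
  assumes "sublist w (factor x i n)"
  obtains j where "j \<ge> 0" "j + int (length w) \<le> int n" "w = factor x (i + j) (length w)"
proof -
  obtain p q where pq: "factor x i n = p @ w @ q" using assms by (auto simp: sublist_def)
  then have n: "n = length p + length w + length q" by (metis length_append length_factor add.assoc)
  have "w ! k = x (i + int (length p) + int k)" if "k < length w" for k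
  proof -
    have "w ! k = (p @ w @ q) ! (length p + k)" using that by (simp add: nth_append)
    also have "\<dots> = x (i + int (length p + k))" unfolding pq[symmetric] using n that by simp
    finally show ?thesis by (simp add: add.assoc)
  qed
  then have "w = factor x (i + int (length p)) (length w)" by (simp add: factor_eq_iff)
  then show ?thesis using that[of "int (length p)"] n by simp
qed

lemma factor_sublist:
  assumes "j \<ge> 0" "j + int m \<le> int n"
  shows "sublist (factor x (i + j) m) (factor x i n)"
proof -
  have "factor x i n = take (nat j) (factor x i n) @ take m (drop (nat j) (factor x i n)) @ drop m (drop (nat j) (factor x i n))"
    by (metis append_take_drop_id)
  moreover have "take m (drop (nat j) (factor x i n)) = factor x (i + j) m"
    using assms by (intro nth_equalityI) (auto simp: add.assoc)
  ultimately show ?thesis unfolding sublist_def by metis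
qed

lemma factor_in_lang: "x \<in> X \<Longrightarrow> factor x i n \<in> lang X"
  unfolding lang_def by auto

lemma lang_sublist:
  assumes "v \<in> lang X" "sublist u v"
  shows "u \<in> lang X"
proof -
  obtain x i where x: "x \<in> X" "v = factor x i (length v)" using assms(1) unfolding lang_def by blast
  then have "sublist u (factor x i (length v))" using assms(2) by simp
  then obtain j where "u = factor x j (length u)" by (rule sublist_factor)
  then show ?thesis using x(1) unfolding lang_def by blast
qed

lemma lang_extend:
  assumes "w \<in> lang X"
  shows "\<exists>a b. a # w @ [b] \<in> lang X"
proof -
  obtain x i where x: "x \<in> X" "w = factor x i (length w)" using assms unfolding lang_def by blast
  have "factor x (i - 1) (length w + 2) = x (i - 1) # w @ [x (i + int (length w))]"
    using x(2) unfolding factor_eq_iff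
    by (intro nth_equalityI) (auto simp: nth_Cons nth_append less_Suc_eq split: nat.splits)
  then show ?thesis using factor_in_lang[OF x(1)] by metis
qed

lemma shift_translate:
  assumes X: "shift ` X = X" and "y \<in> X"
  shows "(\<lambda>k. y (k + t)) \<in> X"
proof (induction t rule: int_induct[of _ 0])
  case base
  then show ?case using assms(2) by simp
next
  case (step1 i)
  have "shift (\<lambda>k. y (k + i)) \<in> X" using step1 X by blast
  moreover have "shift (\<lambda>k. y (k + i)) = (\<lambda>k. y (k + (i + 1)))"
    by (auto simp: shift_def algebra_simps)
  ultimately show ?case by simp
next
  case (step2 i)
  then obtain z where z: "z \<in> X" "(\<lambda>k. y (k + i)) = shift z" using X by blast
  have "z k = y (k + (i - 1))" for k
    using fun_cong[OF z(2), of "k - 1"] by (simp add: shift_def algebra_simps)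
  then have "z = (\<lambda>k. y (k + (i - 1)))" by blast
  then show ?case using z(1) by simp
qed

text \<open>A basic neighbourhood of \<open>x\<close> constrains finitely many coordinates, hence a
  window around 0, where some translate of a point of \<open>X\<close> agrees with
  \<open>x\<close>.\<close>

lemma closed_shift_mem:
  fixes X :: "(int \<Rightarrow> 'a::discrete_topology) set"
  assumes cl: "closed X" and X: "shift ` X = X" and facs: "\<And>i n. factor x i n \<in> lang X"
  shows "x \<in> X"
proof (rule ccontr)
  assume "x \<notin> X"
  moreover have "openin (product_topology (\<lambda>_. euclidean) UNIV) (- X)"
    using cl by (simp add: euclidean_product_topology open_Compl)
  ultimately obtain V where V: "x \<in> (\<Pi>\<^sub>E i\<in>UNIV. V i)" "finite {i. V i \<noteq> topspace euclidean}"
     "(\<Pi>\<^sub>E i\<in>UNIV. V i) \<subseteq> - X"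
    using product_topology_open_contains_basis[of "\<lambda>_. euclidean" UNIV "- X" x] by auto
  obtain m where m: "\<And>i. V i \<noteq> UNIV \<Longrightarrow> \<bar>i\<bar> \<le> int m"
  proof -
    have "finite (abs ` {i. V i \<noteq> UNIV})" using V(2) by simp
    then obtain B where "\<And>i. V i \<noteq> UNIV \<Longrightarrow> \<bar>i\<bar> \<le> B"
      by (metis (mono_tags, lifting) Max_ge image_eqI mem_Collect_eq)
    then have "V i \<noteq> UNIV \<Longrightarrow> \<bar>i\<bar> \<le> int (nat B)" for i
      using order_trans[of "\<bar>i\<bar>" B "int (nat B)"] by simp
    then show ?thesis by (rule that)
  qed
  obtain y j where y: "y \<in> X" "factor x (- int m) (2 * m + 1) = factor y j (2 * m + 1)"
    using facs[of "- int m" "2 * m + 1"] unfolding lang_def by auto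
  define z where "z = (\<lambda>k. y (k + (j + int m)))"
  have "z \<in> X" unfolding z_def by (rule shift_translate[OF X y(1)])
  moreover have "z i = x i" if "\<bar>i\<bar> \<le> int m" for i
  proof -
    have "nat (i + int m) < 2 * m + 1" using that by linarith
    then have "x (- int m + int (nat (i + int m))) = y (j + int (nat (i + int m)))"
      using y(2) nth_factor by metis
    moreover have "int (nat (i + int m)) = i + int m" using that by linarith
    ultimately show ?thesis by (simp add: z_def algebra_simps)
  qed
  then have "z i \<in> V i" for i
    using V(1) m[of i] by (cases "V i = UNIV") (auto simp: PiE_iff)
  then have "z \<in> (\<Pi>\<^sub>E i\<in>UNIV. V i)" by auto
  ultimately show False using V(3) by blast
qed

lemma open_cylinder:
  fixes w :: "'a::discrete_topology list"
  shows "open {x. factor x i (length w) = w}"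
proof -
  have "{x. factor x i (length w) = w} = (\<Inter>k\<in>{..<length w}. (\<lambda>x. x (i + int k)) -` {w ! k})"
    using factor_eq_iff[of w] by (auto simp: eq_commute)
  moreover have "open ((\<lambda>x :: int \<Rightarrow> 'a. x (i + int k)) -` {w ! k})" for k
    by (intro open_vimage open_discrete continuous_on_product_coordinates)
  ultimately show ?thesis by auto
qed

lemma compact_UNIV_sequences: "compact (UNIV :: (int \<Rightarrow> letter) set)"
proof -
  have "compact_space (euclidean :: letter topology)"
    by (simp add: compact_space_def finite_imp_compact UNIV_letter)
  then have "compact_space (product_topology (\<lambda>_ :: int. euclidean :: letter topology) UNIV)"
    by (simp add: compact_space_product_topology)
  then show ?thesis by (simp add: euclidean_product_topology compact_space_def)
qed

text \<open>The points avoiding \<open>w\<close> form a closed invariant proper subset, which is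
  therefore empty; compactness then confines some occurrence of \<open>w\<close> to a fixed window
  of positions.\<close>

lemma minimal_recurrent:
  fixes X :: "(int \<Rightarrow> letter) set"
  assumes cl: "closed X" and X: "shift ` X = X" and min: "minimal_shift X" and w: "w \<in> lang X"
  shows "\<exists>N. \<forall>u\<in>lang X. N \<le> length u \<longrightarrow> sublist w u"
proof -
  define U where "U i = {x. factor x i (length w) = w}" for i
  have U: "open (U i)" for i unfolding U_def by (rule open_cylinder)
  define Y where "Y = X - (\<Union>i. U i)"
  have "closed Y" unfolding Y_def using cl U by (intro closed_Diff) auto
  moreover have "shift ` Y = Y"
  proof -
    have "factor (shift x) i n = factor x (i + 1) n" for x :: "int \<Rightarrow> letter" and i n
      by (simp add: factor_def shift_def add.commute add.left_commute)
    then have U': "shift x \<in> U i \<longleftrightarrow> x \<in> U (i + 1)" for x i by (simp add: U_def)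
    have "shift x \<in> (\<Union>i. U i) \<longleftrightarrow> x \<in> (\<Union>i. U i)" for x
      unfolding UN_iff U' by (metis UNIV_I diff_add_cancel)
    then have "shift ` (X - (\<Union>i. U i)) = shift ` X - (\<Union>i. U i)" by (auto simp del: UN_iff)
    then show ?thesis using X unfolding Y_def by simp
  qed
  moreover have "Y \<noteq> X"
  proof -
    obtain x i where "x \<in> X" "w = factor x i (length w)" using w unfolding lang_def by blast
    then have "x \<in> X" "x \<in> U i" unfolding U_def by simp_all
    then show ?thesis unfolding Y_def by blast
  qed
  moreover have "Y \<subseteq> X" unfolding Y_def by blast
  ultimately have "Y = {}" using min unfolding minimal_shift_def by meson
  then have "X \<subseteq> (\<Union>i\<in>UNIV. U i)" unfolding Y_def by blast
  moreover have "compact X" using compact_Int_closed[OF compact_UNIV_sequences cl] by simp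
  ultimately obtain D where D: "finite D" "X \<subseteq> (\<Union>i\<in>D. U i)"
    using U by (metis compactE_image)
  obtain m where m: "\<And>i. i \<in> D \<Longrightarrow> \<bar>i\<bar> \<le> int m"
  proof -
    have "\<And>i. i \<in> D \<Longrightarrow> \<bar>i\<bar> \<le> Max (abs ` D)" using D(1) by simp
    then have "\<bar>i\<bar> \<le> int (nat (Max (abs ` D)))" if "i \<in> D" for i
      using order_trans[of "\<bar>i\<bar>" "Max (abs ` D)" "int (nat (Max (abs ` D)))"] that by simp
    then show ?thesis by (rule that)
  qed
  have "sublist w u" if u: "u \<in> lang X" "2 * m + length w \<le> length u" for u
  proof -
    obtain x j where x: "x \<in> X" "u = factor x j (length u)" using u(1) unfolding lang_def by blast
    \<comment> \<open>The translation puts the first letter of \<open>u\<close> at position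
      \<open>- int m\<close>, so that the window given by \<open>D\<close> lies inside
      \<open>u\<close>.\<close>
    define z where "z = (\<lambda>k. x (k + (j + int m)))"
    have "z \<in> X" unfolding z_def by (rule shift_translate[OF X x(1)])
    then obtain i where i: "i \<in> D" "factor z i (length w) = w" using D(2) unfolding U_def by blast
    have "u = factor z (- int m) (length u)"
      using x(2) unfolding factor_eq_iff z_def by (simp add: algebra_simps)
    moreover have "sublist (factor z (- int m + (i + int m)) (length w)) (factor z (- int m) (length u))"
      by (rule factor_sublist) (use m[OF i(1)] u(2) in linarith)+
    ultimately show ?thesis using i(2) by simp
  qed
  then show ?thesis by blast
qed

lemma urlang_lang:
  fixes X :: "(int \<Rightarrow> letter) set"
  assumes "shift_space X" "minimal_shift X"
  shows "urlang (lang X)"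
  unfolding urlang_def
proof (intro conjI allI impI ballI)
  show "[a] \<in> lang X" for a
  proof -
    obtain x i where "x \<in> X" "x i = a" using assms(1) unfolding shift_space_def by blast
    then have "[a] = factor x i 1" by (simp add: factor_def)
    then show ?thesis using factor_in_lang[OF \<open>x \<in> X\<close>] by metis
  qed
qed (use assms lang_sublist lang_extend minimal_recurrent in \<open>auto simp: shift_space_def\<close>)

lemma recurrent_minimal:
  fixes X :: "(int \<Rightarrow> 'a::discrete_topology) set"
  assumes "urlang (lang X)"
  shows "minimal_shift X"
  unfolding minimal_shift_def
proof (intro allI impI)
  fix Y assume Y: "Y \<subseteq> X \<and> closed Y \<and> shift ` Y = Y"
  show "Y = {} \<or> Y = X"
  proof (cases "Y = {}")
    case False
    then obtain y where y: "y \<in> Y" by blast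
    have "x \<in> Y" if x: "x \<in> X" for x
    proof (rule closed_shift_mem)
      show "factor x i n \<in> lang Y" for i n
      proof -
        obtain N where "\<And>u. u \<in> lang X \<Longrightarrow> N \<le> length u \<Longrightarrow> sublist (factor x i n) u"
          using urlang_recurrent[OF assms factor_in_lang[OF x]] by blast
        then have "sublist (factor x i n) (factor y 0 N)" using y Y factor_in_lang by (metis length_factor order_refl subsetD)
        then show ?thesis using lang_sublist factor_in_lang[OF y] by blast
      qed
    qed (use Y in auto)
    then show ?thesis using Y by blast
  qed simp
qed

text \<open>A single point suffices: its long factors contain every word of the uniformly recurrent
  \<open>dlang d 1\<close>.\<close>

lemma gen_shift_lang:
  assumes "urlang (dlang d 1)" "gen_shift d \<noteq> {}"
  shows "lang (gen_shift d) = dlang d 1"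
proof (intro equalityI subsetI)
  fix w assume "w \<in> lang (gen_shift d)"
  then obtain x i where "x \<in> gen_shift d" "w = factor x i (length w)" unfolding lang_def by blast
  moreover from this(1) have "factor x i (length w) \<in> dlang d 1" by (simp add: gen_shift_def)
  ultimately show "w \<in> dlang d 1" by metis
next
  fix w assume "w \<in> dlang d 1"
  then obtain N where N: "\<And>u. u \<in> dlang d 1 \<Longrightarrow> N \<le> length u \<Longrightarrow> sublist w u"
    using urlang_recurrent[OF assms(1)] by blast
  obtain x where x: "x \<in> gen_shift d" using assms(2) by blast
  then have "sublist w (factor x 0 N)" using N[of "factor x 0 N"] by (simp add: gen_shift_def)
  then show "w \<in> lang (gen_shift d)" using lang_sublist factor_in_lang[OF x] by blast
qed

lemma gen_shift_eq:
  fixes X :: "(int \<Rightarrow> 'a::discrete_topology) set"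
  assumes "closed X" "shift ` X = X" "dlang d 1 = lang X"
  shows "gen_shift d = X"
  unfolding gen_shift_def assms(3)
  using closed_shift_mem[OF assms(1,2)] factor_in_lang by blast

section \<open>Trees as graphs and in relational form\<close>

lemma share_rtrancl:
  assumes "(a, b) \<in> {(p, q). share M p q}\<^sup>*" and "row M a"
  shows "share M a b \<or> (\<exists>c. share M a c \<and> share M c b)"
  using assms(1)
proof (induction rule: rtrancl_induct)
  case base
  then show ?case using assms(2) by (auto simp: share_def row_def)
next
  case (step c b)
  have aa: "share M a a" using assms(2) by (auto simp: share_def row_def)
  from step.IH show ?case
  proof
    assume "share M a c"
    then show ?thesis using step.hyps by blast
  next
    assume "\<exists>d. share M a d \<and> share M d c"
    then obtain d where d: "share M a d" "share M d c" by blast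
    have "b = a \<or> b = d \<or> b = c \<or> c = a \<or> c = d \<or> a = d"
      by (cases a; cases b; cases c; cases d) simp_all
    then show ?thesis using d aa step.hyps by blast
  qed
qed

lemma length_ge_cases:
  obtains "length xs < 3" | a b c where "xs = [a, b, c]" | a b c d where "xs = [a, b, c, d]"
  | a b c d e where "xs = [a, b, c, d, e]" | a b c d e g where "xs = [a, b, c, d, e, g]" | "length xs \<ge> 7"
proof -
  consider "length xs < 3" | "length xs = 3" | "length xs = 4" | "length xs = 5" | "length xs = 6" | "length xs \<ge> 7"
    by linarith
  then show ?thesis
  proof cases
    case 1
    then show ?thesis by (rule that(1))
  next
    case 2
    then obtain a b c where "xs = [a, b, c]"
      by (auto simp: eval_nat_numeral length_Suc_conv)
    then show ?thesis by (rule that(2))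
  next
    case 3
    then obtain a b c d where "xs = [a, b, c, d]"
      by (auto simp: eval_nat_numeral length_Suc_conv)
    then show ?thesis by (rule that(3))
  next
    case 4
    then obtain a b c d e where "xs = [a, b, c, d, e]"
      by (auto simp: eval_nat_numeral length_Suc_conv)
    then show ?thesis by (rule that(4))
  next
    case 5
    then obtain a b c d e g where "xs = [a, b, c, d, e, g]"
      by (auto simp: eval_nat_numeral length_Suc_conv)
    then show ?thesis by (rule that(5))
  next
    case 6
    then show ?thesis by (rule that(6))
  qed
qed

text \<open>Walks alternate sides, so connectedness projects to chains of left letters with common
  neighbours; cycles have even length and at most six vertices.\<close>

lemma graph_tree_iff_tree3:
  assumes V: "\<And>a. Inl a \<in> V \<longleftrightarrow> row M a" "\<And>b. Inr b \<in> V \<longleftrightarrow> row M\<inverse>\<inverse> b"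
    and adj: "\<And>a b. adj (Inl a) (Inr b) \<longleftrightarrow> M a b" "\<And>a b. adj (Inr b) (Inl a) \<longleftrightarrow> M a b"
      "\<And>a b. \<not> adj (Inl a) (Inl b)" "\<And>a b. \<not> adj (Inr a) (Inr b)"
  shows "graph_tree V adj \<longleftrightarrow> tree3 M"
proof -
  define E where "E = {(p, q). p \<in> V \<and> q \<in> V \<and> adj p q}"
  have mem: "Inl a \<in> V" "Inr b \<in> V" if "M a b" for a b
    using that V by (auto simp: row_def)
  have E: "(Inl a, Inr b) \<in> E" "(Inr b, Inl a) \<in> E" if "M a b" for a b
    using that mem adj by (auto simp: E_def)
  have "graph_connected V adj \<longleftrightarrow> connected3 M"
  proof
    assume conn: "graph_connected V adj"
    show "connected3 M" unfolding connected3_def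
    proof (intro allI impI)
      fix a b assume ab: "row M a \<and> row M b"
      \<comment> \<open>Invariant along the walk: at a left vertex its letter is linked to
        \<open>a\<close>, at a right vertex one of its neighbours is.\<close>
      have "case q of Inl b \<Rightarrow> (a, b) \<in> {(p, q). share M p q}\<^sup>* |
          Inr x \<Rightarrow> \<exists>b. (a, b) \<in> {(p, q). share M p q}\<^sup>* \<and> M b x" if "(Inl a, q) \<in> E\<^sup>*" for q
        using that
      proof (induction rule: rtrancl_induct)
        case (step p q)
        show ?case
        proof (cases p)
          case (Inl c)
          then obtain x where "q = Inr x" "M c x" using step.hyps(2) adj by (cases q) (auto simp: E_def)
          then show ?thesis using step.IH Inl by auto
        next
          case (Inr x)
          then obtain c where c: "q = Inl c" "M c x" using step.hyps(2) adj by (cases q) (auto simp: E_def)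
          obtain b where b: "(a, b) \<in> {(p, q). share M p q}\<^sup>*" "M b x" using step.IH Inr by auto
          then have "share M b c" using c(2) unfolding share_def by blast
          then have "(b, c) \<in> {(p, q). share M p q}" by simp
          then show ?thesis using b(1) c(1) by (simp add: rtrancl.rtrancl_into_rtrancl)
        qed
      qed simp
      moreover have "(Inl a, Inl b) \<in> E\<^sup>*" using conn ab V unfolding graph_connected_def E_def by blast
      ultimately have "(a, b) \<in> {(p, q). share M p q}\<^sup>*" by fastforce
      then show "share M a b \<or> (\<exists>c. share M a c \<and> share M c b)" using share_rtrancl ab by blast
    qed
  next
    assume conn: "connected3 M"
    have share: "(Inl a, Inl b) \<in> E\<^sup>*" if "share M a b" for a b
      using that E unfolding share_def by (meson converse_rtrancl_into_rtrancl r_into_rtrancl)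
    have rows: "(Inl a, Inl b) \<in> E\<^sup>*" if "row M a" "row M b" for a b
      using conn share that unfolding connected3_def by (meson rtrancl_trans)
    have to_row: "\<exists>a. row M a \<and> (u, Inl a) \<in> E\<^sup>* \<and> (Inl a, u) \<in> E\<^sup>*" if u: "u \<in> V" for u
    proof (cases u)
      case (Inl a)
      then show ?thesis using u V by auto
    next
      case (Inr b)
      then obtain a where "M a b" using u V by (auto simp: row_def)
      then show ?thesis using E Inr unfolding row_def by blast
    qed
    show "graph_connected V adj"
      unfolding graph_connected_def E_def[symmetric] using to_row rows by (meson rtrancl_trans)
  qed
  moreover have "graph_acyclic V adj \<longleftrightarrow> acyclic3 M"
  proof
    assume acyc: "graph_acyclic V adj"
    show "acyclic3 M" unfolding acyclic3_def
    proof (intro conjI allI impI; rule ccontr)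
      fix a b x y
      assume m: "M a x \<and> M b x \<and> M a y \<and> M b y" and "\<not> (a = b \<or> x = y)"
      then have "distinct [Inl a, Inr x, Inl b, Inr y]" by auto
      moreover have "\<forall>i. Suc i < length [Inl a, Inr x, Inl b, Inr y] \<longrightarrow>
          adj ([Inl a, Inr x, Inl b, Inr y] ! i) ([Inl a, Inr x, Inl b, Inr y] ! Suc i)"
        using m adj by (auto simp: less_Suc_eq nth_Cons split: nat.splits)
      moreover have "set [Inl a, Inr x, Inl b, Inr y] \<subseteq> V" using m mem by auto
      moreover have "adj (last [Inl a, Inr x, Inl b, Inr y]) (hd [Inl a, Inr x, Inl b, Inr y])" using m adj by simp
      moreover have "3 \<le> length [Inl a, Inr x, Inl b, Inr y]" by simp
      ultimately show False using acyc unfolding graph_acyclic_def by blast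
    next
      fix a b c x y z :: letter
      let ?cs = "[Inl a, Inr x, Inl b, Inr y, Inl c, Inr z]"
      assume m: "M a x \<and> M b x \<and> M b y \<and> M c y \<and> M c z \<and> M a z"
        and "\<not> (a = b \<or> b = c \<or> a = c \<or> x = y \<or> y = z \<or> x = z)"
      then have "distinct ?cs" by auto
      moreover have "\<forall>i. Suc i < length ?cs \<longrightarrow> adj (?cs ! i) (?cs ! Suc i)"
        using m adj by (auto simp: less_Suc_eq nth_Cons split: nat.splits)
      moreover have "set ?cs \<subseteq> V" using m mem by auto
      moreover have "adj (last ?cs) (hd ?cs)" using m adj by simp
      moreover have "3 \<le> length ?cs" by simp
      ultimately show False using acyc unfolding graph_acyclic_def by blast
    qed
  next
    assume acyc: "acyclic3 M"
    show "graph_acyclic V adj" unfolding graph_acyclic_def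
    proof (intro notI, elim exE conjE)
      fix cs
      assume len: "3 \<le> length cs" and dist: "distinct cs" and last: "adj (last cs) (hd cs)"
        and adjs: "\<forall>i. Suc i < length cs \<longrightarrow> adj (cs ! i) (cs ! Suc i)"
      have a: "Suc i < length cs \<Longrightarrow> adj (cs ! i) (cs ! Suc i)" for i using adjs by blast
      have sum: "adj u v \<longleftrightarrow> (\<exists>a b. M a b \<and> (u = Inl a \<and> v = Inr b \<or> u = Inr b \<and> v = Inl a))" for u v
        using adj by (cases u; cases v) auto
      show False
      proof (cases cs rule: length_ge_cases)
        case 1
        then show ?thesis using len by simp
      next
        case (2 p q r)
        then show ?thesis using a[of 0] a[of 1] last by (auto simp: sum)
      next
        case (3 p q r s)
        then have "adj p q" "adj q r" "adj r s" "adj s p"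
          using a[of 0] a[of 1] a[of 2] last by (simp_all add: numeral_2_eq_2)
        then show ?thesis using dist 3 acyc unfolding sum acyclic3_def by auto
      next
        case (4 p q r s t)
        then have "adj p q" "adj q r" "adj r s" "adj s t" "adj t p"
          using a[of 0] a[of 1] a[of 2] a[of 3] last by (simp_all add: numeral_2_eq_2 numeral_3_eq_3)
        then show ?thesis by (auto simp: sum)
      next
        case (5 p q r s t u)
        then have "adj p q" "adj q r" "adj r s" "adj s t" "adj t u" "adj u p"
          using a[of 0] a[of 1] a[of 2] a[of 3] a[of 4] last by (simp_all add: eval_nat_numeral)
        then have "(\<exists>x y z x' y' z'. M x x' \<and> M y x' \<and> M y y' \<and> M z y' \<and> M z z' \<and> M x z' \<and>
            [p, q, r, s, t, u] = [Inl x, Inr x', Inl y, Inr y', Inl z, Inr z']) \<or>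
          (\<exists>x y z x' y' z'. M x x' \<and> M y x' \<and> M y y' \<and> M z y' \<and> M z z' \<and> M x z' \<and>
            [p, q, r, s, t, u] = [Inr x', Inl y, Inr y', Inl z, Inr z', Inl x])"
          unfolding sum by auto
        then obtain x y z x' y' z' where "M x x'" "M y x'" "M y y'" "M z y'" "M z z'" "M x z'"
          and "cs = [Inl x, Inr x', Inl y, Inr y', Inl z, Inr z'] \<or> cs = [Inr x', Inl y, Inr y', Inl z, Inr z', Inl x]"
          unfolding 5 by blast
        moreover from this(7) have "x \<noteq> y \<and> y \<noteq> z \<and> x \<noteq> z \<and> x' \<noteq> y' \<and> y' \<noteq> z' \<and> x' \<noteq> z'"
          using dist by auto
        ultimately show ?thesis using acyc unfolding acyclic3_def by blast
      next
        case 6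
        have fin: "finite (UNIV :: (letter + letter) set)"
          by (simp add: UNIV_letter flip: UNIV_Plus_UNIV)
        have "card (set cs) \<le> card (UNIV :: (letter + letter) set)"
          using fin by (intro card_mono) auto
        also have "\<dots> = 6"
          by (simp add: UNIV_letter card_Plus flip: UNIV_Plus_UNIV)
        finally show ?thesis using 6 dist by (simp add: distinct_card)
      qed
    qed
  qed
  ultimately show ?thesis unfolding graph_tree_def tree3_def by blast
qed

text \<open>Words outside the language have the empty relation, which counts as a tree, so all words
  may be quantified over.\<close>

lemma dendric_iff:
  assumes "urlang (lang X)"
  shows "dendric X \<longleftrightarrow> (\<forall>w. tree3 (ext (lang X) w))"
proof -
  have "graph_tree (ext_vertices X w) (ext_adj X w) \<longleftrightarrow> tree3 (ext (lang X) w)" for w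
    by (rule graph_tree_iff_tree3)
      (auto simp: ext_vertices_def row_ext[OF assms] row_ext_conv[OF assms] ext_def)
  moreover have "tree3 (ext (lang X) w)" if "w \<notin> lang X" for w
  proof -
    have "\<not> ext (lang X) w a b" for a b
      using that urlang_appendD[OF assms, of "[a]" w "[b]"] by (auto simp: ext_def)
    then have "good L1 L1 (ext (lang X) w)" by (intro good_one_row) blast
    then show ?thesis by (simp add: good_def)
  qed
  ultimately show ?thesis unfolding dendric_def by blast
qed

section \<open>Directive sequences\<close>

lemma wmap_single: "wmap (\<lambda>a. [a]) w = w"
  by (simp add: wmap_letters)

lemma mcomp_apply: "(f \<odot> g) x = wmap f (g x)"
  by (simp add: mcomp_def)

lemma mcomp_assoc: "f \<odot> g \<odot> h = f \<odot> (g \<odot> h)"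
  by (rule HOL.ext) (simp add: mcomp_apply wmap_mcomp)

lemma dcomp_add: "dcomp d n (j + k) = dcomp d n j \<odot> dcomp d (n + j) k"
proof (induction k)
  case 0
  show ?case by (simp add: mcomp_def)
next
  case (Suc k)
  then show ?case by (simp add: mcomp_assoc add.assoc)
qed

lemma dcomp_Suc: "dcomp d n (Suc k) = d n \<odot> dcomp d (Suc n) k"
  using dcomp_add[of d n 1 k] by (simp add: mcomp_def wmap_single)

lemma dseg_trans: "\<lbrakk>n \<le> m; m \<le> N\<rbrakk> \<Longrightarrow> dseg d n N = dseg d n m \<odot> dseg d m N"
  using dcomp_add[of d n "m - n" "N - m"] by (simp add: dseg_def)

lemma dseg_trans_apply: "\<lbrakk>n \<le> m; m \<le> N\<rbrakk> \<Longrightarrow> dseg d n N a = wmap (dseg d n m) (dseg d m N a)"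
  using dseg_trans[of n m N d] by (simp add: mcomp_apply)

lemma dseg_Suc: "dseg d n (Suc n) = d n"
  by (simp add: dseg_def mcomp_def wmap_single)

lemma length_wmap_non_erasing: "non_erasing f \<Longrightarrow> length w \<le> length (wmap f w)"
proof (induction w)
  case (Cons a w)
  then have "1 \<le> length (f a)" "length w \<le> length (wmap f w)"
    by (auto simp: non_erasing_def Suc_le_eq)
  then show ?case unfolding wmap_simps length_append list.size by linarith
qed simp

lemma dseg_nonempty:
  assumes "\<And>m. m \<ge> 1 \<Longrightarrow> non_erasing (d m)" "n \<ge> 1"
  shows "dseg d n N a \<noteq> []"
proof -
  have "dcomp d n k a \<noteq> []" for k
    using assms(2)
  proof (induction k arbitrary: n)
    case (Suc k)
    then have "length (dcomp d (Suc n) k a) \<noteq> 0" by simp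
    moreover have "length (dcomp d (Suc n) k a) \<le> length (wmap (d n) (dcomp d (Suc n) k a))"
      by (rule length_wmap_non_erasing) (use assms(1) Suc.prems in blast)
    ultimately have "length (wmap (d n) (dcomp d (Suc n) k a)) \<noteq> 0" by linarith
    then show ?case unfolding dcomp_Suc mcomp_def by simp
  qed simp
  then show ?thesis by (simp add: dseg_def)
qed

text \<open>The next block of levels yields at least two letters: the image of the first has length
  at least \<open>m\<close>, and the second adds at least one.\<close>

lemma growth_iterate:
  assumes ne: "\<And>m. m \<ge> 1 \<Longrightarrow> non_erasing (d m)"
    and two: "\<And>n. n \<ge> 1 \<Longrightarrow> \<exists>N>n. \<forall>a. 2 \<le> length (dseg d n N a)" and "n \<ge> 1"
  shows "\<exists>N>n. \<forall>a. m \<le> length (dseg d n N a)"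
proof (induction m)
  case 0
  show ?case by auto
next
  case (Suc m)
  then obtain N where N: "N > n" "\<And>a. m \<le> length (dseg d n N a)" by blast
  then obtain N' where N': "N' > N" "\<And>a. 2 \<le> length (dseg d N N' a)" using two[of N] \<open>n \<ge> 1\<close> by auto
  have "Suc m \<le> length (dseg d n N' a)" for a
  proof -
    obtain b v where v: "dseg d N N' a = b # v" "v \<noteq> []"
      using N'(2)[of a] by (cases "dseg d N N' a"; fastforce)
    then obtain c v' where "v = c # v'" by (cases v) auto
    moreover have "dseg d n N c \<noteq> []" by (rule dseg_nonempty[OF ne \<open>n \<ge> 1\<close>])
    then have "1 \<le> length (dseg d n N c)" by (simp add: Suc_le_eq)
    ultimately have "Suc m \<le> length (wmap (dseg d n N) (dseg d N N' a))"
      using v N(2)[of b] by simp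
    then show ?thesis using dseg_trans_apply[of n N N' d a] N(1) N'(1) by simp
  qed
  then show ?case using N(1) N'(1) by (meson less_trans)
qed

lemma sublist_wmap_block: "a \<in> set v \<Longrightarrow> sublist (g a) (wmap g v)"
  using sublist_wmap[of "[a]" v g] by (simp add: sublist_singleton)

text \<open>A factor starting inside a block uses up at most \<open>B\<close> letters before the
  next block begins, and the remaining \<open>B\<close> letters cover that block.\<close>

lemma long_sublist_block:
  assumes ne: "\<And>b. g b \<noteq> []" and bound: "\<And>b. length (g b) \<le> B" and u: "2 * B \<le> length u"
  shows "sublist u (wmap g v) \<Longrightarrow> \<exists>b. sublist (g b) u"
proof (induction v)
  case Nil
  have "0 < length (g undefined)" using ne by blast
  then show ?case using Nil u bound[of undefined] by simp
next
  case (Cons b v)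
  have B: "0 < B" using ne[of b] bound[of b] by (metis length_0_conv le_zero_eq neq0_conv)
  from Cons.prems consider "sublist u (g b)" | "sublist u (wmap g v)"
    | u1 u2 where "u = u1 @ u2" "suffix u1 (g b)" "prefix u2 (wmap g v)"
    by (auto simp: sublist_append)
  then show ?case
  proof cases
    case 1
    then have "length u \<le> B" using sublist_length_le bound[of b] le_trans by blast
    then show ?thesis using u B by linarith
  next
    case 2
    then show ?thesis by (rule Cons.IH)
  next
    case 3
    then have "length u1 \<le> B" using suffix_length_le bound[of b] le_trans by blast
    then have u2: "B \<le> length u2" using u 3(1) by simp
    then obtain c v' where v: "v = c # v'" using 3(3) B by (cases v) auto
    have "prefix (g c) (wmap g v)" using v by simp
    then have "prefix (g c) u2" using 3(3) bound[of c] u2 by (meson le_trans prefix_length_prefix)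
    then have "sublist (g c) u" using 3(1) by (auto simp: prefix_def sublist_def)
    then show ?thesis by blast
  qed
qed

lemma dlang_sublist: "v \<in> dlang d n \<Longrightarrow> sublist u v \<Longrightarrow> u \<in> dlang d n"
  unfolding dlang_def using sublist_order.order_trans by blast

text \<open>The hypothesis serves the case \<open>N = Suc n\<close>, where the segment above level
  \<open>n\<close> is a bare letter, whereas \<open>dlang d (Suc n)\<close> is built from segments
  of positive length.\<close>

lemma dlang_image:
  assumes "\<And>a. [a] \<in> dlang d (Suc n)"
  shows "dlang d n = image_lang (d n) (dlang d (Suc n))"
proof (intro equalityI subsetI)
  fix w assume "w \<in> dlang d n"
  then obtain N a where N: "N > n" "sublist w (dseg d n N a)" unfolding dlang_def by blast
  then have "sublist w (wmap (d n) (dseg d (Suc n) N a))"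
    using dseg_trans_apply[of n "Suc n" N d a] by (simp add: dseg_Suc)
  moreover have "dseg d (Suc n) N a \<in> dlang d (Suc n)"
  proof (cases "N = Suc n")
    case True
    then show ?thesis using assms by (simp add: dseg_def)
  next
    case False
    then show ?thesis using N(1) unfolding dlang_def by (auto intro!: exI[of _ N])
  qed
  ultimately show "w \<in> image_lang (d n) (dlang d (Suc n))" unfolding image_lang_def by blast
next
  fix w assume "w \<in> image_lang (d n) (dlang d (Suc n))"
  then obtain v N a where v: "sublist w (wmap (d n) v)" "N > Suc n" "sublist v (dseg d (Suc n) N a)"
    unfolding image_lang_def dlang_def by blast
  have "sublist w (wmap (d n) (dseg d (Suc n) N a))"
    using v(1) sublist_wmap[OF v(3)] sublist_order.order_trans by blast
  then have "sublist w (dseg d n N a)"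
    using dseg_trans_apply[of n "Suc n" N d a] v(2) by (simp add: dseg_Suc)
  then show "w \<in> dlang d n" using v(2) unfolding dlang_def by (auto intro!: exI[of _ N])
qed

section \<open>Languages of primitive directive sequences\<close>

lemma primitive_dlang_letter:
  assumes "primitive_dir d" "n \<ge> 1"
  shows "[a] \<in> dlang d n"
proof -
  obtain N where "N > n" "a \<in> set (dseg d n N a)" using assms unfolding primitive_dir_def by blast
  then show ?thesis unfolding dlang_def by (auto simp: sublist_singleton)
qed

text \<open>Primitivity puts the letter \<open>a\<close> into every image between levels
  \<open>N\<close> and \<open>N'\<close>; longer segments contain such an image because they are
  never empty.\<close>

lemma primitive_dlang_everywhere:
  assumes d: "primitive_dir d" and n: "n \<ge> 1" and w: "w \<in> dlang d n"
  obtains N where "N > n" "\<And>M b. M \<ge> N \<Longrightarrow> sublist w (dseg d n M b)"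
proof -
  have ne: "\<And>m. m \<ge> 1 \<Longrightarrow> non_erasing (d m)" using d unfolding primitive_dir_def by blast
  obtain N a where N: "N > n" "sublist w (dseg d n N a)" using w unfolding dlang_def by blast
  then obtain N' where N': "N' > N" "\<And>b. a \<in> set (dseg d N N' b)"
    using d n unfolding primitive_dir_def by (meson le_trans less_imp_le)
  have "sublist w (dseg d n M b)" if M: "M \<ge> N'" for M b
  proof -
    obtain e where "e \<in> set (dseg d N' M b)"
      using dseg_nonempty[of d N' M b] ne N' N n by (metis le_trans less_imp_le list.set_intros(1) neq_Nil_conv)
    then have "sublist (dseg d N N' e) (dseg d N M b)"
      using dseg_trans_apply[of N N' M d b] N' M sublist_wmap_block by (metis less_imp_le)
    then have "a \<in> set (dseg d N M b)" using N'(2)[of e] set_mono_sublist by blast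
    then have "sublist (dseg d n N a) (dseg d n M b)"
      using dseg_trans_apply[of n N M d b] N N' M sublist_wmap_block by (metis le_trans less_imp_le)
    then show ?thesis using N(2) sublist_order.order_trans by blast
  qed
  then show ?thesis using that[of N'] N(1) N'(1) by simp
qed

text \<open>A long word contains a complete block \<open>dseg d n N b\<close>, and each such block
  contains \<open>w\<close>; this is uniform recurrence. Extendability follows since
  \<open>w\<close> occurs strictly inside a long block.\<close>

lemma urlang_dlang:
  fixes d :: "nat \<Rightarrow> letter \<Rightarrow> letter list"
  assumes d: "primitive_dir d" and n: "n \<ge> 1"
  shows "urlang (dlang d n)"
proof -
  have ne: "\<And>m. m \<ge> 1 \<Longrightarrow> non_erasing (d m)" using d unfolding primitive_dir_def by blast
  have recurrent: "\<exists>N. \<forall>u\<in>dlang d n. N \<le> length u \<longrightarrow> sublist w u" if w: "w \<in> dlang d n" for w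
  proof -
    obtain N where N: "N > n" "\<And>M b. M \<ge> N \<Longrightarrow> sublist w (dseg d n M b)"
      using primitive_dlang_everywhere[OF d n w] by blast
    define B where "B = Max (range (\<lambda>b. length (dseg d n N b)))"
    have B: "length (dseg d n N b) \<le> B" for b
      unfolding B_def by (rule Max_ge) (simp add: UNIV_letter, rule rangeI)
    have "sublist w u" if u: "u \<in> dlang d n" "2 * B \<le> length u" for u
    proof -
      obtain M where M: "\<And>M' b. M' \<ge> M \<Longrightarrow> sublist u (dseg d n M' b)"
        using primitive_dlang_everywhere[OF d n u(1)] by blast
      have "sublist u (wmap (dseg d n N) (dseg d N (max M N) L1))"
        using M[of "max M N" L1] dseg_trans_apply[of n N "max M N" d L1] N(1) by simp
      moreover have "dseg d n N b \<noteq> []" for b by (rule dseg_nonempty[OF ne n])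
      ultimately obtain b where "sublist (dseg d n N b) u"
        using long_sublist_block[where g = "dseg d n N", OF _ B u(2)] by blast
      then show ?thesis using N(2)[of N b] sublist_order.order_trans by blast
    qed
    then show ?thesis by blast
  qed
  have two: "\<exists>N>m. \<forall>a. 2 \<le> length (dseg d m N a)" if m: "m \<ge> 1" for m
  proof -
    obtain N where N: "N > m" "\<And>b a. a \<in> set (dseg d m N b)" using d m unfolding primitive_dir_def by blast
    have "2 \<le> length (dseg d m N b)" for b
    proof -
      have "{L1, L2} \<subseteq> set (dseg d m N b)" using N(2)[of L1 b] N(2)[of L2 b] by blast
      then have "card {L1, L2} \<le> card (set (dseg d m N b))" by (intro card_mono finite_set)
      then show ?thesis using card_length[of "dseg d m N b"] by simp
    qed
    then show ?thesis using N(1) by blast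
  qed
  have ext: "\<exists>a b. a # w @ [b] \<in> dlang d n" if w: "w \<in> dlang d n" for w
  proof -
    obtain N where N: "\<And>u. u \<in> dlang d n \<Longrightarrow> N \<le> length u \<Longrightarrow> sublist w u" using recurrent[OF w] by blast
    \<comment> \<open>Two letters beyond the recurrence bound, so that the interior still contains
      \<open>w\<close>.\<close>
    obtain M where M: "M > n" "Suc (Suc N) \<le> length (dseg d n M L1)"
      using growth_iterate[OF ne two n, of "Suc (Suc N)"] by blast
    have inL: "dseg d n M L1 \<in> dlang d n" unfolding dlang_def using M(1) by blast
    obtain a u where au: "dseg d n M L1 = a # u" using M(2) by (cases "dseg d n M L1") auto
    then obtain v b where vb: "u = v @ [b]" using M(2) by (cases u rule: rev_cases) auto
    have "sublist v (dseg d n M L1)" unfolding au vb sublist_def by (metis append_Cons append_Nil)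
    then have "v \<in> dlang d n" by (rule dlang_sublist[OF inL])
    then obtain p q where v: "v = p @ w @ q" using N[of v] M(2) au vb by (auto simp: sublist_def)
    obtain p' a' where p': "a # p = p' @ [a']" by (metis list.distinct(1) rev_exhaust)
    obtain q' b' where q': "q @ [b] = b' # q'" by (cases q) auto
    have "dseg d n M L1 = (a # p) @ w @ (q @ [b])" using au vb v by simp
    also have "\<dots> = p' @ (a' # w @ [b']) @ q'" unfolding p' q' by simp
    finally have "sublist (a' # w @ [b']) (dseg d n M L1)" unfolding sublist_def by blast
    then show ?thesis using dlang_sublist[OF inL] by blast
  qed
  show ?thesis unfolding urlang_def
    using dlang_sublist primitive_dlang_letter[OF d n] ext recurrent by blast
qed

text \<open>An image of length one at every level forces arbitrarily high powers of a letter, which a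
  uniformly recurrent language excludes.\<close>

lemma dcomp_single_letter:
  assumes L: "\<And>m. m \<ge> 1 \<Longrightarrow> urlang (L m)" "\<And>m. m \<ge> 1 \<Longrightarrow> L m = image_lang (d m) (L (Suc m))"
    and first: "\<And>m. m \<ge> k \<Longrightarrow> \<exists>c. \<forall>a. \<exists>x. d m a = c # x" and "k \<ge> 1"
  shows "\<lbrakk>n \<ge> k; dcomp d n (Suc j) a = [c]\<rbrakk> \<Longrightarrow> replicate (j + 2) c \<in> L n"
proof (induction j arbitrary: n a c)
  case 0
  then have n1: "n \<ge> 1" "Suc n \<ge> 1" using \<open>k \<ge> 1\<close> by auto
  obtain e where e: "\<And>a. \<exists>x. d n a = e # x" using first[OF 0(1)] by blast
  have dc: "d n a = [c]" using 0(2) by (simp add: mcomp_def wmap_single)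
  then have "e = c" using e[of a] by auto
  obtain b where b: "[a] @ [b] \<in> L (Suc n)" using urlang_right[OF L(1)[OF n1(2)] urlang_letter[OF L(1)[OF n1(2)]]] by blast
  obtain x where x: "d n b = c # x" using e[of b] \<open>e = c\<close> by blast
  have "wmap (d n) ([a] @ [b]) = replicate 2 c @ x" using dc x by (simp add: numeral_2_eq_2)
  then have "sublist (replicate (0 + 2) c) (wmap (d n) ([a] @ [b]))"
    unfolding add_0 by (metis append_Nil sublist_appendI)
  then show ?case using b L(2)[OF n1(1)] unfolding image_lang_def by blast
next
  case (Suc j)
  then have n1: "n \<ge> 1" "Suc n \<ge> 1" using \<open>k \<ge> 1\<close> by auto
  obtain e where e: "\<And>a. \<exists>x. d n a = e # x" using first[OF Suc.prems(1)] by blast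
  have "non_erasing (d n)" unfolding non_erasing_def using e by (metis list.distinct(1))
  define w where "w = dcomp d (Suc n) (Suc j) a"
  have w: "wmap (d n) w = [c]" using Suc.prems(2) unfolding w_def dcomp_Suc[of d n] by (simp add: mcomp_def)
  then have "length w \<le> 1" using length_wmap_non_erasing[OF \<open>non_erasing (d n)\<close>, of w] by simp
  moreover have "w \<noteq> []" using w by auto
  ultimately obtain a' where a': "w = [a']" by (cases w) auto
  then have dc: "d n a' = [c]" using w by simp
  then have "e = c" using e[of a'] by auto
  have IH: "replicate (j + 2) a' \<in> L (Suc n)"
    by (rule Suc.IH[of "Suc n" a]) (use Suc.prems a' w_def in auto)
  obtain b where b: "replicate (j + 2) a' @ [b] \<in> L (Suc n)" using urlang_right[OF L(1)[OF n1(2)] IH] by blast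
  obtain x where x: "d n b = c # x" using e[of b] \<open>e = c\<close> by blast
  have rep: "wmap (d n) (replicate m a') = replicate m c" for m by (induction m) (simp_all add: dc)
  \<comment> \<open>The exponent grows by one per level because the image of the following letter
    \<open>b\<close> starts with \<open>c\<close> as well.\<close>
  have "wmap (d n) (replicate (j + 2) a' @ [b]) = replicate (j + 2) c @ [c] @ x"
    by (simp only: wmap_simps rep x append_Cons append_Nil append_Nil2)
  also have "\<dots> = replicate (Suc j + 2) c @ x"
    unfolding append_assoc[symmetric] replicate_snoc by (simp only: add_Suc replicate_Suc)
  finally have "wmap (d n) (replicate (j + 2) a' @ [b]) = replicate (Suc j + 2) c @ x" .
  then have "sublist (replicate (Suc j + 2) c) (wmap (d n) (replicate (j + 2) a' @ [b]))"
    by (metis sublist_appendI append_Nil)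
  then show ?case using b L(2)[OF n1(1)] unfolding image_lang_def by blast
qed

text \<open>An image of length one over \<open>Suc j\<close> levels would put
  \<open>replicate (j + 2) c\<close> into \<open>L n\<close>, where every word of length at least
  \<open>j\<close> contains another letter \<open>e\<close>.\<close>

lemma growth_levels:
  fixes d :: "nat \<Rightarrow> letter \<Rightarrow> letter list"
  assumes L: "\<And>m. m \<ge> 1 \<Longrightarrow> urlang (L m)" "\<And>m. m \<ge> 1 \<Longrightarrow> L m = image_lang (d m) (L (Suc m))"
    and ne: "\<And>m. m \<ge> 1 \<Longrightarrow> non_erasing (d m)"
    and first: "\<And>m. m \<ge> k \<Longrightarrow> \<exists>c. \<forall>a. \<exists>x. d m a = c # x" and k: "k \<ge> 1" "n \<ge> k"
  shows "\<exists>N>n. \<forall>a. 2 \<le> length (dseg d n N a)"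
proof -
  have n: "n \<ge> 1" using k by simp
  obtain c where c: "\<And>a. \<exists>x. d n a = c # x" using first[OF k(2)] by blast
  obtain e where e: "e \<noteq> c" by (cases c) auto
  obtain j where j: "\<And>u. u \<in> L n \<Longrightarrow> j \<le> length u \<Longrightarrow> sublist [e] u"
    using urlang_recurrent[OF L(1)[OF n] urlang_letter[OF L(1)[OF n]]] by blast
  have "2 \<le> length (dseg d n (n + Suc j) a)" for a
  proof (rule ccontr)
    assume "\<not> 2 \<le> length (dseg d n (n + Suc j) a)"
    then have "length (dseg d n (n + Suc j) a) \<le> 1" by simp
    then obtain c' where "dseg d n (n + Suc j) a = [c']"
      using dseg_nonempty[where d = d and N = "n + Suc j" and a = a, OF ne n] by (cases "dseg d n (n + Suc j) a") auto
    then have c': "dcomp d n (Suc j) a = [c']" by (simp add: dseg_def del: dcomp.simps)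
    have "c' = c"
    proof -
      have "dcomp d (Suc n) j a \<noteq> []"
        using dseg_nonempty[where d = d and n = "Suc n" and N = "Suc n + j" and a = a, OF ne] by (simp add: dseg_def)
      then obtain b w where "dcomp d (Suc n) j a = b # w" by (cases "dcomp d (Suc n) j a") auto
      then show ?thesis using c' c[of b] unfolding dcomp_Suc by (auto simp: mcomp_def)
    qed
    then have "replicate (j + 2) c \<in> L n"
      using dcomp_single_letter[OF L first k(1) k(2) c'] by simp
    then have "e \<in> set (replicate (j + 2) c)" using j[of "replicate (j + 2) c"] sublist_singleton[of e] by simp
    then show False using e by simp
  qed
  then show ?thesis by (intro exI[of _ "n + Suc j"]) simp
qed

text \<open>Images of letters are words of \<open>L n\<close> and become arbitrarily long, so by
  uniform recurrence they contain any given finite set of words. Applied to all letters this is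
  primitivity; applied to one word it shows that \<open>dlang d 1\<close> exhausts
  \<open>L 1\<close>.\<close>

lemma directive_levels:
  fixes d :: "nat \<Rightarrow> letter \<Rightarrow> letter list"
  assumes L: "\<And>m. m \<ge> 1 \<Longrightarrow> urlang (L m)" "\<And>m. m \<ge> 1 \<Longrightarrow> L m = image_lang (d m) (L (Suc m))"
    and ne: "\<And>m. m \<ge> 1 \<Longrightarrow> non_erasing (d m)"
    and two: "\<And>n. n \<ge> 1 \<Longrightarrow> \<exists>N>n. \<forall>a. 2 \<le> length (dseg d n N a)"
  shows "primitive_dir d" "dlang d 1 = L 1"
proof -
  have up: "u \<in> L (n + k) \<Longrightarrow> n \<ge> 1 \<Longrightarrow> wmap (dcomp d n k) u \<in> L n" for n k u
  proof (induction k arbitrary: n)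
    case (Suc k)
    then have "wmap (dcomp d (Suc n) k) u \<in> L (Suc n)" by simp
    then show ?case using L(2)[OF Suc.prems(2)] unfolding dcomp_Suc wmap_mcomp image_lang_def
      by (metis (mono_tags, lifting) mem_Collect_eq sublist_order.order_refl)
  qed (simp add: wmap_single)
  have mem: "dseg d n N a \<in> L n" if "n \<ge> 1" "N \<ge> n" for n N a
    using up[of "[a]" n "N - n"] urlang_letter[OF L(1), of N a] that by (simp add: dseg_def)
  have occurs: "\<exists>N>n. \<forall>a. \<forall>w\<in>W. sublist w (dseg d n N a)" if "finite W" "W \<subseteq> L n" "n \<ge> 1" for n W
  proof -
    have "\<exists>m. \<forall>u\<in>L n. m \<le> length u \<longrightarrow> (\<forall>w\<in>W. sublist w u)"
      using that(1,2)
    proof (induction W)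
      case (insert w W)
      then obtain m where m: "\<forall>u\<in>L n. m \<le> length u \<longrightarrow> (\<forall>w\<in>W. sublist w u)" by blast
      obtain m' where "\<And>u. u \<in> L n \<Longrightarrow> m' \<le> length u \<Longrightarrow> sublist w u"
        using urlang_recurrent[OF L(1)[OF \<open>n \<ge> 1\<close>], of w] insert.prems by blast
      then show ?case using m by (intro exI[of _ "max m m'"]) auto
    qed auto
    then obtain m where m: "\<forall>u\<in>L n. m \<le> length u \<longrightarrow> (\<forall>w\<in>W. sublist w u)" by blast
    obtain N where "N > n" "\<forall>a. m \<le> length (dseg d n N a)"
      using growth_iterate[OF ne two \<open>n \<ge> 1\<close>] by blast
    then show ?thesis using m mem[OF \<open>n \<ge> 1\<close>] by (intro exI[of _ N]) auto
  qed
  show "primitive_dir d" unfolding primitive_dir_def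
  proof (intro conjI allI impI)
    fix n :: nat assume n: "1 \<le> n"
    have "finite (range (\<lambda>a :: letter. [a]))" by (simp add: UNIV_letter)
    then obtain N where N: "N > n" "\<forall>a. \<forall>w\<in>range (\<lambda>a. [a]). sublist w (dseg d n N a)"
      using occurs[of "range (\<lambda>a. [a])" n] urlang_letter[OF L(1)[OF n]] n by blast
    then have "\<forall>b a. a \<in> set (dseg d n N b)" by (auto simp: sublist_singleton)
    then show "\<exists>N>n. \<forall>b a. a \<in> set (dseg d n N b)" using N(1) by blast
  qed (use ne in blast)
  show "dlang d 1 = L 1"
  proof (intro equalityI subsetI)
    fix w assume "w \<in> dlang d 1"
    then obtain N a where "N > 1" "sublist w (dseg d 1 N a)" unfolding dlang_def by blast
    moreover from this have "dseg d 1 N a \<in> L 1" by (intro mem) simp_all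
    ultimately show "w \<in> L 1" using urlang_sublist[OF L(1)[OF order_refl]] by blast
  next
    fix w assume "w \<in> L 1"
    then obtain N where "N > 1" "\<forall>a. sublist w (dseg d 1 N a)" using occurs[of "{w}" 1] by auto
    then show "w \<in> dlang d 1" unfolding dlang_def by blast
  qed
qed

section \<open>The characterization\<close>

lemma Sigma3_cases:
  assumes "p0 \<in> Sigma3"
  obtains p where "distinct3 p" "p0 = perm p"
proof -
  have "\<exists>p. distinct3 p \<and> p0 = perm p"
    using assms unfolding Sigma3_def
    by (elim insertE emptyE; force intro: exI[of _ "(_, _, _)"])
  then show ?thesis using that by blast
qed

text \<open>Up to relabelling, the two vertices are the two possible cases: coinciding and distinct
  common letters.\<close>

lemma center_vertex:
  obtains v p where "distinct3 p" "relabelling p (lcenter v) = l" "relabelling p (rcenter v) = r"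
proof -
  have "\<exists>v p. distinct3 p \<and> relabelling p (lcenter v) = l \<and> relabelling p (rcenter v) = r"
  proof (cases "l = r")
    case True
    obtain a b where "a \<noteq> b" "b \<noteq> l" "a \<noteq> l" by (cases l) auto
    then show ?thesis using True by (intro exI[of _ V33] exI[of _ "(a, b, l)"]) auto
  next
    case False
    obtain a where "a \<noteq> l" "a \<noteq> r" by (cases l; cases r) auto
    then show ?thesis using False by (intro exI[of _ V32] exI[of _ "(a, r, l)"]) auto
  qed
  then show ?thesis using that by blast
qed

lemma prepend_dir_simps: "prepend_dir p0 s 1 = p0" "n \<ge> 1 \<Longrightarrow> prepend_dir p0 s (Suc n) = s n"
  by (auto simp: prepend_dir_def)

lemma dendric_if_path:
  fixes X :: "(int \<Rightarrow> letter) set"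
  assumes X: "shift_space X" and p0: "p0 \<in> Sigma3"
    and path: "\<And>n. n \<ge> 1 \<Longrightarrow> Gedge (v n) (s n) (v (Suc n))"
    and prim: "primitive_dir (prepend_dir p0 s)" and gen: "X = gen_shift (prepend_dir p0 s)"
  shows "minimal_shift X \<and> dendric X"
proof -
  define d where "d = prepend_dir p0 s"
  have d: "d 1 = p0" "\<And>n. n \<ge> 1 \<Longrightarrow> d (Suc n) = s n" unfolding d_def by (rule prepend_dir_simps; assumption?)+
  have prim: "primitive_dir d" using prim unfolding d_def .
  have ur: "urlang (dlang d n)" if "n \<ge> 1" for n by (rule urlang_dlang[OF prim that])
  have step: "dlang d n = image_lang (d n) (dlang d (Suc n))" for n
    by (rule dlang_image) (use primitive_dlang_letter[OF prim] in simp)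
  \<comment> \<open>The prepended permutation shifts the indices: the vertex \<open>v n\<close>
    belongs to level \<open>Suc n\<close>.\<close>
  have good: "good (lcenter (v n)) (rcenter (v n)) (ext (dlang d (Suc n)) w)" if "n \<ge> 1" for n w
    using that
  proof (induction w arbitrary: n rule: length_induct)
    case (1 w)
    have "good (lcenter (v n)) (rcenter (v n)) (ext (image_lang (s n) (dlang d (Suc (Suc n)))) w)"
      by (rule good_image_label[OF path[OF 1(2)] ur]) (use 1 in auto)
    then show ?case using step[of "Suc n"] d(2)[OF 1(2)] by simp
  qed
  obtain p where p: "distinct3 p" "p0 = perm p" using p0 by (rule Sigma3_cases)
  have h: "bij (relabelling p)" by (rule bij_relabelling[OF p(1)])
  have perm: "perm p = (\<lambda>x. [relabelling p x])" by (intro HOL.ext) (rule perm_apply)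
  have "dlang d 1 = relabel (inv (relabelling p)) (dlang d (Suc 1))"
    unfolding step[of 1] d(1) p(2) perm by (rule image_lang_letters[OF h urlang_sublist[OF ur]]) simp
  moreover have "good (relabelling p (lcenter (v 1))) (relabelling p (rcenter (v 1)))
      (ext (relabel (inv (relabelling p)) (dlang d (Suc 1))) w)" for w
    by (rule good_ext_relabel[OF bij_imp_bij_inv[OF h]]) (use good[of 1] h in \<open>simp add: bij_is_inj\<close>)
  ultimately have tree: "tree3 (ext (dlang d 1) w)" for w by (simp add: good_def)
  have "X \<noteq> {}" using X unfolding shift_space_def by blast
  then have lang: "lang X = dlang d 1" using gen_shift_lang[of d] ur[of 1] gen d_def by simp
  have urX: "urlang (lang X)" unfolding lang by (rule ur) simp
  show ?thesis using recurrent_minimal[OF urX] dendric_iff[OF urX] tree lang by simp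
qed

lemma path_if_dendric:
  fixes X :: "(int \<Rightarrow> letter) set"
  assumes X: "shift_space X" and min: "minimal_shift X" and dend: "dendric X"
  shows "\<exists>p0 \<in> Sigma3. \<exists>s v. (\<forall>n\<ge>1. s n \<in> SigmaS3Sigma \<and> Gedge (v n) (s n) (v (Suc n))) \<and>
       primitive_dir (prepend_dir p0 s) \<and> X = gen_shift (prepend_dir p0 s)"
proof -
  define L where "L = lang X"
  have L: "urlang L" unfolding L_def by (rule urlang_lang[OF X min])
  have tree: "tree3 (ext L w)" for w using dend dendric_iff L unfolding L_def by blast
  obtain l where l: "\<And>w b. pers (ext L w) l b" using exists_left_center[OF L tree] by blast
  obtain r where r: "\<And>w b. pers (ext L w)\<inverse>\<inverse> r b" using exists_right_center[OF L tree] by blast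
  obtain v1 p where p: "distinct3 p" "relabelling p (lcenter v1) = l" "relabelling p (rcenter v1) = r"
    by (rule center_vertex)
  have h: "bij (relabelling p)" by (rule bij_relabelling[OF p(1)])
  \<comment> \<open>In the rest of this proof \<open>L1\<close> names the relabelled language and
    hides the letter.\<close>
  define L1 where "L1 = relabel (relabelling p) L"
  define P where "P x \<longleftrightarrow> urlang (snd x) \<and> (\<forall>w. good (lcenter (fst x)) (rcenter (fst x)) (ext (snd x) w))" for x
  define Q where "Q x y \<longleftrightarrow> (\<exists>s. Gedge (fst x) s (fst y) \<and> s \<in> SigmaS3Sigma \<and> snd x = image_lang s (snd y))" for x y
  have "good (lcenter v1) (rcenter v1) (ext L1 w)" for w
    unfolding L1_def by (rule good_ext_relabel[OF h]) (use tree l r p in \<open>simp add: good_def\<close>)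
  then have P1: "P (v1, L1)" unfolding P_def L1_def using urlang_relabel[OF h L] by simp
  have "\<exists>y. P y \<and> Q x y" if "P x" for x
    using desubstitution_label[of "snd x" "fst x"] that unfolding P_def Q_def by (metis fst_conv snd_conv)
  then obtain g where g: "g 0 = (v1, L1)" "\<And>n. P (g n)" "\<And>n. Q (g n) (g (Suc n))"
    using dependent_nat_choice[of "\<lambda>n x. P x \<and> (n = 0 \<longrightarrow> x = (v1, L1))" "\<lambda>_. Q"] P1 by auto
  then obtain s0 where s0: "\<And>n. Gedge (fst (g n)) (s0 n) (fst (g (Suc n)))" "\<And>n. s0 n \<in> SigmaS3Sigma"
     "\<And>n. snd (g n) = image_lang (s0 n) (snd (g (Suc n)))"
    unfolding Q_def by metis
  define v where "v n = fst (g (n - 1))" for n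
  define s where "s n = s0 (n - 1)" for n
  define d where "d = prepend_dir (perm p) s"
  \<comment> \<open>\<open>K 1\<close> is the language of \<open>X\<close>; from \<open>K 2\<close>
    on these are the languages in \<open>g\<close>, two indices behind because \<open>g\<close>
    starts at 0 and a permutation is prepended.\<close>
  define K where "K n = (if n \<le> 1 then L else snd (g (n - 2)))" for n
  have d: "d 1 = perm p" "\<And>n. n \<ge> 2 \<Longrightarrow> d n = s0 (n - 2)"
    by (auto simp: d_def prepend_dir_def s_def numeral_2_eq_2)
  have K: "urlang (K n)" for n using L g(2) by (simp add: K_def P_def)
  have pL: "L = image_lang (perm p) L1"
  proof -
    have "perm p = (\<lambda>x. [relabelling p x])" by (intro HOL.ext) (rule perm_apply)
    then have "image_lang (perm p) L1 = relabel (inv (relabelling p)) L1"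
      using image_lang_letters[OF h urlang_sublist] urlang_relabel[OF h L] unfolding L1_def by simp
    then show ?thesis unfolding L1_def by (simp add: relabel_def o_def bij_is_surj[OF h] surj_f_inv_f)
  qed
  have step: "K n = image_lang (d n) (K (Suc n))" if "n \<ge> 1" for n
  proof (cases "n = 1")
    case True
    then show ?thesis using d(1) pL g(1) by (simp add: K_def)
  next
    case False
    then have n: "n \<ge> 2" using that by simp
    then have "Suc n - 2 = Suc (n - 2)" by simp
    then show ?thesis using n d(2)[OF n] s0(3)[of "n - 2"] by (simp add: K_def)
  qed
  have first: "\<exists>c. \<forall>a. \<exists>x. d n a = c # x" if "n \<ge> 2" for n
    using Gedge_first_letter[OF s0(1)[of "n - 2"]] d(2)[OF that] by metis
  have ne: "non_erasing (d n)" if "n \<ge> 1" for n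
  proof (cases "n = 1")
    case True
    then show ?thesis using d(1) by (simp add: non_erasing_def perm_apply)
  next
    case False
    then have "n \<ge> 2" using that by simp
    then obtain c where "\<And>a. \<exists>x. d n a = c # x" using first by blast
    then show ?thesis unfolding non_erasing_def by (metis list.distinct(1))
  qed
  \<comment> \<open>Growth is first shown from level 2 on, since the images under the permutation at
    level 1 have no common first letter; level 1 then inherits it.\<close>
  have two': "\<exists>N>n. \<forall>a. 2 \<le> length (dseg d n N a)" if "n \<ge> 2" for n
    by (rule growth_levels[where k = 2 and L = K, OF K step ne first _ that]) simp_all
  have two: "\<exists>N>n. \<forall>a. 2 \<le> length (dseg d n N a)" if n: "n \<ge> 1" for n
  proof (cases "n = 1")
    case True
    obtain N where N: "N > 2" "\<And>a. 2 \<le> length (dseg d 2 N a)" using two'[of 2] by auto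
    have "length (dseg d 2 N a) \<le> length (dseg d 1 N a)" for a
      using dseg_trans_apply[of 1 2 N d a] N(1) dseg_Suc[of d 1] length_wmap_non_erasing[OF ne[of 1]]
      by (simp add: numeral_2_eq_2)
    then show ?thesis using N True by (intro exI[of _ N]) (auto intro: le_trans)
  qed (use two' n in simp)
  have lev: "primitive_dir d" "dlang d 1 = K 1"
    using directive_levels[of K d] K step ne two by blast+
  have "X = gen_shift d"
    using gen_shift_eq[of X d] X lev(2) unfolding shift_space_def by (simp add: K_def L_def)
  moreover have "\<forall>n\<ge>1. s n \<in> SigmaS3Sigma \<and> Gedge (v n) (s n) (v (Suc n))"
  proof (intro allI impI)
    fix n :: nat assume "1 \<le> n"
    then obtain m where "n = Suc m" by (cases n) auto
    then show "s n \<in> SigmaS3Sigma \<and> Gedge (v n) (s n) (v (Suc n))"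
      using s0 by (simp add: s_def v_def)
  qed
  ultimately show ?thesis using lev(1) Sigma3_perm[OF p(1)] unfolding d_def by blast
qed

theorem theorem1p1:
  fixes X :: "(int \<Rightarrow> letter) set"
  assumes "shift_space X"
  shows "(minimal_shift X \<and> dendric X) \<longleftrightarrow>
    (\<exists>p0 \<in> Sigma3. \<exists>(s :: nat \<Rightarrow> letter \<Rightarrow> letter list) (v :: nat \<Rightarrow> vtx).
       (\<forall>n\<ge>1. s n \<in> SigmaS3Sigma \<and> Gedge (v n) (s n) (v (Suc n))) \<and>
       primitive_dir (prepend_dir p0 s) \<and>
       X = gen_shift (prepend_dir p0 s))"
  using path_if_dendric[OF assms] dendric_if_path[OF assms] by blast

end
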